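(* Let $\lambda\ge0$ and $p_0=\frac{2\lambda}{2\lambda+1}$. For $p_0\le p\le\infty$ with $p>0$, the space $H^p_\lambda(\mathbb{D})$ is complete.
   Context: Fix $\lambda\ge0$; $\mathbb{D}$ is the open unit disk in $\mathbb{C}$. For a complex-valued function $f$ put $D_{\bar z}f(z)=\partial_{\bar z}f(z)-\lambda\frac{f(z)-f(\bar z)}{z-\bar z}$, $z=x+iy$ (at real points the quotient is read as its limit $-i\,\partial_y f$). A $C^2$ (real sense) function $f:\mathbb{D}\to\mathbb{C}$ is $\lambda$-analytic if $D_{\bar z}f=0$ in $\mathbb{D}$. $dm_\lambda(\theta)=\tilde c_\lambda|\sin\theta|^{2\lambda}d\theta$ on $[-\pi,\pi]$, $\tilde c_\lambda=c_\lambda/(2\lambda+2)$, $c_\lambda=\frac{\Gamma(\lambda+2)}{\Gamma(\lambda+1/2)\Gamma(1/2)}$. For $0<p<\infty$, $M_p(f;r)=\left\{\int_{-\pi}^{\pi}|f(re^{i\theta})|^pdm_\lambda(\theta)\right\}^{1/p}$, and $M_\infty(f;r)=\sup_\theta|f(re^{i\theta})|$. $H^p_\lambda(\mathbb{D})$ is the set of $\lambda$-analytic functions $f$ on $\mathbb{D}$ with $\|f\|_{H^p_\lambda}:=\sup_{0\le r<1}M_p(f;r)<\infty$. It is equipped with the norm $\|\cdot\|_{H^p_\lambda}$ if $p\ge1$, and with the metric $\|f-g\|^p_{H^p_\lambda}$ if $0<p<1$. *)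

theory Defs
  imports "HOL-Analysis.Analysis"
begin

abbreviation unit_disc :: "complex set" where
  "unit_disc \<equiv> ball 0 1"

text \<open>
  Twice continuously differentiable in the real sense: the type \<open>_ \<Rightarrow>\<^sub>L _\<close> consists of bounded
  \<^emph>\<open>real\<close>-linear maps, so \<open>f'\<close> and \<open>f''\<close> are the first and second Frechet derivatives of \<open>f\<close>,
  regarded as a function of two real variables.
\<close>
definition C2_on :: "(complex \<Rightarrow> complex) \<Rightarrow> complex set \<Rightarrow> bool" where
  "C2_on f S \<longleftrightarrow>
     (\<exists>(f' :: complex \<Rightarrow> complex \<Rightarrow>\<^sub>L complex) (f'' :: complex \<Rightarrow> complex \<Rightarrow>\<^sub>L complex \<Rightarrow>\<^sub>L complex).
        (\<forall>z\<in>S. (f has_derivative blinfun_apply (f' z)) (at z)) \<and>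
        (\<forall>z\<in>S. (f' has_derivative blinfun_apply (f'' z)) (at z)) \<and>
        continuous_on S f'')"

definition partial_x :: "(complex \<Rightarrow> complex) \<Rightarrow> complex \<Rightarrow> complex" where
  "partial_x f z = vector_derivative (\<lambda>t. f (z + complex_of_real t)) (at 0)"

definition partial_y :: "(complex \<Rightarrow> complex) \<Rightarrow> complex \<Rightarrow> complex" where
  "partial_y f z = vector_derivative (\<lambda>t. f (z + \<i> * complex_of_real t)) (at 0)"

definition partial_zbar :: "(complex \<Rightarrow> complex) \<Rightarrow> complex \<Rightarrow> complex" where
  "partial_zbar f z = (partial_x f z + \<i> * partial_y f z) / 2"

text \<open>At real points the difference quotient is replaced by its limit \<open>- \<i> \<partial>\<^sub>y f\<close>.\<close>
definition D_zbar :: "real \<Rightarrow> (complex \<Rightarrow> complex) \<Rightarrow> complex \<Rightarrow> complex" where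
  "D_zbar lam f z = partial_zbar f z - complex_of_real lam *
     (if z \<in> \<real> then - \<i> * partial_y f z else (f z - f (cnj z)) / (z - cnj z))"

definition lam_analytic :: "real \<Rightarrow> (complex \<Rightarrow> complex) \<Rightarrow> bool" where
  "lam_analytic lam f \<longleftrightarrow> C2_on f unit_disc \<and> (\<forall>z\<in>unit_disc. D_zbar lam f z = 0)"

definition c_lam :: "real \<Rightarrow> real" where
  "c_lam lam = Gamma (lam + 2) / (Gamma (lam + 1/2) * Gamma (1/2))"

definition c_tilde :: "real \<Rightarrow> real" where
  "c_tilde lam = c_lam lam / (2 * lam + 2)"

text \<open>
  Since \<open>0 powr 0 = 0\<close>, for \<open>lam = 0\<close> the density differs from the constant \<open>c_tilde 0\<close> at the
  zeros of \<open>sin\<close>; this is a null set, so the measure is the intended one.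
\<close>
definition m_lam :: "real \<Rightarrow> real measure" where
  "m_lam lam = density (restrict_space lborel {-pi..pi})
     (\<lambda>\<theta>. ennreal (c_tilde lam * \<bar>sin \<theta>\<bar> powr (2 * lam)))"

text \<open>
  The exponent \<open>p\<close> is an extended nonnegative real, so that \<open>p = \<infinity>\<close> is allowed. The functions
  considered below are continuous on the disc, so for \<open>0 < p < \<infinity>\<close> and \<open>0 \<le> r < 1\<close> the integrand
  is integrable and the Bochner integral has its usual meaning.
\<close>
definition M_mean :: "real \<Rightarrow> ennreal \<Rightarrow> (complex \<Rightarrow> complex) \<Rightarrow> real \<Rightarrow> ennreal" where
  "M_mean lam p f r =
     (if p = \<infinity> then (SUP \<theta>. ennreal (norm (f (complex_of_real r * cis \<theta>))))
      else ennreal ((\<integral>\<theta>. norm (f (complex_of_real r * cis \<theta>)) powr enn2real p \<partial>(m_lam lam))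
                      powr (1 / enn2real p)))"

definition Hardy_norm :: "real \<Rightarrow> ennreal \<Rightarrow> (complex \<Rightarrow> complex) \<Rightarrow> ennreal" where
  "Hardy_norm lam p f = (SUP r\<in>{0..<1}. M_mean lam p f r)"

text \<open>
  A function on the disc is represented by a total function that is \<open>undefined\<close> off the disc, so
  that functions agreeing on the disc are equal.
\<close>
definition Hardy_space :: "real \<Rightarrow> ennreal \<Rightarrow> (complex \<Rightarrow> complex) set" where
  "Hardy_space lam p =
     {f \<in> extensional unit_disc. lam_analytic lam f \<and> Hardy_norm lam p f < \<infinity>}"

definition Hardy_dist ::
    "real \<Rightarrow> ennreal \<Rightarrow> (complex \<Rightarrow> complex) \<Rightarrow> (complex \<Rightarrow> complex) \<Rightarrow> real" where
  "Hardy_dist lam p f g =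
     (if p < 1 then enn2real (Hardy_norm lam p (\<lambda>z. f z - g z)) powr enn2real p
      else enn2real (Hardy_norm lam p (\<lambda>z. f z - g z)))"

end

theory Submission
  imports Defs
begin

text \<open>
  Completeness rests on two facts about \<open>lam\<close>-analytic functions. The limit of a locally uniformly
  convergent sequence of \<open>lam\<close>-analytic functions is \<open>lam\<close>-analytic (\<open>lam_analytic_limit\<close>), and the
  values of a function on a compact subset of the disc are controlled by its Hardy means
  (\<open>point_estimate\<close>). A Cauchy sequence then converges locally uniformly to a \<open>lam\<close>-analytic function,
  and letting one index of \<open>F n - F k\<close> tend to infinity on each circle turns the Cauchy condition into
  convergence in the metric.

  Both facts come from an expansion \<open>f = (\<Sum>n. c n * phi lam n)\<close> in explicit homogeneous solutions
  \<open>phi lam n\<close>, polynomials in \<open>z\<close> and \<open>cnj z\<close>. In polar coordinates the equation says that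
  \<open>r * (d/dr) f\<close> is obtained from the restriction of \<open>f\<close> to a circle by a first order differential
  operator with a reflection term. This operator is symmetric for the weight \<open>\<bar>sin t\<bar> powr (2 * lam)\<close>
  (\<open>angular_selfadjoint\<close>), and \<open>phi lam n\<close> is an eigenfunction with eigenvalue \<open>n\<close>. Hence the moment of
  \<open>f\<close> against \<open>phi lam n\<close> on the circle of radius \<open>r\<close> is a constant times \<open>r ^ n\<close>, which yields
  the coefficients. That \<open>f\<close> is the sum of its series follows from a uniqueness statement
  (\<open>lam_analytic_unique\<close>): if all these moments vanish, then so do all trigonometric moments, those of
  negative frequency because they would have to grow like a negative power of \<open>r\<close> at the origin.

  The maximum of \<open>phi lam n\<close> on the unit circle exceeds its weighted \<open>L\<^sup>2\<close> norm at most by a power of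
  \<open>n\<close> (\<open>phi_norm2_ge\<close>). The expansion therefore bounds \<open>norm (f z)\<close> by a power of \<open>1 / (R - norm z)\<close>
  times the weighted \<open>L\<^sup>1\<close> mean of \<open>f\<close> over the circle of radius \<open>R\<close> (\<open>point_bound\<close>). For
  \<open>p \<ge> 1\<close> the \<open>L\<^sup>1\<close> mean is controlled by the mean of order \<open>p\<close>; for \<open>p < 1\<close> the polynomial rate
  of the bound allows the supremum of \<open>f\<close>, with a suitable weight, to be absorbed. The same bound,
  applied to the coefficients, lets them and the whole expansion pass to locally uniform limits; series
  of this kind are smooth because differentiation with respect to \<open>z\<close> or \<open>cnj z\<close> multiplies
  coefficients by at most the degree.
\<close>

section \<open>Series of homogeneous polynomials in z and its conjugate\<close>

text \<open>Real differentiability at \<open>z\<close>, where \<open>a\<close> and \<open>b\<close> are the derivatives with respect to \<open>z\<close> and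
  \<open>cnj z\<close>.\<close>
definition wirtinger :: "(complex \<Rightarrow> complex) \<Rightarrow> complex \<Rightarrow> complex \<Rightarrow> complex \<Rightarrow> bool" where
  "wirtinger f a b z \<longleftrightarrow> (f has_derivative (\<lambda>h. a * h + b * cnj h)) (at z)"

definition hom_form :: "nat \<Rightarrow> (nat \<Rightarrow> complex) \<Rightarrow> complex \<Rightarrow> complex" where
  "hom_form n b z = (\<Sum>j\<le>n. b j * z ^ (n - j) * cnj z ^ j)"

definition biseries :: "(nat \<Rightarrow> nat \<Rightarrow> complex) \<Rightarrow> complex \<Rightarrow> complex" where
  "biseries b z = (\<Sum>n. hom_form n (b n) z)"

definition bsum :: "(nat \<Rightarrow> nat \<Rightarrow> complex) \<Rightarrow> nat \<Rightarrow> real" where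
  "bsum b n = (\<Sum>j\<le>n. norm (b n j))"

definition disc_summable :: "(nat \<Rightarrow> real) \<Rightarrow> bool" where
  "disc_summable B \<longleftrightarrow> (\<forall>r. 0 \<le> r \<longrightarrow> r < 1 \<longrightarrow> summable (\<lambda>n. B n * r ^ n))"

definition diff_z :: "(nat \<Rightarrow> nat \<Rightarrow> complex) \<Rightarrow> nat \<Rightarrow> nat \<Rightarrow> complex" where
  "diff_z b n j = of_nat (Suc n - j) * b (Suc n) j"

definition diff_zbar :: "(nat \<Rightarrow> nat \<Rightarrow> complex) \<Rightarrow> nat \<Rightarrow> nat \<Rightarrow> complex" where
  "diff_zbar b n j = of_nat (Suc j) * b (Suc n) (Suc j)"

lemma norm_hom_le: "norm (hom_form n b z) \<le> (\<Sum>j\<le>n. norm (b j)) * norm z ^ n"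
proof -
  have "norm (hom_form n b z) \<le> (\<Sum>j\<le>n. norm (b j * z ^ (n - j) * cnj z ^ j))"
    unfolding hom_form_def by (rule norm_sum)
  also have "\<dots> = (\<Sum>j\<le>n. norm (b j) * norm z ^ n)"
    by (intro sum.cong refl) (simp add: norm_mult norm_power flip: power_add mult.assoc)
  finally show ?thesis by (simp add: sum_distrib_right)
qed

lemma bsum_nonneg: "0 \<le> bsum b n"
  unfolding bsum_def by (intro sum_nonneg) auto

lemma bsum_diff_z: "bsum (diff_z b) n \<le> real (Suc n) * bsum b (Suc n)"
proof -
  have "bsum (diff_z b) n \<le> (\<Sum>j\<le>n. real (Suc n) * norm (b (Suc n) j))"
    unfolding bsum_def diff_z_def norm_mult norm_of_nat
    by (intro sum_mono mult_right_mono) auto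
  also have "\<dots> \<le> (\<Sum>j\<le>Suc n. real (Suc n) * norm (b (Suc n) j))"
    by (intro sum_mono2) auto
  finally show ?thesis unfolding bsum_def sum_distrib_left .
qed

lemma bsum_diff_zbar: "bsum (diff_zbar b) n \<le> real (Suc n) * bsum b (Suc n)"
proof -
  have "bsum (diff_zbar b) n \<le> (\<Sum>j\<le>n. real (Suc n) * norm (b (Suc n) (Suc j)))"
    unfolding bsum_def diff_zbar_def norm_mult norm_of_nat
    by (intro sum_mono mult_right_mono) auto
  also have "\<dots> \<le> (\<Sum>j\<le>Suc n. real (Suc n) * norm (b (Suc n) j))"
    unfolding sum.atMost_Suc_shift by simp
  finally show ?thesis unfolding bsum_def sum_distrib_left .
qed

lemma disc_summable_mono:
  assumes "disc_summable B" "\<And>n. 0 \<le> A n" "\<And>n. A n \<le> B n"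
  shows "disc_summable A"
  unfolding disc_summable_def
proof (intro allI impI)
  fix r :: real assume r: "0 \<le> r" "r < 1"
  show "summable (\<lambda>n. A n * r ^ n)"
  proof (rule summable_comparison_test')
    show "summable (\<lambda>n. B n * r ^ n)" using assms r by (auto simp: disc_summable_def)
    show "norm (A n * r ^ n) \<le> B n * r ^ n" for n
      using assms(2,3)[of n] r by (simp add: abs_mult mult_right_mono)
  qed
qed

lemma disc_summable_diffs:
  assumes "disc_summable B" shows "disc_summable (\<lambda>n. real (Suc n) * B (Suc n))"
  unfolding disc_summable_def
proof (intro allI impI)
  fix r :: real assume r: "0 \<le> r" "r < 1"
  have "summable (\<lambda>n. diffs B n * r ^ n)"
  proof (rule termdiff_converges[where K = 1])
    show "norm r < 1" using r by simp
    fix x :: real assume x: "norm x < 1"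
    have "summable (\<lambda>n. B n * ((norm x + 1) / 2) ^ n)"
      using assms x by (auto simp: disc_summable_def)
    then have "summable (\<lambda>n. norm (B n * x ^ n))"
      by (rule powser_insidea) (use x in auto)
    then show "summable (\<lambda>n. B n * x ^ n)" by (rule summable_norm_cancel)
  qed
  then show "summable (\<lambda>n. real (Suc n) * B (Suc n) * r ^ n)" by (simp add: diffs_def)
qed

lemma disc_summable_diff_z:
  "disc_summable (bsum b) \<Longrightarrow> disc_summable (bsum (diff_z b))"
  by (rule disc_summable_mono[OF disc_summable_diffs])
    (auto simp: bsum_nonneg intro: order_trans[OF bsum_diff_z])

lemma disc_summable_diff_zbar:
  "disc_summable (bsum b) \<Longrightarrow> disc_summable (bsum (diff_zbar b))"
  by (rule disc_summable_mono[OF disc_summable_diffs])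
    (auto simp: bsum_nonneg intro: order_trans[OF bsum_diff_zbar])

lemma wirtinger_hom:
  "wirtinger (hom_form (Suc n) (b (Suc n))) (hom_form n (diff_z b n) z) (hom_form n (diff_zbar b n) z) z"
proof -
  let ?c = "b (Suc n)"
  have pw: "((\<lambda>z. z ^ m) has_derivative (\<lambda>h. of_nat m * z ^ (m - 1) * h)) (at z)" for m and z :: complex
    by (auto intro!: derivative_eq_intros simp: mult_ac)
  have pc: "((\<lambda>z. cnj z ^ m) has_derivative (\<lambda>h. of_nat m * cnj z ^ (m - 1) * cnj h)) (at z)" for m
    by (auto intro!: derivative_eq_intros simp: mult_ac)
  have "((\<lambda>z. \<Sum>j\<le>Suc n. ?c j * z ^ (Suc n - j) * cnj z ^ j) has_derivative
     (\<lambda>h. \<Sum>j\<le>Suc n. ?c j * z ^ (Suc n - j) * (of_nat j * cnj z ^ (j - 1) * cnj h)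
        + ?c j * (of_nat (Suc n - j) * z ^ (Suc n - j - 1) * h) * cnj z ^ j)) (at z)"
    by (intro has_derivative_sum has_derivative_mult has_derivative_mult_right pw pc)
  moreover have "(\<Sum>j\<le>Suc n. ?c j * z ^ (Suc n - j) * (of_nat j * cnj z ^ (j - 1) * cnj h)
        + ?c j * (of_nat (Suc n - j) * z ^ (Suc n - j - 1) * h) * cnj z ^ j)
      = hom_form n (diff_z b n) z * h + hom_form n (diff_zbar b n) z * cnj h" for h
  proof -
    have "(\<Sum>j\<le>Suc n. ?c j * z ^ (Suc n - j) * (of_nat j * cnj z ^ (j - 1) * cnj h))
        = hom_form n (diff_zbar b n) z * cnj h"
      unfolding sum.atMost_Suc_shift
      by (simp add: hom_form_def diff_zbar_def sum_distrib_left mult_ac del: of_nat_Suc)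
    moreover have "(\<Sum>j\<le>Suc n. ?c j * (of_nat (Suc n - j) * z ^ (Suc n - j - 1) * h) * cnj z ^ j)
        = hom_form n (diff_z b n) z * h"
      unfolding sum.atMost_Suc
      by (simp add: hom_form_def diff_z_def sum_distrib_left mult_ac Suc_diff_le del: of_nat_Suc)
    ultimately show ?thesis by (simp add: sum.distrib)
  qed
  ultimately show ?thesis by (simp add: wirtinger_def hom_form_def[abs_def])
qed

lemma summable_norm_hom:
  assumes "disc_summable (bsum b)" "norm z < 1"
  shows "summable (\<lambda>n. norm (hom_form n (b n) z))"
proof (rule summable_comparison_test')
  show "summable (\<lambda>n. bsum b n * norm z ^ n)" using assms by (auto simp: disc_summable_def)
  show "norm (norm (hom_form n (b n) z)) \<le> bsum b n * norm z ^ n" for n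
    using norm_hom_le[of n "b n" z] by (simp add: bsum_def)
qed

lemma summable_hom:
  assumes "disc_summable (bsum b)" "norm z < 1"
  shows "summable (\<lambda>n. hom_form n (b n) z)"
  using summable_norm_hom[OF assms] by (rule summable_norm_cancel)

lemma uniform_limit_biseries:
  assumes "disc_summable (bsum b)" "0 \<le> r" "r < 1"
  shows "uniform_limit (cball 0 r) (\<lambda>n z. \<Sum>i<n. hom_form i (b i) z) (biseries b) sequentially"
  unfolding biseries_def[abs_def]
proof (rule Weierstrass_m_test)
  show "summable (\<lambda>n. bsum b n * r ^ n)" using assms by (auto simp: disc_summable_def)
  fix n and z :: complex assume "z \<in> cball 0 r"
  then have "norm z ^ n \<le> r ^ n" by (intro power_mono) auto
  then show "norm (hom_form n (b n) z) \<le> bsum b n * r ^ n"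
    using norm_hom_le[of n "b n" z] mult_left_mono[OF _ bsum_nonneg[of b n]]
    by (fastforce simp: bsum_def intro: order_trans)
qed

text \<open>Both derivatives are series of the same kind, with absolutely summable coefficients on the same disc, so
  that the statement can be iterated.\<close>
lemma wirtinger_biseries:
  assumes b: "disc_summable (bsum b)" and z: "norm z < 1"
  shows "wirtinger (biseries b) (biseries (diff_z b) z) (biseries (diff_zbar b) z) z"
proof -
  define r where "r = (1 + norm z) / 2"
  have r: "0 \<le> r" "r < 1" "norm z < r" using z by (auto simp: r_def)
  let ?f' = "\<lambda>n w h. hom_form n (diff_z b n) w * h + hom_form n (diff_zbar b n) w * cnj h"
  let ?g' = "\<lambda>w h. biseries (diff_z b) w * h + biseries (diff_zbar b) w * cnj h"
  have "\<exists>g. \<forall>w\<in>ball 0 r. (\<lambda>n. hom_form (Suc n) (b (Suc n)) w) sums g w \<and>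
            (g has_derivative ?g' w) (at w within ball 0 r)"
  proof (rule has_derivative_series[where f' = ?f'])
    show "convex (ball (0::complex) r)" by simp
    show "(hom_form (Suc n) (b (Suc n)) has_derivative ?f' n w) (at w within ball 0 r)" for n w
      using wirtinger_hom[of n b w] by (auto simp: wirtinger_def intro: has_derivative_at_withinI)
    show "z \<in> ball 0 r" using r by simp
    show "(\<lambda>n. hom_form (Suc n) (b (Suc n)) z) sums (\<Sum>n. hom_form (Suc n) (b (Suc n)) z)"
      using summable_hom[OF b z] by (intro summable_sums iffD2[OF summable_Suc_iff[of "\<lambda>n. hom_form n (b n) z"]])
    fix e :: real assume e: "e > 0"
    have 1: "\<forall>\<^sub>F n in sequentially. \<forall>w\<in>cball 0 r. dist (\<Sum>i<n. hom_form i (diff_z b i) w) (biseries (diff_z b) w) < e/2"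
      using uniform_limitD[OF uniform_limit_biseries[OF disc_summable_diff_z[OF b] r(1,2)], of "e/2"] e by simp
    have 2: "\<forall>\<^sub>F n in sequentially. \<forall>w\<in>cball 0 r. dist (\<Sum>i<n. hom_form i (diff_zbar b i) w) (biseries (diff_zbar b) w) < e/2"
      using uniform_limitD[OF uniform_limit_biseries[OF disc_summable_diff_zbar[OF b] r(1,2)], of "e/2"] e by simp
    show "\<forall>\<^sub>F n in sequentially. \<forall>w\<in>ball 0 r. \<forall>h. norm ((\<Sum>i<n. ?f' i w h) - ?g' w h) \<le> e * norm h"
      using 1 2
    proof eventually_elim
      case (elim n)
      show ?case
      proof (intro ballI allI)
        fix w h :: complex assume w: "w \<in> ball 0 r"
        let ?A = "(\<Sum>i<n. hom_form i (diff_z b i) w) - biseries (diff_z b) w"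
        let ?B = "(\<Sum>i<n. hom_form i (diff_zbar b i) w) - biseries (diff_zbar b) w"
        have AB: "norm ?A \<le> e/2" "norm ?B \<le> e/2"
          using bspec[OF elim(1), of w] bspec[OF elim(2), of w] w by (simp_all add: dist_norm)
        have "(\<Sum>i<n. ?f' i w h) - ?g' w h = ?A * h + ?B * cnj h"
          unfolding sum.distrib sum_distrib_right[symmetric] left_diff_distrib by simp
        then have "norm ((\<Sum>i<n. ?f' i w h) - ?g' w h) \<le> norm ?A * norm h + norm ?B * norm h"
          using norm_triangle_ineq[of "?A * h" "?B * cnj h"] by (simp only: norm_mult complex_mod_cnj)
        also have "\<dots> \<le> e/2 * norm h + e/2 * norm h"
          by (intro add_mono mult_right_mono AB) auto
        finally show "norm ((\<Sum>i<n. ?f' i w h) - ?g' w h) \<le> e * norm h" by simp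
      qed
    qed
  qed
  then obtain g where g: "\<And>w. w \<in> ball 0 r \<Longrightarrow> (\<lambda>n. hom_form (Suc n) (b (Suc n)) w) sums g w"
    "\<And>w. w \<in> ball 0 r \<Longrightarrow> (g has_derivative ?g' w) (at w within ball 0 r)" by blast
  have "(g has_derivative ?g' z) (at z)"
    using g(2)[of z] r at_within_open[of z "ball 0 r"] by simp
  then have "((\<lambda>w. g w + b 0 0) has_derivative ?g' z) (at z)"
    by (auto intro!: derivative_eq_intros)
  then have "(biseries b has_derivative ?g' z) (at z)"
  proof (rule has_derivative_transform_within_open)
    show "open (ball (0::complex) r)" "z \<in> ball 0 r" using r by auto
    fix w :: complex assume w: "w \<in> ball 0 r"
    have "(\<lambda>n. hom_form n (b n) w) sums (g w + hom_form 0 (b 0) w)"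
      using g(1)[OF w] by (rule sums_Suc)
    then show "g w + b 0 0 = biseries b w"
      by (simp add: biseries_def sums_iff hom_form_def)
  qed
  then show ?thesis by (simp add: wirtinger_def)
qed

lemma wirtinger_continuous: "wirtinger f a b z \<Longrightarrow> isCont f z"
  unfolding wirtinger_def using has_derivative_continuous by blast

lemma continuous_on_biseries:
  "disc_summable (bsum b) \<Longrightarrow> continuous_on unit_disc (biseries b)"
  using wirtinger_biseries wirtinger_continuous
  by (metis continuous_at_imp_continuous_on dist_0_norm mem_ball)

definition wirt_blinfun :: "complex \<Rightarrow> complex \<Rightarrow> complex \<Rightarrow>\<^sub>L complex" where
  "wirt_blinfun a b = blinfun_mult_right a + (blinfun_mult_right b o\<^sub>L Blinfun cnj)"

lemma wirt_blinfun_apply: "blinfun_apply (wirt_blinfun a b) h = a * h + b * cnj h"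
  by (simp add: wirt_blinfun_def blinfun.bilinear_simps bounded_linear_Blinfun_apply[OF bounded_linear_cnj])

lemma C2_on_biseries:
  assumes b: "disc_summable (bsum b)"
  shows "C2_on (biseries b) unit_disc"
proof -
  let ?z = "\<lambda>b. biseries (diff_z b)" and ?w = "\<lambda>b. biseries (diff_zbar b)"
  let ?T1 = "Blinfun (\<lambda>a. wirt_blinfun a 0)" and ?T2 = "Blinfun (\<lambda>a. wirt_blinfun 0 a)"
  have T1: "bounded_linear (\<lambda>a. wirt_blinfun a 0)" and T2: "bounded_linear (\<lambda>a. wirt_blinfun 0 a)"
  proof -
    have "(\<lambda>a. wirt_blinfun a 0) = blinfun_mult_right"
      by (intro ext blinfun_eqI) (simp add: wirt_blinfun_apply)
    then show "bounded_linear (\<lambda>a. wirt_blinfun a 0)"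
      by (simp add: bounded_linear_blinfun_mult_right)
    have "(\<lambda>a. wirt_blinfun 0 a) = (\<lambda>a. blinfun_mult_right a o\<^sub>L Blinfun cnj)"
      by (intro ext blinfun_eqI)
        (simp add: wirt_blinfun_apply bounded_linear_Blinfun_apply[OF bounded_linear_cnj])
    then show "bounded_linear (\<lambda>a. wirt_blinfun 0 a)"
      by (simp add: bounded_linear_compose[OF
         bounded_bilinear.bounded_linear_left[OF bounded_bilinear_blinfun_compose]
         bounded_linear_blinfun_mult_right])
  qed
  define f' where "f' z = wirt_blinfun (?z b z) (?w b z)" for z
  define f'' where "f'' z = (?T1 o\<^sub>L wirt_blinfun (?z (diff_z b) z) (?w (diff_z b) z))
     + (?T2 o\<^sub>L wirt_blinfun (?z (diff_zbar b) z) (?w (diff_zbar b) z))" for z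
  note bs = b disc_summable_diff_z[OF b] disc_summable_diff_zbar[OF b]
  have split: "wirt_blinfun a c = wirt_blinfun a 0 + wirt_blinfun 0 c" for a c
    by (rule blinfun_eqI) (simp add: wirt_blinfun_apply blinfun.bilinear_simps)
  have "(biseries b has_derivative blinfun_apply (f' z)) (at z)" if "z \<in> unit_disc" for z
    using wirtinger_biseries[OF b, of z] that
    by (simp add: wirtinger_def f'_def wirt_blinfun_apply[abs_def])
  moreover have "(f' has_derivative blinfun_apply (f'' z)) (at z)" if "z \<in> unit_disc" for z
  proof -
    have der: "((\<lambda>z. wirt_blinfun (?z b z) 0 + wirt_blinfun 0 (?w b z)) has_derivative
        (\<lambda>h. wirt_blinfun (?z (diff_z b) z * h + ?w (diff_z b) z * cnj h) 0
           + wirt_blinfun 0 (?z (diff_zbar b) z * h + ?w (diff_zbar b) z * cnj h))) (at z)"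
      by (intro has_derivative_add bounded_linear.has_derivative[OF T1]
         bounded_linear.has_derivative[OF T2])
       (use wirtinger_biseries[OF bs(2), of z] wirtinger_biseries[OF bs(3), of z] that
         in \<open>simp_all add: wirtinger_def\<close>)
    have eq1: "blinfun_apply (f'' z) =
        (\<lambda>h. wirt_blinfun (?z (diff_z b) z * h + ?w (diff_z b) z * cnj h) 0
           + wirt_blinfun 0 (?z (diff_zbar b) z * h + ?w (diff_zbar b) z * cnj h))"
      by (rule ext) (simp only: f''_def blinfun.add_left blinfun_apply_blinfun_compose
          wirt_blinfun_apply bounded_linear_Blinfun_apply[OF T1] bounded_linear_Blinfun_apply[OF T2])
    have eq2: "f' = (\<lambda>z. wirt_blinfun (?z b z) 0 + wirt_blinfun 0 (?w b z))"
      unfolding f'_def[abs_def] by (rule ext) (rule split)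
    show ?thesis unfolding eq1 unfolding eq2 by (rule der)
  qed
  moreover have "continuous_on unit_disc f''"
    unfolding f''_def[abs_def] wirt_blinfun_def
    by (intro continuous_intros continuous_on_biseries disc_summable_diff_z disc_summable_diff_zbar bs
       bounded_linear.continuous_on[OF bounded_linear_blinfun_mult_right])
  ultimately show ?thesis unfolding C2_on_def
    by (intro exI[of _ f'] exI[of _ f''] conjI ballI)
qed

section \<open>Generalized analytic functions through Wirtinger derivatives\<close>

lemma wirtinger_direction:
  assumes "wirtinger f a b z"
  shows "((\<lambda>t. f (z + v * complex_of_real t)) has_vector_derivative (a * v + b * cnj v)) (at 0)"
proof -
  have d: "(f has_derivative (\<lambda>h. a * h + b * cnj h)) (at z)"
    using assms by (simp add: wirtinger_def)
  have "((\<lambda>t. z + v * complex_of_real t) has_vector_derivative v) (at 0)"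
    by (auto intro!: derivative_eq_intros)
  from has_derivative_compose[OF this[unfolded has_vector_derivative_def], of f "\<lambda>h. a * h + b * cnj h"] d
  show ?thesis
    by (simp add: has_vector_derivative_def scaleR_conv_of_real algebra_simps)
qed

lemma wirtinger_partials:
  assumes "wirtinger f a b z"
  shows "((\<lambda>t. f (z + complex_of_real t)) has_vector_derivative (a + b)) (at 0)"
    and "((\<lambda>t. f (z + \<i> * complex_of_real t)) has_vector_derivative (\<i> * (a - b))) (at 0)"
  using wirtinger_direction[OF assms, of 1] wirtinger_direction[OF assms, of \<i>]
  by (simp_all add: algebra_simps)

lemma partial_y_wirtinger: "wirtinger f a b z \<Longrightarrow> partial_y f z = \<i> * (a - b)"
  unfolding partial_y_def by (rule vector_derivative_at[OF wirtinger_partials(2)])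

lemma partial_zbar_wirtinger:
  assumes "wirtinger f a b z" shows "partial_zbar f z = b"
  unfolding partial_zbar_def partial_x_def partial_y_wirtinger[OF assms]
    vector_derivative_at[OF wirtinger_partials(1)[OF assms]]
  by (simp add: algebra_simps)

text \<open>Clearing the denominator \<open>z - cnj z\<close> gives an equation without case distinction, which is trivial at
  real points.\<close>
lemma lam_analyticD:
  assumes "lam_analytic lam f"
  obtains fz fb where "\<And>z. z \<in> unit_disc \<Longrightarrow> wirtinger f (fz z) (fb z) z"
    "continuous_on unit_disc fz" "continuous_on unit_disc fb"
    "\<And>z. z \<in> unit_disc \<Longrightarrow> (z - cnj z) * fb z = complex_of_real lam * (f z - f (cnj z))"
proof -
  obtain f' :: "complex \<Rightarrow> complex \<Rightarrow>\<^sub>L complex" and f'' :: "complex \<Rightarrow> complex \<Rightarrow>\<^sub>L complex \<Rightarrow>\<^sub>L complex"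
    where f': "\<And>z. z \<in> unit_disc \<Longrightarrow> (f has_derivative blinfun_apply (f' z)) (at z)"
      and f'': "\<And>z. z \<in> unit_disc \<Longrightarrow> (f' has_derivative blinfun_apply (f'' z)) (at z)"
    using assms unfolding lam_analytic_def C2_on_def by blast
  define fz where "fz z = (f' z 1 - \<i> * f' z \<i>) / 2" for z
  define fb where "fb z = (f' z 1 + \<i> * f' z \<i>) / 2" for z
  have cf': "continuous_on unit_disc f'"
    using f'' has_derivative_continuous by (blast intro: continuous_at_imp_continuous_on)
  have w: "wirtinger f (fz z) (fb z) z" if "z \<in> unit_disc" for z
  proof -
    have "blinfun_apply (f' z) = (\<lambda>h. fz z * h + fb z * cnj h)"
    proof
      fix h
      have "h = Re h *\<^sub>R 1 + Im h *\<^sub>R \<i>" by (simp add: complex_eq_iff)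
      then have "f' z h = f' z (Re h *\<^sub>R 1 + Im h *\<^sub>R \<i>)" by metis
      also have "\<dots> = of_real (Re h) * f' z 1 + of_real (Im h) * f' z \<i>"
        unfolding blinfun.add_right blinfun.scaleR_right by (simp add: scaleR_conv_of_real)
      also have "\<dots> = fz z * h + fb z * cnj h"
        by (simp add: fz_def fb_def complex_eq_iff algebra_simps) (simp add: field_simps)
      finally show "f' z h = fz z * h + fb z * cnj h" .
    qed
    then show ?thesis using f'[OF that] by (simp add: wirtinger_def)
  qed
  have "(z - cnj z) * fb z = complex_of_real lam * (f z - f (cnj z))" if z: "z \<in> unit_disc" for z
  proof (cases "z \<in> \<real>")
    case True
    then show ?thesis by (auto elim!: Reals_cases)
  next
    case False
    then have "z - cnj z \<noteq> 0" using complex_is_Real_iff by (auto simp: complex_eq_iff)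
    moreover have "fb z - of_real lam * ((f z - f (cnj z)) / (z - cnj z)) = 0"
    proof -
      have "D_zbar lam f z = 0" using assms z by (simp add: lam_analytic_def)
      then show ?thesis using False by (simp add: D_zbar_def partial_zbar_wirtinger[OF w[OF z]])
    qed
    ultimately show ?thesis by (simp add: field_simps)
  qed
  moreover have "continuous_on unit_disc fz" "continuous_on unit_disc fb"
    unfolding fz_def[abs_def] fb_def[abs_def] by (auto intro!: continuous_intros cf')
  ultimately show ?thesis using that w by blast
qed

text \<open>At a real point the equation is obtained by dividing
  \<open>(z - cnj z) * fb z = lam * (f z - f (cnj z))\<close> by the imaginary part and letting it tend to 0, so the
  equation in product form carries all the information.\<close>
lemma lam_analyticI:
  assumes C2: "C2_on f unit_disc"
    and w: "\<And>z. z \<in> unit_disc \<Longrightarrow> wirtinger f (fz z) (fb z) z"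
    and cont: "continuous_on unit_disc fb"
    and eq: "\<And>z. z \<in> unit_disc \<Longrightarrow> (z - cnj z) * fb z = complex_of_real lam * (f z - f (cnj z))"
  shows "lam_analytic lam f"
  unfolding lam_analytic_def
proof (intro conjI C2 ballI)
  fix z assume z: "z \<in> unit_disc"
  show "D_zbar lam f z = 0"
  proof (cases "z \<in> \<real>")
    case False
    then have "z - cnj z \<noteq> 0" using complex_is_Real_iff by (auto simp: complex_eq_iff)
    then show ?thesis using eq[OF z] False
      by (simp add: D_zbar_def partial_zbar_wirtinger[OF w[OF z]] field_simps)
  next
    case True
    then have cz: "cnj z = z" using Reals_cnj_iff by blast
    let ?G = "\<lambda>t. of_real lam * (f (z + \<i> * complex_of_real t) - f (z + \<i> * complex_of_real (- t)))"
    have d: "((\<lambda>t. f (z + \<i> * complex_of_real t)) has_vector_derivative partial_y f z) (at 0)"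
      using wirtinger_partials(2)[OF w[OF z]] partial_y_wirtinger[OF w[OF z]] by simp
    have d': "((\<lambda>t. f (z + \<i> * complex_of_real (- t))) has_vector_derivative - partial_y f z) (at 0)"
      using wirtinger_direction[OF w[OF z], of "- \<i>"] unfolding partial_y_wirtinger[OF w[OF z]]
      by (simp add: algebra_simps)
    have "(?G has_vector_derivative of_real lam * (partial_y f z - - partial_y f z)) (at 0)"
      by (intro has_vector_derivative_mult_right has_vector_derivative_diff d d')
    then have G1: "(?G has_vector_derivative of_real lam * (2 * partial_y f z)) (at 0)"
      by (simp only: diff_minus_eq_add mult_2)
    have near: "\<forall>\<^sub>F t in at 0. z + \<i> * complex_of_real t \<in> unit_disc"
    proof (rule topological_tendstoD)
      show "((\<lambda>t. z + \<i> * complex_of_real t) \<longlongrightarrow> z) (at 0)"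
        by (auto intro!: tendsto_eq_intros)
    qed (use z in auto)
    have "isCont fb z" using cont z continuous_on_eq_continuous_at[OF open_ball] by blast
    then have lim: "((\<lambda>t. fb (z + \<i> * complex_of_real t)) \<longlongrightarrow> fb z) (at 0)"
      by (rule isCont_tendsto_compose) (auto intro!: tendsto_eq_intros)
    have Geq: "\<forall>\<^sub>F t in at 0. ?G t = 2 * \<i> * complex_of_real t * fb (z + \<i> * complex_of_real t)"
      using near
    proof eventually_elim
      case (elim t)
      show ?case using eq[OF elim] cz by (simp add: mult.assoc)
    qed
    have G2: "(?G has_vector_derivative 2 * \<i> * fb z) (at 0)"
      unfolding has_vector_derivative_def has_derivative_at
    proof (intro conjI)
      show "bounded_linear (\<lambda>x. x *\<^sub>R (2 * \<i> * fb z))" by (rule bounded_linear_scaleR_left)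
      have "((\<lambda>t. 2 * norm (fb (z + \<i> * complex_of_real t) - fb z)) \<longlongrightarrow> 2 * norm (fb z - fb z)) (at 0)"
        by (intro tendsto_intros lim)
      moreover have "\<forall>\<^sub>F t in at 0. 2 * norm (fb (z + \<i> * complex_of_real t) - fb z)
           = norm (?G (0 + t) - ?G 0 - t *\<^sub>R (2 * \<i> * fb z)) / norm t"
        using Geq eventually_at_ball'[of 1 "0::real" UNIV, simplified]
      proof eventually_elim
        case (elim t)
        have "?G (0 + t) - ?G 0 - t *\<^sub>R (2 * \<i> * fb z)
            = 2 * \<i> * complex_of_real t * (fb (z + \<i> * complex_of_real t) - fb z)"
          using elim by (simp add: scaleR_conv_of_real algebra_simps)
        then show ?case using elim by (simp add: norm_mult)
      qed
      ultimately show "((\<lambda>t. norm (?G (0 + t) - ?G 0 - t *\<^sub>R (2 * \<i> * fb z)) / norm t) \<longlongrightarrow> 0) (at 0)"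
        using Lim_transform_eventually by fastforce
    qed
    have "of_real lam * (2 * partial_y f z) = 2 * \<i> * fb z"
      using vector_derivative_at[OF G1] vector_derivative_at[OF G2] by simp
    then have "of_real lam * partial_y f z = \<i> * fb z" by simp
    then have "of_real lam * (- \<i> * partial_y f z) = - \<i> * (\<i> * fb z)"
      by (simp only: mult.left_commute[of "of_real lam" "- \<i>"])
    also have "\<dots> = fb z" by simp
    finally show ?thesis using True
      by (simp only: D_zbar_def partial_zbar_wirtinger[OF w[OF z]] if_True diff_self)
  qed
qed

lemma lam_analytic_diff:
  assumes f: "lam_analytic lam f" and g: "lam_analytic lam g"
  shows "lam_analytic lam (\<lambda>z. f z - g z)"
proof -
  obtain fz fb where f1: "\<And>z. z \<in> unit_disc \<Longrightarrow> wirtinger f (fz z) (fb z) z"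
    "continuous_on unit_disc fb"
    "\<And>z. z \<in> unit_disc \<Longrightarrow> (z - cnj z) * fb z = complex_of_real lam * (f z - f (cnj z))"
    using lam_analyticD[OF f] by metis
  obtain gz gb where g1: "\<And>z. z \<in> unit_disc \<Longrightarrow> wirtinger g (gz z) (gb z) z"
    "continuous_on unit_disc gb"
    "\<And>z. z \<in> unit_disc \<Longrightarrow> (z - cnj z) * gb z = complex_of_real lam * (g z - g (cnj z))"
    using lam_analyticD[OF g] by metis
  have C2: "C2_on (\<lambda>z. f z - g z) unit_disc"
  proof -
    obtain f' f'' g' g'' where
      "\<And>z. z \<in> unit_disc \<Longrightarrow> (f has_derivative blinfun_apply (f' z)) (at z)"
      "\<And>z. z \<in> unit_disc \<Longrightarrow> (f' has_derivative blinfun_apply (f'' z)) (at z)"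
      "continuous_on unit_disc f''"
      "\<And>z. z \<in> unit_disc \<Longrightarrow> (g has_derivative blinfun_apply (g' z)) (at z)"
      "\<And>z. z \<in> unit_disc \<Longrightarrow> (g' has_derivative blinfun_apply (g'' z)) (at z)"
      "continuous_on unit_disc g''"
      using f g unfolding lam_analytic_def C2_on_def by metis
    then show ?thesis unfolding C2_on_def
      by (intro exI[of _ "\<lambda>z. f' z - g' z"] exI[of _ "\<lambda>z. f'' z - g'' z"])
        (auto simp: minus_blinfun.rep_eq intro!: has_derivative_diff continuous_intros)
  qed
  show ?thesis
  proof (rule lam_analyticI[OF C2])
    show "wirtinger (\<lambda>z. f z - g z) (fz z - gz z) (fb z - gb z) z" if "z \<in> unit_disc" for z
      using has_derivative_diff[OF f1(1)[OF that, unfolded wirtinger_def] g1(1)[OF that, unfolded wirtinger_def]]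
      by (simp add: wirtinger_def algebra_simps)
    show "continuous_on unit_disc (\<lambda>z. fb z - gb z)" by (intro continuous_intros f1 g1)
  qed (simp add: f1 g1 right_diff_distrib)
qed

lemma lam_analytic_cong:
  assumes f: "lam_analytic lam f" and fg: "\<And>z. z \<in> unit_disc \<Longrightarrow> f z = g z"
  shows "lam_analytic lam g"
proof -
  obtain fz fb where f1: "\<And>z. z \<in> unit_disc \<Longrightarrow> wirtinger f (fz z) (fb z) z"
    "continuous_on unit_disc fb"
    "\<And>z. z \<in> unit_disc \<Longrightarrow> (z - cnj z) * fb z = complex_of_real lam * (f z - f (cnj z))"
    using lam_analyticD[OF f] by metis
  have tr: "(g has_derivative D) (at z)" if "(f has_derivative D) (at z)" "z \<in> unit_disc" for z D
    using has_derivative_transform_within_open[OF that(1) open_ball that(2) fg] .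
  have C2: "C2_on g unit_disc"
    using f tr unfolding lam_analytic_def C2_on_def by meson
  show ?thesis
    by (rule lam_analyticI[OF C2 _ f1(2), where fz = fz]) (use f1 fg tr in \<open>auto simp: wirtinger_def\<close>)
qed

lemma lam_analytic_continuous: "lam_analytic lam f \<Longrightarrow> continuous_on unit_disc f"
  by (metis lam_analyticD wirtinger_continuous continuous_at_imp_continuous_on)

section \<open>The homogeneous solutions\<close>

text \<open>\<open>bc lam n\<close> is \<open>pochhammer (lam + 1) n / fact n\<close> and \<open>ac lam n\<close> is \<open>pochhammer lam n / fact n\<close>; writing
  the latter as a difference of values of the former makes \<open>phi_Suc_eq\<close> a rearrangement.\<close>
fun bc :: "real \<Rightarrow> nat \<Rightarrow> real" where
  "bc lam 0 = 1"
| "bc lam (Suc n) = (lam + 1 + real n) / (real n + 1) * bc lam n"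

definition ac :: "real \<Rightarrow> nat \<Rightarrow> real" where
  "ac lam j = (case j of 0 \<Rightarrow> 1 | Suc k \<Rightarrow> bc lam (Suc k) - bc lam k)"

definition phi_coeff :: "real \<Rightarrow> nat \<Rightarrow> nat \<Rightarrow> real" where
  "phi_coeff lam n j = ac lam j * bc lam (n - j)"

definition phi :: "real \<Rightarrow> nat \<Rightarrow> complex \<Rightarrow> complex" where
  "phi lam n = hom_form n (\<lambda>j. of_real (phi_coeff lam n j))"

definition phi_mass :: "real \<Rightarrow> nat \<Rightarrow> real" where
  "phi_mass lam n = (\<Sum>j\<le>n. phi_coeff lam n j)"

definition phi_series :: "real \<Rightarrow> (nat \<Rightarrow> complex) \<Rightarrow> complex \<Rightarrow> complex" where
  "phi_series lam c = biseries (\<lambda>n j. c n * of_real (phi_coeff lam n j))"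

lemma bc_pos: "0 \<le> lam \<Longrightarrow> 0 < bc lam n"
  by (induction n) auto

lemma ac_Suc: "real (Suc k) * ac lam (Suc k) = lam * bc lam k"
  by (simp add: ac_def field_simps)

lemma ac_nonneg: "0 \<le> lam \<Longrightarrow> 0 \<le> ac lam j"
  using ac_Suc[of "j - 1" lam] bc_pos[of lam "j - 1"]
  by (cases j) (auto simp: ac_def field_simps)

lemma phi_coeff_nonneg: "0 \<le> lam \<Longrightarrow> 0 \<le> phi_coeff lam n j"
  by (simp add: phi_coeff_def ac_nonneg bc_pos less_imp_le)

lemma phi_mass_pos:
  assumes "0 \<le> lam" shows "0 < phi_mass lam n"
  unfolding phi_mass_def
proof (rule sum_pos2[where i = 0])
  show "0 < phi_coeff lam n 0"
    using assms by (simp add: phi_coeff_def ac_def bc_pos)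
qed (use assms in \<open>auto simp: phi_coeff_nonneg\<close>)

lemma phi_0: "phi lam 0 z = 1"
  by (simp add: phi_def hom_form_def phi_coeff_def ac_def)

lemma norm_phi_le: "0 \<le> lam \<Longrightarrow> norm (phi lam n z) \<le> phi_mass lam n * norm z ^ n"
  unfolding phi_def phi_mass_def
  by (rule order_trans[OF norm_hom_le]) (simp add: phi_coeff_nonneg)

lemma hom_cmult: "hom_form n (\<lambda>j. c * b j) z = c * hom_form n b z"
  by (simp add: hom_form_def sum_distrib_left mult_ac)

lemma hom_scale: "hom_form n b (of_real r * z) = of_real (r ^ n) * hom_form n b z"
  unfolding hom_form_def sum_distrib_left
proof (intro sum.cong refl)
  fix j assume "j \<in> {..n}"
  then have "complex_of_real r ^ n = of_real r ^ (n - j) * of_real r ^ j" by (simp flip: power_add)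
  then show "b j * (of_real r * z) ^ (n - j) * cnj (of_real r * z) ^ j
      = of_real (r ^ n) * (b j * z ^ (n - j) * cnj z ^ j)"
    by (simp add: power_mult_distrib)
qed

lemma phi_scale: "phi lam n (of_real r * z) = of_real (r ^ n) * phi lam n z"
  unfolding phi_def by (rule hom_scale)

abbreviation sym_hom :: "real \<Rightarrow> nat \<Rightarrow> complex \<Rightarrow> complex" where
  "sym_hom lam n \<equiv> hom_form n (\<lambda>j. of_real (bc lam j * bc lam (n - j)))"

lemma sym_hom_cnj: "sym_hom lam n (cnj z) = sym_hom lam n z"
  unfolding hom_form_def by (rule sum.reindex_bij_witness[of _ "\<lambda>j. n - j" "\<lambda>j. n - j"]) auto

lemma phi_Suc_eq: "phi lam (Suc n) z = sym_hom lam (Suc n) z - cnj z * sym_hom lam n z"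
  unfolding phi_def phi_coeff_def hom_form_def sum.atMost_Suc_shift
  by (simp add: ac_def algebra_simps sum_distrib_left sum_subtractf del: bc.simps(2))

text \<open>The difference \<open>phi - phi \<circ> cnj\<close> is divisible by \<open>z - cnj z\<close> because \<open>phi\<close> differs from a
  polynomial symmetric in \<open>z\<close> and \<open>cnj z\<close> by \<open>cnj z\<close> times another such polynomial; the latter is also,
  up to the factor \<open>lam\<close>, the derivative with respect to \<open>cnj z\<close>.\<close>
lemma phi_diff_cnj: "phi lam (Suc n) z - phi lam (Suc n) (cnj z) = (z - cnj z) * sym_hom lam n z"
  unfolding phi_Suc_eq sym_hom_cnj by (simp add: algebra_simps)

lemma diff_zbar_phi_series:
  "hom_form n (diff_zbar (\<lambda>n j. c n * of_real (phi_coeff lam n j)) n) z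
     = of_real lam * c (Suc n) * sym_hom lam n z"
proof -
  have "diff_zbar (\<lambda>n j. c n * of_real (phi_coeff lam n j)) n j
      = of_real lam * c (Suc n) * of_real (bc lam j * bc lam (n - j))" for j
  proof -
    have "diff_zbar (\<lambda>n j. c n * of_real (phi_coeff lam n j)) n j
        = c (Suc n) * of_real (real (Suc j) * ac lam (Suc j) * bc lam (n - j))"
      unfolding diff_zbar_def phi_coeff_def by (simp del: of_nat_Suc)
    then show ?thesis unfolding ac_Suc by simp
  qed
  then show ?thesis using hom_cmult by presburger
qed

lemma bsum_phi_series:
  "0 \<le> lam \<Longrightarrow> bsum (\<lambda>n j. c n * of_real (phi_coeff lam n j)) = (\<lambda>n. norm (c n) * phi_mass lam n)"
  by (rule ext) (simp add: bsum_def phi_mass_def norm_mult phi_coeff_nonneg sum_distrib_left)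

lemma phi_series_sums:
  assumes "0 \<le> lam" "disc_summable (\<lambda>n. norm (c n) * phi_mass lam n)" "norm z < 1"
  shows "(\<lambda>n. c n * phi lam n z) sums phi_series lam c z"
  using summable_sums[OF summable_hom[of "\<lambda>n j. c n * of_real (phi_coeff lam n j)" z]] assms
  by (simp add: bsum_phi_series phi_series_def biseries_def phi_def hom_cmult)

lemma lam_analytic_phi_series:
  assumes lam: "0 \<le> lam" and c: "disc_summable (\<lambda>n. norm (c n) * phi_mass lam n)"
  shows "lam_analytic lam (phi_series lam c)"
proof -
  let ?b = "\<lambda>n j. c n * complex_of_real (phi_coeff lam n j)"
  have b: "disc_summable (bsum ?b)" using c bsum_phi_series[OF lam] by simp
  show ?thesis
  proof (rule lam_analyticI)
    show "C2_on (phi_series lam c) unit_disc"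
      unfolding phi_series_def by (rule C2_on_biseries[OF b])
    show "wirtinger (phi_series lam c) (biseries (diff_z ?b) z) (biseries (diff_zbar ?b) z) z"
      if "z \<in> unit_disc" for z
      unfolding phi_series_def using wirtinger_biseries[OF b, of z] that by simp
    show "continuous_on unit_disc (biseries (diff_zbar ?b))"
      by (intro continuous_on_biseries disc_summable_diff_zbar b)
    fix z assume z: "z \<in> unit_disc"
    have "(\<lambda>n. c n * phi lam n z - c n * phi lam n (cnj z)) sums (phi_series lam c z - phi_series lam c (cnj z))"
      using z by (intro sums_diff phi_series_sums lam c) auto
    then have "(\<lambda>n. c (Suc n) * phi lam (Suc n) z - c (Suc n) * phi lam (Suc n) (cnj z))
        sums (phi_series lam c z - phi_series lam c (cnj z))"
      by (subst sums_Suc_iff) (simp add: phi_0)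
    then have "(\<lambda>n. of_real lam * (c (Suc n) * phi lam (Suc n) z - c (Suc n) * phi lam (Suc n) (cnj z)))
        sums (of_real lam * (phi_series lam c z - phi_series lam c (cnj z)))"
      by (rule sums_mult)
    moreover have "(\<lambda>n. hom_form n (diff_zbar ?b n) z) sums biseries (diff_zbar ?b) z"
      unfolding biseries_def using z by (intro summable_sums summable_hom disc_summable_diff_zbar b) auto
    then have "(\<lambda>n. (z - cnj z) * hom_form n (diff_zbar ?b n) z) sums ((z - cnj z) * biseries (diff_zbar ?b) z)"
      by (rule sums_mult)
    moreover have "(z - cnj z) * hom_form n (diff_zbar ?b n) z
        = of_real lam * (c (Suc n) * phi lam (Suc n) z - c (Suc n) * phi lam (Suc n) (cnj z))" for n
      unfolding diff_zbar_phi_series right_diff_distrib[symmetric] phi_diff_cnj by (simp add: mult_ac)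
    ultimately show "(z - cnj z) * biseries (diff_zbar ?b) z
        = of_real lam * (phi_series lam c z - phi_series lam c (cnj z))"
      by (metis (no_types, lifting) sums_cong sums_unique2)
  qed
qed

section \<open>The angular operator is self-adjoint for the weight\<close>

text \<open>For \<open>lam = 0\<close> the value at the zeros of the sine is 1, which makes the weight continuous.\<close>
definition weight :: "real \<Rightarrow> real \<Rightarrow> real" where
  "weight lam t = (if lam = 0 then 1 else \<bar>sin t\<bar> powr (2 * lam))"

definition pairing :: "real \<Rightarrow> (real \<Rightarrow> complex) \<Rightarrow> (real \<Rightarrow> complex) \<Rightarrow> complex" where
  "pairing lam u v = integral {-pi..pi} (\<lambda>t. u t * cnj (v t) * of_real (weight lam t))"

text \<open>\<open>V\<close> is the image of \<open>u\<close> under the operator that represents \<open>r * (d/dr)\<close> on circles. Its defining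
  equation is multiplied by \<open>sin t\<close>; at the two zeros of the sine \<open>V\<close> is determined by continuity.\<close>
definition angular :: "real \<Rightarrow> (real \<Rightarrow> complex) \<Rightarrow> (real \<Rightarrow> complex) \<Rightarrow> bool" where
  "angular lam u V \<longleftrightarrow> continuous_on UNIV V \<and> u pi = u (- pi) \<and>
     (\<exists>u'. \<forall>t. (u has_vector_derivative u' t) (at t) \<and>
        of_real (sin t) * (V t + \<i> * u' t) = - \<i> * of_real lam * cis (- t) * (u t - u (- t)))"

lemma angular_continuous: "angular lam u V \<Longrightarrow> continuous_on S u"
  unfolding angular_def
  by (meson continuous_at_imp_continuous_on has_vector_derivative_continuous)

lemma angular_continuous': "angular lam u V \<Longrightarrow> continuous_on S V"
  unfolding angular_def using continuous_on_subset by blast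

lemma continuous_on_weight: "0 \<le> lam \<Longrightarrow> continuous_on S (weight lam)"
proof (cases "lam = 0")
  case False
  assume "0 \<le> lam"
  then have "continuous_on S (\<lambda>t. \<bar>sin t\<bar> powr (2 * lam))"
    using False by (intro continuous_on_powr' continuous_intros) auto
  then show ?thesis using False by (simp add: weight_def[abs_def])
qed (simp add: weight_def[abs_def])

lemma weight_minus [simp]: "weight lam (- t) = weight lam t"
  by (simp add: weight_def)

lemma weight_nonneg: "0 \<le> weight lam t"
  by (simp add: weight_def)

lemma weight_deriv:
  assumes "0 < t" "t < pi"
  shows "(weight lam has_real_derivative 2 * lam * cos t / sin t * weight lam t) (at t)"
proof (cases "lam = 0")
  case False
  have s: "sin t > 0" using assms by (rule sin_gt_zero)
  have "((\<lambda>t. sin t powr (2 * lam)) has_real_derivative 2 * lam * sin t powr (2 * lam - of_nat 1) * cos t) (at t)"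
    by (rule DERIV_fun_powr[OF DERIV_sin s])
  also have "2 * lam * sin t powr (2 * lam - of_nat 1) * cos t = 2 * lam * cos t / sin t * weight lam t"
    using s False by (simp add: powr_diff weight_def)
  finally show ?thesis
  proof (rule has_field_derivative_transform_within_open)
    show "open {0<..<pi}" "t \<in> {0<..<pi}" using assms by auto
    fix x assume "x \<in> {0<..<pi}"
    then have "sin x > 0" using sin_gt_zero by auto
    then show "sin x powr (2 * lam) = weight lam x" using False by (simp add: weight_def)
  qed
qed (simp add: weight_def[abs_def])

lemma integral_fold:
  fixes F :: "real \<Rightarrow> 'a::euclidean_space"
  assumes "continuous_on {-a..a} F" "0 \<le> a"
  shows "integral {-a..a} F = integral {0..a} (\<lambda>t. F t + F (- t))"
proof -
  have c: "continuous_on {0..a} F" "continuous_on {-a..0} F"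
    using assms by (auto intro: continuous_on_subset)
  have c': "continuous_on {0..a} (\<lambda>t. F (- t))"
    by (rule continuous_on_compose2[OF c(2)]) (auto intro!: continuous_intros)
  have "integral {-a..a} F = integral {-a..0} F + integral {0..a} F"
    using assms by (intro Henstock_Kurzweil_Integration.integral_combine[symmetric] integrable_continuous_real) auto
  also have "integral {-a..0} F = integral {0..a} (\<lambda>t. F (- t))"
    using Henstock_Kurzweil_Integration.integral_reflect_real[of a 0 "\<lambda>t. F (- t)"] by simp
  finally show ?thesis
    using c(1) c' by (subst integral_add) (auto intro: integrable_continuous_real)
qed

text \<open>The suffixes p and m stand for the values at \<open>t\<close> and \<open>- t\<close>, \<open>s\<close> and \<open>c\<close> for sine and cosine, \<open>ep\<close> and
  \<open>em\<close> for \<open>cis t\<close> and \<open>cis (- t)\<close>; \<open>vp\<close>, \<open>vm\<close>, \<open>Wp\<close>, \<open>Wm\<close> are already conjugated.\<close>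
lemma fold_identity:
  fixes s l :: complex
  assumes "s * Vp = - \<i> * l * em * (up - um) - \<i> * s * dup"
    and "s * Vm = - \<i> * l * ep * (up - um) - \<i> * s * dum"
    and "s * Wp = \<i> * l * ep * (vp - vm) + \<i> * s * dvp"
    and "s * Wm = \<i> * l * em * (vp - vm) + \<i> * s * dvm"
    and "ep + em = 2 * c"
  shows "s * (Vp * vp - up * Wp + (Vm * vm - um * Wm))
    = - \<i> * (s * (dup * vp + up * dvp + (dum * vm + um * dvm)) + 2 * l * c * (up * vp - um * vm))"
proof -
  have "s * (Vp * vp - up * Wp + (Vm * vm - um * Wm))
      = (s * Vp) * vp - up * (s * Wp) + ((s * Vm) * vm - um * (s * Wm))"
    by (simp add: algebra_simps)
  also have "\<dots> = - \<i> * (s * (dup * vp + up * dvp + (dum * vm + um * dvm)) + l * (ep + em) * (up * vp - um * vm))"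
    unfolding assms(1-4) by (simp add: algebra_simps)
  finally show ?thesis unfolding assms(5) by (simp only: mult_ac)
qed

text \<open>After adding the values at \<open>t\<close> and \<open>- t\<close>, the integrand of the difference of the two pairings is
  the derivative of \<open>- \<i> * (u t * cnj (v t) - u (- t) * cnj (v (- t))) * weight lam t\<close> on the open half
  circle: the reflection terms of the two operators combine to \<open>2 * lam * cot t\<close>, the logarithmic
  derivative of the weight. The primitive vanishes at both ends.\<close>
lemma angular_selfadjoint:
  assumes lam: "0 \<le> lam" and u: "angular lam u V" and v: "angular lam v W"
  shows "pairing lam V v = pairing lam u W"
proof -
  obtain u' where u': "\<And>t. (u has_vector_derivative u' t) (at t)"
    and ue: "\<And>t. of_real (sin t) * (V t + \<i> * u' t) = - \<i> * of_real lam * cis (- t) * (u t - u (- t))"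
    using u unfolding angular_def by metis
  obtain v' where v': "\<And>t. (v has_vector_derivative v' t) (at t)"
    and ve: "\<And>t. of_real (sin t) * (W t + \<i> * v' t) = - \<i> * of_real lam * cis (- t) * (v t - v (- t))"
    using v unfolding angular_def by metis
  have per: "u pi = u (- pi)" "v pi = v (- pi)" using u v by (auto simp: angular_def)
  note cont = angular_continuous[OF u] angular_continuous[OF v] angular_continuous'[OF u]
    angular_continuous'[OF v] continuous_on_weight[OF lam]
  have minus: "((\<lambda>t. g (- t)) has_vector_derivative - g' (- t)) (at t)"
    if g: "\<And>t. (g has_vector_derivative g' t) (at t)" for g g' :: "real \<Rightarrow> complex" and t
  proof -
    have "(uminus has_vector_derivative (- 1 :: real)) (at t)"
      by (auto intro!: derivative_eq_intros)
    from vector_diff_chain_at[OF this g[of "- t"]] show ?thesis by (simp add: o_def)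
  qed
  have cm: "continuous_on S (\<lambda>t. g (- t))" if "\<And>S. continuous_on S g" for g :: "real \<Rightarrow> complex" and S
    by (rule continuous_on_compose2[OF that[of UNIV]]) (auto intro!: continuous_intros)
  define F where "F t = (V t * cnj (v t) - u t * cnj (W t)) * of_real (weight lam t)" for t
  define Q where "Q t = u t * cnj (v t) - u (- t) * cnj (v (- t))" for t
  have F1: "continuous_on {-pi..pi} (\<lambda>t. V t * cnj (v t) * of_real (weight lam t))"
    "continuous_on {-pi..pi} (\<lambda>t. u t * cnj (W t) * of_real (weight lam t))"
    by (intro continuous_intros cont)+
  have cF: "continuous_on {-pi..pi} F"
    unfolding F_def[abs_def] by (intro continuous_intros cont)
  have "((\<lambda>t. F t + F (- t)) has_integral
      (- \<i> * Q pi * of_real (weight lam pi) - - \<i> * Q 0 * of_real (weight lam 0))) {0..pi}"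
  proof (rule fundamental_theorem_of_calculus_interior)
    show "continuous_on {0..pi} (\<lambda>t. - \<i> * Q t * of_real (weight lam t))"
      unfolding Q_def[abs_def] by (intro continuous_intros cont cm)
    fix t assume "t \<in> {0<..<pi}"
    then have t: "0 < t" "t < pi" by auto
    have s: "complex_of_real (sin t) \<noteq> 0" using sin_gt_zero[OF t] by simp
    let ?Q' = "u' t * cnj (v t) + u t * cnj (v' t) + (u' (- t) * cnj (v (- t)) + u (- t) * cnj (v' (- t)))"
    have "(Q has_vector_derivative (u t * cnj (v' t) + u' t * cnj (v t))
        - (u (- t) * cnj (- v' (- t)) + - u' (- t) * cnj (v (- t)))) (at t)"
      unfolding Q_def[abs_def]
      by (intro has_vector_derivative_diff has_vector_derivative_mult u' v' minus
         bounded_linear.has_vector_derivative[OF bounded_linear_cnj])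
    then have Q': "(Q has_vector_derivative ?Q') (at t)" by (simp add: algebra_simps)
    have w': "((\<lambda>t. complex_of_real (weight lam t)) has_vector_derivative
        of_real (2 * lam * cos t / sin t * weight lam t)) (at t)"
      by (rule has_vector_derivative_of_real)
        (use weight_deriv[OF t] in \<open>simp add: has_real_derivative_iff_has_vector_derivative\<close>)
    have "((\<lambda>t. - \<i> * (Q t * of_real (weight lam t))) has_vector_derivative
        - \<i> * (Q t * of_real (2 * lam * cos t / sin t * weight lam t) + ?Q' * of_real (weight lam t))) (at t)"
      by (intro has_vector_derivative_mult_right has_vector_derivative_mult Q' w')
    moreover have "- \<i> * (Q t * of_real (2 * lam * cos t / sin t * weight lam t) + ?Q' * of_real (weight lam t))
        = F t + F (- t)"
    proof -
      let ?s = "complex_of_real (sin t)"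
      have eqs: "?s * V t = - \<i> * of_real lam * cis (- t) * (u t - u (- t)) - \<i> * ?s * u' t"
        "?s * V (- t) = - \<i> * of_real lam * cis t * (u t - u (- t)) - \<i> * ?s * u' (- t)"
        using ue[of t] ue[of "- t"] by (simp_all add: algebra_simps)
      have "?s * cnj (W t) = cnj (?s * (W t + \<i> * v' t)) + \<i> * ?s * cnj (v' t)"
        by (simp add: algebra_simps)
      then have eqs2: "?s * cnj (W t) = \<i> * of_real lam * cis t * (cnj (v t) - cnj (v (- t))) + \<i> * ?s * cnj (v' t)"
        unfolding ve by (simp add: cis_cnj)
      have "?s * cnj (W (- t)) = - cnj (of_real (sin (- t)) * (W (- t) + \<i> * v' (- t))) + \<i> * ?s * cnj (v' (- t))"
        by (simp add: algebra_simps)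
      then have eqs3: "?s * cnj (W (- t)) = \<i> * of_real lam * cis (- t) * (cnj (v t) - cnj (v (- t))) + \<i> * ?s * cnj (v' (- t))"
        unfolding ve by (simp add: cis_cnj algebra_simps)
      have "cis t + cis (- t) = 2 * of_real (cos t)" by (simp add: complex_eq_iff)
      note id = fold_identity[OF eqs eqs2 eqs3 this]
      have "?s * (F t + F (- t)) = ?s * (V t * cnj (v t) - u t * cnj (W t)
           + (V (- t) * cnj (v (- t)) - u (- t) * cnj (W (- t)))) * of_real (weight lam t)"
        by (simp add: F_def algebra_simps)
      also have "\<dots> = - \<i> * (?s * ?Q' + 2 * of_real lam * of_real (cos t) * Q t) * of_real (weight lam t)"
        unfolding id Q_def ..
      also have "\<dots> = ?s * (- \<i> * (Q t * of_real (2 * lam * cos t / sin t * weight lam t) + ?Q' * of_real (weight lam t)))"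
      proof -
        have "?s * of_real (2 * lam * cos t / sin t * weight lam t)
            = 2 * of_real lam * of_real (cos t) * of_real (weight lam t)"
          using s by simp
        moreover have "?s * (- \<i> * (Q t * x + q * y)) = - \<i> * (Q t * (?s * x) + ?s * q * y)" for x y q
          by (simp add: algebra_simps)
        ultimately have "?s * (- \<i> * (Q t * of_real (2 * lam * cos t / sin t * weight lam t) + ?Q' * of_real (weight lam t)))
           = - \<i> * (Q t * (2 * of_real lam * of_real (cos t) * of_real (weight lam t)) + ?s * ?Q' * of_real (weight lam t))"
          by (simp only:)
        then show ?thesis by (simp add: algebra_simps)
      qed
      finally show ?thesis using s by (metis mult_left_cancel)
    qed
    ultimately show "((\<lambda>t. - \<i> * Q t * of_real (weight lam t)) has_vector_derivative F t + F (- t)) (at t)"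
      by (simp only: mult.assoc)
  qed auto
  then have "integral {0..pi} (\<lambda>t. F t + F (- t)) = 0"
    by (simp add: Q_def per integral_unique)
  then have "integral {-pi..pi} F = 0"
    using integral_fold[OF cF] by simp
  moreover have "integral {-pi..pi} F = pairing lam V v - pairing lam u W"
    unfolding pairing_def F_def left_diff_distrib
    by (intro integral_diff integrable_continuous_real F1)
  ultimately show ?thesis by simp
qed

lemma cis_has_vector_derivative:
  "((\<lambda>t. cis (k * t)) has_vector_derivative \<i> * of_real k * cis (k * t)) (at t)"
proof -
  have "((\<lambda>z. exp (\<i> * of_real k * z)) has_field_derivative \<i> * of_real k * exp (\<i> * of_real k * of_real t))
      (at (of_real t))"
    by (auto intro!: derivative_eq_intros)
  from has_vector_derivative_real_field[OF this] show ?thesis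
    by (simp add: cis_conv_exp mult.assoc)
qed

text \<open>Here \<open>V r t\<close> is \<open>r * (d/dr) f\<close>, that is \<open>z * fz z + cnj z * fb z\<close>; adding \<open>\<i>\<close> times the angular derivative
  \<open>\<i> * (z * fz z - cnj z * fb z)\<close> leaves \<open>2 * cnj z * fb z\<close>, which the equation expresses by values
  of \<open>f\<close>.\<close>
lemma lam_analytic_polar:
  assumes f: "lam_analytic lam f"
  obtains V where "\<And>r. 0 \<le> r \<Longrightarrow> r < 1 \<Longrightarrow> angular lam (\<lambda>t. f (of_real r * cis t)) (V r)"
    and "\<And>r t. 0 < r \<Longrightarrow> r < 1 \<Longrightarrow>
      ((\<lambda>r. f (of_real r * cis t)) has_vector_derivative V r t / of_real r) (at r)"
    and "continuous_on ({0<..<1} \<times> UNIV) (\<lambda>(r, t). V r t)"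
proof -
  obtain fz fb where w: "\<And>z. z \<in> unit_disc \<Longrightarrow> wirtinger f (fz z) (fb z) z"
    and cz: "continuous_on unit_disc fz" and cb: "continuous_on unit_disc fb"
    and eq: "\<And>z. z \<in> unit_disc \<Longrightarrow> (z - cnj z) * fb z = complex_of_real lam * (f z - f (cnj z))"
    using lam_analyticD[OF f] by metis
  define V where "V r t = (let z = of_real r * cis t in z * fz z + cnj z * fb z)" for r t
  have comp: "((\<lambda>s. f (g s)) has_vector_derivative fz (g x) * g' + fb (g x) * cnj g') (at x)"
    if "(g has_vector_derivative g') (at x)" "g x \<in> unit_disc" for g g' and x :: real
    using has_derivative_compose[OF that(1)[unfolded has_vector_derivative_def]
       w[OF that(2), unfolded wirtinger_def]]
    by (simp add: has_vector_derivative_def scaleR_conv_of_real algebra_simps)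
  have in_disc: "of_real r * cis t \<in> unit_disc" if "0 \<le> r" "r < 1" for r t
    using that by (simp add: norm_mult)
  have cV: "continuous_on ({r. 0 \<le> r \<and> r < 1} \<times> UNIV) (\<lambda>(r, t). V r t)"
    unfolding V_def Let_def split_beta
    by (intro continuous_intros continuous_on_compose2[OF cz] continuous_on_compose2[OF cb])
      (auto simp: norm_mult)
  show ?thesis
  proof (rule that[of V])
    fix r :: real assume r: "0 \<le> r" "r < 1"
    show "angular lam (\<lambda>t. f (of_real r * cis t)) (V r)"
      unfolding angular_def
    proof (intro conjI exI allI)
      have "continuous_on UNIV (\<lambda>t. (\<lambda>(r, t). V r t) (r, t))"
        by (rule continuous_on_compose2[OF cV]) (use r in \<open>auto intro!: continuous_intros\<close>)
      then show "continuous_on UNIV (V r)" by simp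
      show "f (of_real r * cis pi) = f (of_real r * cis (- pi))"
        by (rule arg_cong[of _ _ f]) (simp add: complex_eq_iff)
      fix t
      let ?z = "complex_of_real r * cis t"
      have "((\<lambda>t. of_real r * cis t) has_vector_derivative of_real r * (\<i> * cis t)) (at t)"
        using cis_has_vector_derivative[of 1 t] by (intro has_vector_derivative_mult_right) simp
      from comp[OF this in_disc[OF r]]
      show "((\<lambda>t. f (of_real r * cis t)) has_vector_derivative \<i> * (?z * fz ?z - cnj ?z * fb ?z)) (at t)"
        by (simp add: algebra_simps)
      have "V r t + \<i> * (\<i> * (?z * fz ?z - cnj ?z * fb ?z)) = 2 * cnj ?z * fb ?z"
        by (simp add: V_def Let_def flip: mult.assoc)
      then have "of_real (sin t) * (V r t + \<i> * (\<i> * (?z * fz ?z - cnj ?z * fb ?z)))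
          = of_real (sin t) * (2 * cnj ?z * fb ?z)" by (simp only:)
      also have "\<dots> = - \<i> * cis (- t) * ((?z - cnj ?z) * fb ?z)"
      proof -
        have "?z - cnj ?z = of_real r * (cis t - cis (- t))" by (simp add: cis_cnj algebra_simps)
        also have "cis t - cis (- t) = 2 * \<i> * of_real (sin t)" by (simp add: complex_eq_iff)
        finally show ?thesis by (simp add: cis_cnj)
      qed
      also have "\<dots> = - \<i> * of_real lam * cis (- t) * (f ?z - f (of_real r * cis (- t)))"
        unfolding eq[OF in_disc[OF r]] by (simp add: cis_cnj)
      finally show "of_real (sin t) * (V r t + \<i> * (\<i> * (?z * fz ?z - cnj ?z * fb ?z)))
          = - \<i> * of_real lam * cis (- t) * (f ?z - f (of_real r * cis (- t)))" .
    qed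
  next
    fix r t :: real assume r: "0 < r" "r < 1"
    have "((\<lambda>r. of_real r * cis t) has_vector_derivative cis t) (at r)"
      by (auto intro!: derivative_eq_intros)
    from comp[OF this in_disc] r
    have "((\<lambda>r. f (of_real r * cis t)) has_vector_derivative
      fz (of_real r * cis t) * cis t + fb (of_real r * cis t) * cnj (cis t)) (at r)" by simp
    moreover have "fz (of_real r * cis t) * cis t + fb (of_real r * cis t) * cnj (cis t) = V r t / of_real r"
      using r by (simp add: V_def Let_def add_divide_distrib)
    ultimately show "((\<lambda>r. f (of_real r * cis t)) has_vector_derivative V r t / of_real r) (at r)"
      by (simp only:)
  next
    show "continuous_on ({0<..<1} \<times> UNIV) (\<lambda>(r, t). V r t)"
      by (rule continuous_on_subset[OF cV]) auto
  qed
qed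

section \<open>Moments on circles determine the function\<close>

definition circ :: "(complex \<Rightarrow> complex) \<Rightarrow> real \<Rightarrow> real \<Rightarrow> complex" where
  "circ f r t = f (of_real r * cis t)"

definition expi :: "int \<Rightarrow> real \<Rightarrow> complex" where
  "expi k t = cis (of_int k * t)"

lemma continuous_on_circ:
  assumes "continuous_on unit_disc f" "0 \<le> r" "r < 1" shows "continuous_on S (circ f r)"
  unfolding circ_def[abs_def]
  by (rule continuous_on_compose2[OF assms(1)])
    (use assms(2,3) in \<open>auto simp: norm_mult intro!: continuous_intros\<close>)

lemma continuous_on_expi: "continuous_on S (expi k)"
  unfolding expi_def[abs_def] by (intro continuous_intros)

lemma pairing_integrable:
  assumes "0 \<le> lam" "continuous_on {-pi..pi} u" "continuous_on {-pi..pi} v"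
  shows "(\<lambda>t. u t * cnj (v t) * of_real (weight lam t)) integrable_on {-pi..pi}"
  by (intro integrable_continuous_real continuous_intros continuous_on_weight assms)

lemma pairing_cmult_left: "pairing lam (\<lambda>t. c * u t) v = c * pairing lam u v"
  by (simp add: pairing_def mult.assoc)

lemma pairing_cmult_right: "pairing lam u (\<lambda>t. c * v t) = cnj c * pairing lam u v"
  unfolding pairing_def integral_mult_right[symmetric]
  by (rule arg_cong[where f = "integral {-pi..pi}"]) (auto simp: mult_ac)

lemma pairing_diff_left:
  assumes "0 \<le> lam" "continuous_on {-pi..pi} u" "continuous_on {-pi..pi} u'" "continuous_on {-pi..pi} v"
  shows "pairing lam (\<lambda>t. u t - u' t) v = pairing lam u v - pairing lam u' v"
  unfolding pairing_def by (simp add: left_diff_distrib integral_diff pairing_integrable assms)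

lemma pairing_add_right:
  assumes "0 \<le> lam" "continuous_on {-pi..pi} u" "continuous_on {-pi..pi} v" "continuous_on {-pi..pi} v'"
  shows "pairing lam u (\<lambda>t. v t + v' t) = pairing lam u v + pairing lam u v'"
  unfolding pairing_def by (simp add: distrib_right distrib_left integral_add pairing_integrable assms)

lemma pairing_diff_right:
  assumes "0 \<le> lam" "continuous_on {-pi..pi} u" "continuous_on {-pi..pi} v" "continuous_on {-pi..pi} v'"
  shows "pairing lam u (\<lambda>t. v t - v' t) = pairing lam u v - pairing lam u v'"
  unfolding pairing_def by (simp add: left_diff_distrib right_diff_distrib integral_diff pairing_integrable assms)

lemma pairing_sum_right:
  assumes "0 \<le> lam" "continuous_on {-pi..pi} u" "finite S" "\<And>j. j \<in> S \<Longrightarrow> continuous_on {-pi..pi} (v j)"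
  shows "pairing lam u (\<lambda>t. \<Sum>j\<in>S. v j t) = (\<Sum>j\<in>S. pairing lam u (v j))"
  using assms(3,4)
proof (induction S)
  case empty then show ?case by (simp add: pairing_def)
next
  case (insert j S)
  have "pairing lam u (\<lambda>t. \<Sum>j\<in>insert j S. v j t) = pairing lam u (\<lambda>t. v j t + (\<Sum>j\<in>S. v j t))"
    using insert.hyps by simp
  also have "\<dots> = pairing lam u (v j) + pairing lam u (\<lambda>t. \<Sum>j\<in>S. v j t)"
    by (intro pairing_add_right assms(1,2) continuous_on_sum) (auto intro: insert.prems)
  also have "pairing lam u (\<lambda>t. \<Sum>j\<in>S. v j t) = (\<Sum>j\<in>S. pairing lam u (v j))"
    by (rule insert.IH) (auto intro: insert.prems)
  finally show ?case using insert.hyps by simp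
qed

lemma norm_pairing_le:
  assumes lam: "0 \<le> lam" and u: "continuous_on {-pi..pi} u" and v: "continuous_on {-pi..pi} v"
    and M: "\<And>t. t \<in> {-pi..pi} \<Longrightarrow> norm (v t) \<le> M"
  shows "norm (pairing lam u v) \<le> M * integral {-pi..pi} (\<lambda>t. norm (u t) * weight lam t)"
proof -
  have "norm (pairing lam u v) \<le> integral {-pi..pi} (\<lambda>t. M * (norm (u t) * weight lam t))"
    unfolding pairing_def
  proof (rule Henstock_Kurzweil_Integration.integral_norm_bound_integral)
    show "(\<lambda>t. u t * cnj (v t) * of_real (weight lam t)) integrable_on {-pi..pi}"
      by (rule pairing_integrable[OF lam u v])
    show "(\<lambda>t. M * (norm (u t) * weight lam t)) integrable_on {-pi..pi}"
      by (intro integrable_continuous_real continuous_intros u continuous_on_weight lam)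
    fix t assume "t \<in> {-pi..pi}"
    from M[OF this] have "norm (v t) * (norm (u t) * weight lam t) \<le> M * (norm (u t) * weight lam t)"
      by (intro mult_right_mono) (auto simp: weight_nonneg)
    then show "norm (u t * cnj (v t) * of_real (weight lam t)) \<le> M * (norm (u t) * weight lam t)"
      by (simp add: norm_mult weight_nonneg mult_ac)
  qed
  then show ?thesis by simp
qed

lemma angular_cmult:
  assumes "angular lam u V" shows "angular lam (\<lambda>t. c * u t) (\<lambda>t. c * V t)"
proof -
  obtain u' where u': "\<And>t. (u has_vector_derivative u' t) (at t)"
    and ue: "\<And>t. of_real (sin t) * (V t + \<i> * u' t) = - \<i> * of_real lam * cis (- t) * (u t - u (- t))"
    using assms unfolding angular_def by metis
  have "of_real (sin t) * (c * V t + \<i> * (c * u' t))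
      = - \<i> * of_real lam * cis (- t) * (c * u t - c * u (- t))" for t
  proof -
    have "of_real (sin t) * (c * V t + \<i> * (c * u' t)) = c * (of_real (sin t) * (V t + \<i> * u' t))"
      by (simp add: algebra_simps)
    then show ?thesis unfolding ue by (simp add: algebra_simps)
  qed
  then show ?thesis
    using assms unfolding angular_def
    by (intro conjI exI[of _ "\<lambda>t. c * u' t"] allI has_vector_derivative_mult_right u' continuous_intros)
      auto
qed

text \<open>The angular operator maps \<open>cis (- n * t)\<close> to \<open>- n * cis (- n * t)\<close> plus exponentials of frequency
  between \<open>- n\<close> and \<open>n - 2\<close>, because the difference quotient
  \<open>(cis (n * t) - cis (- n * t)) / (cis t - cis (- t))\<close> is a finite geometric sum.\<close>
lemma angular_expi:
  "angular lam (expi (- int n))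
     (\<lambda>t. of_real (- real n) * expi (- int n) t
        - (\<Sum>j<n. of_real (2 * lam) * expi (int n - 2 - 2 * int j) t))"
  unfolding angular_def
proof (intro conjI exI allI)
  show "continuous_on UNIV (\<lambda>t. of_real (- real n) * expi (- int n) t
        - (\<Sum>j<n. of_real (2 * lam) * expi (int n - 2 - 2 * int j) t))"
    by (intro continuous_intros continuous_on_expi)
  show "expi (- int n) pi = expi (- int n) (- pi)"
    by (simp add: expi_def complex_eq_iff)
  fix t
  show "(expi (- int n) has_vector_derivative \<i> * of_real (- real n) * expi (- int n) t) (at t)"
    using cis_has_vector_derivative[of "- real n" t] by (simp add: expi_def[abs_def])
  let ?S = "\<Sum>j<n. expi (int n - 2 - 2 * int j) t"
  let ?g = "\<lambda>j. expi (int n - 1 - 2 * int j) t"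
  have "2 * \<i> * of_real (sin t) * expi k t = expi (k + 1) t - expi (k - 1) t" for k
  proof -
    have "2 * \<i> * complex_of_real (sin t) = cis t - cis (- t)" by (simp add: complex_eq_iff)
    then show ?thesis
      unfolding expi_def by (simp only: left_diff_distrib cis_mult) (simp add: algebra_simps)
  qed
  from this[of "int n - 2 - 2 * int j" for j]
  have "2 * \<i> * of_real (sin t) * ?S = (\<Sum>j<n. ?g j - ?g (Suc j))"
    unfolding sum_distrib_left by (intro sum.cong refl) (simp add: algebra_simps)
  also have "\<dots> = ?g 0 - ?g n" by (rule sum_lessThan_telescope')
  also have "\<dots> = cis (- t) * (expi (int n) t - expi (- int n) t)"
    by (simp add: expi_def right_diff_distrib cis_mult algebra_simps)
  finally have S: "2 * \<i> * of_real (sin t) * ?S = cis (- t) * (expi (int n) t - expi (- int n) t)" .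
  have sum: "(\<Sum>j<n. of_real (2 * lam) * expi (int n - 2 - 2 * int j) t) = of_real (2 * lam) * ?S"
    by (simp only: sum_distrib_left)
  have "of_real (sin t) * (- of_real (real n) * e - of_real (2 * lam) * S + \<i> * (\<i> * - of_real (real n) * e))
      = \<i> * of_real lam * (2 * \<i> * of_real (sin t) * S)" for e S
    by (simp add: algebra_simps)
  then have "of_real (sin t) * (of_real (- real n) * expi (- int n) t
        - (\<Sum>j<n. of_real (2 * lam) * expi (int n - 2 - 2 * int j) t)
        + \<i> * (\<i> * of_real (- real n) * expi (- int n) t))
      = \<i> * of_real lam * (2 * \<i> * of_real (sin t) * ?S)"
    unfolding sum of_real_minus .
  also have "\<dots> = - \<i> * of_real lam * cis (- t) * (expi (- int n) t - expi (- int n) (- t))"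
    unfolding S by (simp add: expi_def algebra_simps)
  finally show "of_real (sin t) * (of_real (- real n) * expi (- int n) t
        - (\<Sum>j<n. of_real (2 * lam) * expi (int n - 2 - 2 * int j) t)
        + \<i> * (\<i> * of_real (- real n) * expi (- int n) t))
      = - \<i> * of_real lam * cis (- t) * (expi (- int n) t - expi (- int n) (- t))" .
qed

lemma lam_analytic_phi:
  assumes lam: "0 \<le> lam" shows "lam_analytic lam (phi lam n)"
proof -
  let ?c = "\<lambda>m. if m = n then 1 else (0::complex)"
  have c: "disc_summable (\<lambda>m. norm (?c m) * phi_mass lam m)"
    unfolding disc_summable_def
  proof (intro allI impI)
    fix r :: real
    show "summable (\<lambda>m. norm (?c m) * phi_mass lam m * r ^ m)"
      by (rule summable_finite[of "{n}"]) auto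
  qed
  have "phi_series lam ?c z = phi lam n z" if "z \<in> unit_disc" for z
  proof -
    have "(\<lambda>m. ?c m * phi lam m z) sums phi_series lam ?c z"
      by (rule phi_series_sums[OF lam c]) (use that in simp)
    moreover have "(\<lambda>m. ?c m * phi lam m z) sums (\<Sum>m\<in>{n}. ?c m * phi lam m z)"
      by (rule sums_finite) auto
    ultimately show ?thesis using sums_unique2 by fastforce
  qed
  then show ?thesis using lam_analytic_cong[OF lam_analytic_phi_series[OF lam c]] by blast
qed

text \<open>On a homogeneous function of degree \<open>n\<close> the operator \<open>r * (d/dr)\<close> is multiplication by \<open>n\<close>.\<close>
lemma angular_phi:
  assumes lam: "0 \<le> lam"
  shows "angular lam (circ (phi lam n) 1) (\<lambda>t. of_real (real n) * circ (phi lam n) 1 t)"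
proof -
  obtain V where V: "\<And>r. 0 \<le> r \<Longrightarrow> r < 1 \<Longrightarrow> angular lam (\<lambda>t. phi lam n (of_real r * cis t)) (V r)"
    and V': "\<And>r t. 0 < r \<Longrightarrow> r < 1 \<Longrightarrow>
      ((\<lambda>r. phi lam n (of_real r * cis t)) has_vector_derivative V r t / of_real r) (at r)"
    using lam_analytic_polar[OF lam_analytic_phi[OF lam, of n]] by metis
  have "V (1/2) t = of_real (real n * (1/2) ^ n) * circ (phi lam n) 1 t" for t
  proof -
    have "((\<lambda>r. of_real (r ^ n) * phi lam n (cis t)) has_vector_derivative
       of_real (real n * (1/2) ^ (n - 1)) * phi lam n (cis t)) (at (1/2))"
      by (intro has_vector_derivative_mult_left has_vector_derivative_of_real)
        (auto intro!: derivative_eq_intros simp flip: has_real_derivative_iff_has_vector_derivative)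
    moreover have "((\<lambda>r. of_real (r ^ n) * phi lam n (cis t)) has_vector_derivative V (1/2) t / of_real (1/2)) (at (1/2))"
      using V'[of "1/2" t] by (simp add: phi_scale)
    ultimately have "of_real (real n * (1/2) ^ (n - 1)) * phi lam n (cis t) = V (1/2) t / of_real (1/2)"
      by (rule vector_derivative_unique_at)
    then have "V (1/2) t = of_real (1/2) * (of_real (real n * (1/2) ^ (n - 1)) * phi lam n (cis t))"
      by simp
    also have "\<dots> = of_real (real n * (1/2) ^ n) * circ (phi lam n) 1 t"
      by (cases n) (auto simp: circ_def)
    finally show ?thesis .
  qed
  then have eqV: "(\<lambda>t. 2 ^ n * V (1/2) t) = (\<lambda>t. of_real (real n) * circ (phi lam n) 1 t)"
    by (intro ext) (simp add: power_one_over)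
  have equ: "(\<lambda>t. 2 ^ n * phi lam n (of_real (1/2) * cis t)) = circ (phi lam n) 1"
    by (intro ext) (simp only: phi_scale, simp add: circ_def power_one_over)
  from angular_cmult[OF V[of "1/2"], of "2 ^ n"]
  show ?thesis unfolding eqV equ by simp
qed

lemma continuous_on_circ_phi:
  "0 \<le> lam \<Longrightarrow> continuous_on S (circ (phi lam n) 1)"
  using angular_continuous[OF angular_phi] by blast

lemma phi_circle_expi:
  "circ (phi lam n) 1 t = (\<Sum>j\<le>n. of_real (phi_coeff lam n j) * expi (int n - 2 * int j) t)"
  unfolding circ_def phi_def hom_form_def
proof (intro sum.cong refl)
  fix j assume "j \<in> {..n}"
  have "cis t ^ (n - j) * cnj (cis t) ^ j = cis (real (n - j) * t + real j * (- t))"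
    by (simp only: cis_cnj Complex.DeMoivre cis_mult)
  also have "\<dots> = expi (int n - 2 * int j) t"
    using \<open>j \<in> {..n}\<close> by (simp add: expi_def of_nat_diff algebra_simps)
  finally have "cis t ^ (n - j) * cnj (cis t) ^ j = expi (int n - 2 * int j) t" .
  then show "complex_of_real (phi_coeff lam n j) * (complex_of_real 1 * cis t) ^ (n - j) * cnj (complex_of_real 1 * cis t) ^ j
      = of_real (phi_coeff lam n j) * expi (int n - 2 * int j) t" by (simp add: mult.assoc)
qed

text \<open>Differentiation under the integral replaces \<open>f\<close> by \<open>r * (d/dr) f\<close>, and symmetry moves the angular
  operator to \<open>v\<close>.\<close>
lemma radial_moment_deriv:
  assumes lam: "0 \<le> lam" and f: "lam_analytic lam f" and v: "angular lam v W" and r: "0 < r" "r < 1"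
  shows "((\<lambda>r. pairing lam (circ f r) v) has_vector_derivative pairing lam (circ f r) W / of_real r) (at r)"
proof -
  obtain V where V: "\<And>r. 0 \<le> r \<Longrightarrow> r < 1 \<Longrightarrow> angular lam (\<lambda>t. f (of_real r * cis t)) (V r)"
    and V': "\<And>r t. 0 < r \<Longrightarrow> r < 1 \<Longrightarrow>
      ((\<lambda>r. f (of_real r * cis t)) has_vector_derivative V r t / of_real r) (at r)"
    and cV: "continuous_on ({0<..<1} \<times> UNIV) (\<lambda>(r, t). V r t)"
    using lam_analytic_polar[OF f] by metis
  have cf: "continuous_on unit_disc f" by (rule lam_analytic_continuous[OF f])
  have cVr: "continuous_on ({0<..<1} \<times> cbox (-pi) pi) (\<lambda>x. V (fst x) (snd x))"
    by (rule continuous_on_subset[OF cV[unfolded split_beta]]) auto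
  have "((\<lambda>r. integral (cbox (-pi) pi) (\<lambda>t. circ f r t * cnj (v t) * of_real (weight lam t))) has_vector_derivative
      integral (cbox (-pi) pi) (\<lambda>t. V r t / of_real r * cnj (v t) * of_real (weight lam t))) (at r within {0<..<1})"
  proof (rule leibniz_rule_vector_derivative)
    fix s t :: real assume s: "s \<in> {0<..<1}"
    have "((\<lambda>r. circ f r t) has_vector_derivative V s t / of_real s) (at s)"
      unfolding circ_def using V' s by simp
    then have "((\<lambda>r. circ f r t * cnj (v t) * of_real (weight lam t)) has_vector_derivative
       V s t / of_real s * cnj (v t) * of_real (weight lam t)) (at s)"
      by (intro has_vector_derivative_mult_left)
    then show "((\<lambda>r. circ f r t * cnj (v t) * of_real (weight lam t)) has_vector_derivative
       V s t / of_real s * cnj (v t) * of_real (weight lam t)) (at s within {0<..<1})"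
      by (rule has_vector_derivative_at_within)
  next
    fix s :: real assume "s \<in> {0<..<1}"
    then show "(\<lambda>t. circ f s t * cnj (v t) * of_real (weight lam t)) integrable_on cbox (-pi) pi"
      using pairing_integrable[OF lam continuous_on_circ[OF cf] angular_continuous[OF v]] by simp
  next
    show "continuous_on ({0<..<1} \<times> cbox (-pi) pi)
       (\<lambda>(s, t). V s t / of_real s * cnj (v t) * of_real (weight lam t))"
      unfolding split_beta
      by (intro continuous_intros cVr continuous_on_compose2[OF angular_continuous[OF v, of UNIV]]
          continuous_on_compose2[OF continuous_on_weight[OF lam, of UNIV]]) auto
  qed (use r in auto)
  then have "((\<lambda>r. pairing lam (circ f r) v) has_vector_derivative
      pairing lam (\<lambda>t. inverse (of_real r) * V r t) v) (at r)"
    using at_within_open[of r "{0<..<1}"] r by (simp add: pairing_def field_simps)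
  also have "pairing lam (\<lambda>t. inverse (of_real r) * V r t) v = pairing lam (V r) v / of_real r"
    unfolding pairing_cmult_left by (simp add: field_simps)
  also have "pairing lam (V r) v = pairing lam (circ f r) W"
    using angular_selfadjoint[OF lam V v] r by (simp add: circ_def[abs_def])
  finally show ?thesis .
qed

lemma euler_ode:
  fixes m :: "real \<Rightarrow> complex"
  assumes "\<And>r. 0 < r \<Longrightarrow> r < 1 \<Longrightarrow> (m has_vector_derivative of_real \<kappa> * m r / of_real r) (at r)"
  obtains c where "\<And>r. 0 < r \<Longrightarrow> r < 1 \<Longrightarrow> m r = c * of_real (r powr \<kappa>)"
proof -
  have zero: "((\<lambda>r. m r * of_real (r powr (- \<kappa>))) has_vector_derivative 0) (at r within {0<..<1})"
    if r: "r \<in> {0<..<1}" for r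
  proof -
    have "((\<lambda>r. r powr (- \<kappa>)) has_real_derivative - \<kappa> * r powr (- \<kappa> - 1)) (at r)"
      using has_real_derivative_powr[of r "- \<kappa>"] r by simp
    then have pw: "((\<lambda>r. complex_of_real (r powr (- \<kappa>))) has_vector_derivative of_real (- \<kappa> * r powr (- \<kappa> - 1))) (at r)"
      by (intro has_vector_derivative_of_real) (simp add: has_real_derivative_iff_has_vector_derivative)
    have m': "(m has_vector_derivative of_real \<kappa> * m r / of_real r) (at r)"
      using r by (intro assms) auto
    have "r powr (- \<kappa> - 1) = r powr (- \<kappa>) / r" using r by (simp add: powr_diff)
    then have 0: "m r * of_real (- \<kappa> * r powr (- \<kappa> - 1)) + of_real \<kappa> * m r / of_real r * of_real (r powr (- \<kappa>)) = 0"
      by (simp add: mult_ac)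
    show ?thesis
      by (rule has_vector_derivative_at_within) (rule has_vector_derivative_mult[OF m' pw, unfolded 0])
  qed
  obtain c where c: "\<And>r. r \<in> {0<..<1} \<Longrightarrow> m r * of_real (r powr (- \<kappa>)) = c"
    by (rule has_vector_derivative_zero_constant[OF _ zero]) auto
  have "m r = c * of_real (r powr \<kappa>)" if "0 < r" "r < 1" for r
  proof -
    have "c * of_real (r powr \<kappa>) = m r * of_real (r powr (- \<kappa>) * r powr \<kappa>)"
      using c[of r] that by simp
    also have "r powr (- \<kappa>) * r powr \<kappa> = 1" using that by (simp flip: powr_add)
    finally show ?thesis by simp
  qed
  then show ?thesis by (rule that)
qed

lemma phi_moment:
  assumes lam: "0 \<le> lam" and f: "lam_analytic lam f"
  obtains c where "\<And>r. 0 < r \<Longrightarrow> r < 1 \<Longrightarrow> pairing lam (circ f r) (circ (phi lam n) 1) = c * of_real (r ^ n)"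
proof -
  let ?m = "\<lambda>r. pairing lam (circ f r) (circ (phi lam n) 1)"
  have "(?m has_vector_derivative of_real (real n) * ?m r / of_real r) (at r)" if "0 < r" "r < 1" for r
    using radial_moment_deriv[OF lam f angular_phi[OF lam] that] by (simp add: pairing_cmult_right)
  then obtain c where c: "\<And>r. 0 < r \<Longrightarrow> r < 1 \<Longrightarrow> ?m r = c * of_real (r powr real n)"
    using euler_ode[of ?m "real n"] by blast
  show ?thesis by (rule that[of c]) (use c in \<open>simp add: powr_realpow\<close>)
qed

text \<open>If a function is orthogonal to every homogeneous solution, its moments of frequency at most \<open>n\<close> vanish by
  induction on \<open>n\<close>: the moment against \<open>cis (- n * t)\<close> then solves the Euler equation of degree
  \<open>- (n + 2 * lam)\<close> and is bounded near the origin, and orthogonality to the solution of degree \<open>n\<close>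
  disposes of \<open>cis (n * t)\<close>.\<close>
lemma moments_vanish:
  assumes lam: "0 \<le> lam" and f: "lam_analytic lam f"
    and orth: "\<And>n r. 0 < r \<Longrightarrow> r < 1 \<Longrightarrow> pairing lam (circ f r) (circ (phi lam n) 1) = 0"
  shows "\<bar>k\<bar> \<le> int n \<Longrightarrow> 0 < r \<Longrightarrow> r < 1 \<Longrightarrow> pairing lam (circ f r) (expi k) = 0"
proof (induction n arbitrary: k r rule: less_induct)
  case (less n)
  have cf: "continuous_on unit_disc f" by (rule lam_analytic_continuous[OF f])
  have cc: "continuous_on S (circ f r)" if "0 < r" "r < 1" for r S
    using continuous_on_circ[OF cf] that by simp
  have low: "pairing lam (circ f r) (expi k) = 0" if "\<bar>k\<bar> < int n" "0 < r" "r < 1" for k r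
    by (rule less.IH[of "nat \<bar>k\<bar>"]) (use that in auto)
  have neg: "pairing lam (circ f r) (expi (- int n)) = 0" if n: "n \<noteq> 0" and r: "0 < r" "r < 1" for r
  proof -
    let ?m = "\<lambda>r. pairing lam (circ f r) (expi (- int n))"
    let ?k = "- (real n + 2 * lam)"
    have "(?m has_vector_derivative of_real ?k * ?m r / of_real r) (at r)" if r: "0 < r" "r < 1" for r
    proof -
      let ?W = "\<lambda>t. of_real (- real n) * expi (- int n) t
        - (\<Sum>j<n. of_real (2 * lam) * expi (int n - 2 - 2 * int j) t)"
      have "pairing lam (circ f r) ?W = pairing lam (circ f r) (\<lambda>t. of_real (- real n) * expi (- int n) t)
          - pairing lam (circ f r) (\<lambda>t. \<Sum>j<n. of_real (2 * lam) * expi (int n - 2 - 2 * int j) t)"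
        by (intro pairing_diff_right lam cc r continuous_intros continuous_on_expi)
      also have "pairing lam (circ f r) (\<lambda>t. \<Sum>j<n. of_real (2 * lam) * expi (int n - 2 - 2 * int j) t)
          = (\<Sum>j<n. pairing lam (circ f r) (\<lambda>t. of_real (2 * lam) * expi (int n - 2 - 2 * int j) t))"
        by (intro pairing_sum_right lam cc r continuous_intros continuous_on_expi) auto
      also have "\<dots> = (\<Sum>j<n. of_real (2 * lam) * pairing lam (circ f r) (expi (int n - 2 - 2 * int j)))"
        by (simp only: pairing_cmult_right complex_cnj_complex_of_real)
      also have "\<dots> = (\<Sum>j<n. if j = n - 1 then of_real (2 * lam) * ?m r else 0)"
      proof (intro sum.cong refl)
        fix j assume j: "j \<in> {..<n}"
        show "of_real (2 * lam) * pairing lam (circ f r) (expi (int n - 2 - 2 * int j))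
            = (if j = n - 1 then of_real (2 * lam) * ?m r else 0)"
        proof (cases "j = n - 1")
          case True
          then have "int n - 2 - 2 * int j = - int n" using n by (simp add: of_nat_diff)
          then show ?thesis using True by simp
        next
          case False
          then have "\<bar>int n - 2 - 2 * int j\<bar> < int n" using j by auto
          then show ?thesis using False low[OF _ r] by simp
        qed
      qed
      also have "\<dots> = of_real (2 * lam) * ?m r" using n by simp
      also have "pairing lam (circ f r) (\<lambda>t. of_real (- real n) * expi (- int n) t) = of_real (- real n) * ?m r"
        by (simp only: pairing_cmult_right complex_cnj_complex_of_real)
      also have "of_real (- real n) * ?m r - of_real (2 * lam) * ?m r = of_real ?k * ?m r"
        by (simp add: algebra_simps)
      finally have W: "pairing lam (circ f r) ?W = of_real ?k * ?m r" .
      show ?thesis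
        by (rule radial_moment_deriv[OF lam f angular_expi[of lam n] r, unfolded W])
    qed
    then obtain c where c: "\<And>r. 0 < r \<Longrightarrow> r < 1 \<Longrightarrow> ?m r = c * of_real (r powr ?k)"
      using euler_ode[of ?m ?k] by blast
    have "bounded (f ` cball 0 (1/2))"
      by (intro compact_imp_bounded compact_continuous_image continuous_on_subset[OF cf]) auto
    then obtain B where B: "\<And>z. z \<in> cball 0 (1/2) \<Longrightarrow> norm (f z) \<le> B"
      unfolding bounded_iff by blast
    define C where "C = integral {-pi..pi} (\<lambda>t. B * weight lam t)"
    have mC: "norm (?m s) \<le> C" if s: "0 < s" "s \<le> 1/2" for s
    proof -
      have "norm (?m s) \<le> 1 * integral {-pi..pi} (\<lambda>t. norm (circ f s t) * weight lam t)"
        by (rule norm_pairing_le[OF lam cc continuous_on_expi]) (use s in \<open>auto simp: expi_def\<close>)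
      also have "\<dots> \<le> C"
        unfolding C_def mult_1
      proof (rule integral_le)
        show "(\<lambda>t. norm (circ f s t) * weight lam t) integrable_on {-pi..pi}"
          "(\<lambda>t. B * weight lam t) integrable_on {-pi..pi}"
          using s by (auto intro!: integrable_continuous_real continuous_intros cc continuous_on_weight lam)
        fix t
        have "norm (circ f s t) \<le> B" unfolding circ_def by (rule B) (use s in \<open>simp add: norm_mult\<close>)
        then show "norm (circ f s t) * weight lam t \<le> B * weight lam t"
          by (rule mult_right_mono) (rule weight_nonneg)
      qed
      finally show ?thesis .
    qed
    have pos: "0 < - ?k" using n lam by simp
    have "norm c \<le> C * s powr (- ?k)" if s: "0 < s" "s \<le> 1/2" for s
    proof -
      have "norm c = norm (?m s) * s powr (- ?k)"
      proof -
        have "s powr ?k * s powr (- ?k) = 1" using s by (simp flip: powr_add)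
        then show ?thesis using c[of s] s by (simp add: norm_mult mult.assoc)
      qed
      then show ?thesis using mC[OF s] by (simp add: mult_right_mono)
    qed
    then have "\<forall>\<^sub>F s in at_right 0. norm c \<le> C * s powr (- ?k)"
      using eventually_at_right_less[of "0::real"] eventually_at_right_field[of _ "0::real"]
      by (auto simp: eventually_at_right_field intro!: exI[of _ "1/2"])
    moreover have "((\<lambda>s. C * s powr (- ?k)) \<longlongrightarrow> C * 0) (at_right 0)"
    proof (intro tendsto_intros)
      have "((\<lambda>s. s powr (- ?k)) \<longlongrightarrow> 0 powr (- ?k)) (at_right 0)"
        by (rule tendsto_powr') (use pos in \<open>auto intro!: tendsto_eq_intros eventually_at_right_less simp: eventually_at_right_field intro: exI[of _ 1]\<close>)
      then show "((\<lambda>s. s powr (- ?k)) \<longlongrightarrow> 0) (at_right 0)" by simp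
    qed
    ultimately have "norm c \<le> C * 0"
      by (intro tendsto_lowerbound[of _ _ "at_right (0::real)"]) auto
    then show ?thesis using c[OF r] by simp
  qed
  show ?case
  proof (cases "\<bar>k\<bar> < int n")
    case True then show ?thesis using low less.prems by blast
  next
    case False
    then have k: "k = int n \<or> k = - int n" using less.prems(1) by linarith
    have "k = int n \<Longrightarrow> pairing lam (circ f r) (expi (int n)) = 0"
    proof -
      note r = less.prems(2,3)
      let ?P = "\<lambda>j. of_real (phi_coeff lam n j) * pairing lam (circ f r) (expi (int n - 2 * int j))"
      have "0 = pairing lam (circ f r) (\<lambda>t. \<Sum>j\<le>n. of_real (phi_coeff lam n j) * expi (int n - 2 * int j) t)"
        using orth[OF r, of n] by (simp only: phi_circle_expi[abs_def])
      also have "\<dots> = (\<Sum>j\<le>n. pairing lam (circ f r) (\<lambda>t. of_real (phi_coeff lam n j) * expi (int n - 2 * int j) t))"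
        by (intro pairing_sum_right lam cc r continuous_intros continuous_on_expi) auto
      also have "\<dots> = (\<Sum>j\<le>n. ?P j)"
        by (simp only: pairing_cmult_right complex_cnj_complex_of_real)
      also have "\<dots> = (\<Sum>j\<le>n. if j = 0 then ?P 0 else 0)"
      proof (intro sum.cong refl)
        fix j assume j: "j \<in> {..n}"
        have "pairing lam (circ f r) (expi (int n - 2 * int j)) = 0" if "j \<noteq> 0"
        proof (cases "j = n")
          case True
          then show ?thesis using neg[OF _ r] that by simp
        next
          case False
          then show ?thesis using low[OF _ r] that j by auto
        qed
        then show "?P j = (if j = 0 then ?P 0 else 0)" by auto
      qed
      also have "\<dots> = of_real (phi_coeff lam n 0) * pairing lam (circ f r) (expi (int n))" by simp
      finally show ?thesis
        using bc_pos[OF lam, of n] by (simp add: phi_coeff_def ac_def)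
    qed
    then show ?thesis using k neg less.prems by (cases "n = 0") auto
  qed
qed

inductive trig :: "(real \<Rightarrow> complex) \<Rightarrow> bool" where
  expi: "trig (\<lambda>t. c * expi k t)"
| add: "trig u \<Longrightarrow> trig v \<Longrightarrow> trig (\<lambda>t. u t + v t)"

lemma trig_mult:
  assumes "trig u" "trig v" shows "trig (\<lambda>t. u t * v t)"
  using assms(1)
proof induction
  case (expi c k)
  show ?case using assms(2)
  proof induction
    case (expi d l)
    have "(\<lambda>t. c * expi k t * (d * expi l t)) = (\<lambda>t. (c * d) * expi (k + l) t)"
      by (rule ext) (simp add: expi_def distrib_right flip: cis_mult)
    then show ?case using trig.expi[of "c * d" "k + l"] by simp
  next
    case (add u v)
    then show ?case using trig.add[OF add.IH] by (simp add: distrib_left)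
  qed
next
  case (add u v)
  then show ?case using trig.add[OF add.IH] by (simp add: distrib_right)
qed

lemma trig_polynomial:
  assumes "real_polynomial_function p"
  shows "trig (\<lambda>t. complex_of_real (p (cis t)))"
  using assms
proof induction
  case (linear p)
  have "complex_of_real (p (cis t)) = (p 1 - \<i> * p \<i>) / 2 * expi 1 t + (p 1 + \<i> * p \<i>) / 2 * expi (- 1) t" for t
  proof -
    have "p (cis t) = p (cos t *\<^sub>R 1 + sin t *\<^sub>R \<i>)"
      by (rule arg_cong[of _ _ p]) (simp add: complex_eq_iff)
    also have "\<dots> = cos t * p 1 + sin t * p \<i>"
      using linear by (simp add: bounded_linear.linear linear_add linear_scale)
    finally show ?thesis
      by (simp add: expi_def complex_eq_iff field_simps)
  qed
  then show ?case using trig.add[OF trig.expi trig.expi] by presburger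
next
  case (const c)
  show ?case using trig.expi[of "of_real c" 0] by (simp add: expi_def)
next
  case (add f g) then show ?case using trig.add by fastforce
next
  case (mult f g) then show ?case using trig_mult by fastforce
qed

lemma trig_continuous: "trig u \<Longrightarrow> continuous_on S u"
  by (induction rule: trig.induct) (auto intro!: continuous_intros continuous_on_expi)

lemma trig_orthogonal:
  assumes lam: "0 \<le> lam" and h: "continuous_on {-pi..pi} h"
    and orth: "\<And>k. pairing lam h (expi k) = 0" and u: "trig u"
  shows "pairing lam h u = 0"
  using u
proof induction
  case (expi c k) then show ?case by (simp add: pairing_cmult_right orth)
next
  case (add u v)
  then show ?case by (simp add: pairing_add_right lam h trig_continuous)
qed

lemma trig_approx:
  fixes g :: "complex \<Rightarrow> complex"
  assumes g: "continuous_on (sphere 0 1) g" and e: "0 < e"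
  obtains u where "trig u" "\<And>t. norm (g (cis t) - u t) < e"
proof -
  have cr: "continuous_on (sphere 0 1) (\<lambda>z. Re (g z))" and ci: "continuous_on (sphere 0 1) (\<lambda>z. Im (g z))"
    by (intro continuous_intros g)+
  have e2: "0 < e/2" using e by simp
  obtain p where p: "real_polynomial_function p" "\<And>z. z \<in> sphere 0 1 \<Longrightarrow> \<bar>Re (g z) - p z\<bar> < e/2"
    by (rule Stone_Weierstrass_real_polynomial_function[OF compact_sphere cr e2]) (rule that; blast)
  obtain q where q: "real_polynomial_function q" "\<And>z. z \<in> sphere 0 1 \<Longrightarrow> \<bar>Im (g z) - q z\<bar> < e/2"
    by (rule Stone_Weierstrass_real_polynomial_function[OF compact_sphere ci e2]) (rule that; blast)
  let ?u = "\<lambda>t. complex_of_real (p (cis t)) + \<i> * complex_of_real (q (cis t))"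
  have "trig (\<lambda>t. \<i> * expi 0 t)" by (rule trig.expi)
  then have "trig (\<lambda>t. \<i>)" by (simp add: expi_def)
  then have "trig ?u"
    by (intro trig.add trig_mult trig_polynomial p q)
  moreover have "norm (g (cis t) - ?u t) < e" for t
  proof -
    have "norm (g (cis t) - ?u t) \<le> \<bar>Re (g (cis t) - ?u t)\<bar> + \<bar>Im (g (cis t) - ?u t)\<bar>"
      by (rule cmod_le)
    also have "\<dots> < e/2 + e/2"
      using p(2)[of "cis t"] q(2)[of "cis t"] by (intro add_strict_mono) auto
    finally show ?thesis by simp
  qed
  ultimately show ?thesis by (rule that)
qed

lemma integral_complex_of_real:
  fixes g :: "real \<Rightarrow> real"
  assumes "continuous_on {a..b} g"
  shows "integral {a..b} (\<lambda>t. complex_of_real (g t)) = of_real (integral {a..b} g)"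
  using integral_linear[OF integrable_continuous_real[OF assms] bounded_linear_of_real]
  by (simp add: o_def)

text \<open>Trigonometric polynomials are uniformly dense on the circle, so vanishing moments force \<open>f\<close> to be orthogonal to
  itself. On the real axis, where the weight can vanish, continuity of \<open>f\<close> is used instead.\<close>
lemma lam_analytic_unique:
  assumes lam: "0 \<le> lam" and f: "lam_analytic lam f"
    and orth: "\<And>n r. 0 < r \<Longrightarrow> r < 1 \<Longrightarrow> pairing lam (circ f r) (circ (phi lam n) 1) = 0"
    and z: "z \<in> unit_disc"
  shows "f z = 0"
proof -
  have cf: "continuous_on unit_disc f" by (rule lam_analytic_continuous[OF f])
  have nonreal: "f z = 0" if z: "z \<in> unit_disc" "Im z \<noteq> 0" for z
  proof -
    define r where "r = norm z"
    have r: "0 < r" "r < 1" using z by (auto simp: r_def)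
    let ?h = "circ f r"
    have ch: "continuous_on S ?h" for S using continuous_on_circ[OF cf] r by simp
    have mom: "pairing lam ?h (expi k) = 0" for k
      by (rule moments_vanish[OF lam f orth, of k "nat \<bar>k\<bar>" r]) (use r in auto)
    define C where "C = integral {-pi..pi} (\<lambda>t. norm (?h t) * weight lam t)"
    have small: "norm (pairing lam ?h ?h) \<le> e * C" if e: "e > 0" for e
    proof -
      have "continuous_on (sphere 0 1) (\<lambda>w. f (of_real r * w))"
        by (rule continuous_on_compose2[OF cf]) (use r in \<open>auto simp: norm_mult intro!: continuous_intros\<close>)
      then obtain u where u: "trig u" "\<And>t. norm (f (of_real r * cis t) - u t) < e"
        using trig_approx[of "\<lambda>w. f (of_real r * w)" e] e by blast
      have "pairing lam ?h (\<lambda>t. ?h t - u t) = pairing lam ?h ?h - pairing lam ?h u"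
        by (intro pairing_diff_right lam ch trig_continuous u)
      also have "pairing lam ?h u = 0"
        by (rule trig_orthogonal[OF lam ch mom u(1)])
      finally have "norm (pairing lam ?h ?h) = norm (pairing lam ?h (\<lambda>t. ?h t - u t))" by simp
      also have "\<dots> \<le> e * C"
        unfolding C_def
        by (rule norm_pairing_le[OF lam ch continuous_on_diff[OF ch trig_continuous[OF u(1)]]])
          (use u(2) in \<open>simp add: circ_def less_imp_le\<close>)
      finally show ?thesis .
    qed
    have "norm (pairing lam ?h ?h) \<le> 0"
    proof (rule field_le_epsilon)
      fix d :: real assume d: "d > 0"
      have C0: "C \<ge> 0" unfolding C_def
        by (rule Henstock_Kurzweil_Integration.integral_nonneg)
          (auto intro!: integrable_continuous_real continuous_intros ch continuous_on_weight lam simp: weight_nonneg)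
      have "norm (pairing lam ?h ?h) \<le> d / (C + 1) * C" using C0 d by (intro small) auto
      also have "\<dots> \<le> 0 + d" using C0 d by (simp add: field_simps)
      finally show "norm (pairing lam ?h ?h) \<le> 0 + d" .
    qed
    then have P0: "pairing lam ?h ?h = 0" by simp
    have "pairing lam ?h ?h = integral {-pi..pi} (\<lambda>t. complex_of_real ((norm (?h t))\<^sup>2 * weight lam t))"
      unfolding pairing_def
      by (rule arg_cong[where f = "integral {-pi..pi}"], rule ext) (simp only: of_real_mult complex_norm_square)
    also have "\<dots> = of_real (integral {-pi..pi} (\<lambda>t. (norm (?h t))\<^sup>2 * weight lam t))"
      by (intro integral_complex_of_real continuous_intros ch continuous_on_weight lam)
    finally have "integral {-pi..pi} (\<lambda>t. (norm (?h t))\<^sup>2 * weight lam t) = 0"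
      using P0 by simp
    then have all0: "\<forall>t\<in>{-pi..pi}. (norm (?h t))\<^sup>2 * weight lam t = 0"
      by (subst (asm) integral_eq_0_iff)
        (auto intro!: continuous_intros ch continuous_on_weight lam simp: weight_nonneg)
    have polar: "of_real r * cis (Arg z) = z"
      using rcis_cmod_Arg[of z] by (simp add: r_def rcis_def)
    have "Im z = r * sin (Arg z)" using arg_cong[OF polar, of Im] by simp
    then have "sin (Arg z) \<noteq> 0" using z by auto
    then have "weight lam (Arg z) \<noteq> 0" by (simp add: weight_def)
    moreover have "Arg z \<in> {-pi..pi}" using Arg_bounded[of z] by auto
    ultimately have "?h (Arg z) = 0" using all0 by force
    then show ?thesis using polar by (simp add: circ_def)
  qed
  show ?thesis
  proof (cases "Im z = 0")
    case False then show ?thesis using nonreal z by blast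
  next
    case True
    have lim: "((\<lambda>t. z + \<i> * complex_of_real t) \<longlongrightarrow> z) (at 0)"
      by (auto intro!: tendsto_eq_intros)
    have "isCont f z" using cf z continuous_on_eq_continuous_at[OF open_ball] by blast
    then have "((\<lambda>t. f (z + \<i> * complex_of_real t)) \<longlongrightarrow> f z) (at 0)"
      using isCont_tendsto_compose lim by blast
    moreover have "\<forall>\<^sub>F t in at 0. f (z + \<i> * complex_of_real t) = 0"
      using topological_tendstoD[OF lim open_ball z] eventually_neq_at_within[of "0::real" 0 UNIV]
    proof eventually_elim
      case (elim t) then show ?case using True by (intro nonreal) auto
    qed
    ultimately have "((\<lambda>t. 0::complex) \<longlongrightarrow> f z) (at (0::real))"
      by (rule Lim_transform_eventually)
    then have "0 = f z" by (rule LIM_const_eq)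
    then show ?thesis by simp
  qed
qed

section \<open>Expansion in homogeneous solutions\<close>

definition phi_norm2 :: "real \<Rightarrow> nat \<Rightarrow> real" where
  "phi_norm2 lam n = integral {-pi..pi} (\<lambda>t. (norm (circ (phi lam n) 1 t))\<^sup>2 * weight lam t)"

definition l1 :: "real \<Rightarrow> (real \<Rightarrow> complex) \<Rightarrow> real" where
  "l1 lam u = integral {-pi..pi} (\<lambda>t. norm (u t) * weight lam t)"

text \<open>A bound for the order of growth in \<open>n\<close> of \<open>(phi_mass lam n)\<^sup>2 / phi_norm2 lam n\<close>.\<close>
definition growth :: "real \<Rightarrow> nat" where
  "growth lam = nat \<lceil>2 * lam + 1\<rceil>"

text \<open>The coefficients are the same for all radii; this is what a series of homogeneous solutions requires.\<close>
definition has_coeffs :: "real \<Rightarrow> (complex \<Rightarrow> complex) \<Rightarrow> (nat \<Rightarrow> complex) \<Rightarrow> bool" where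
  "has_coeffs lam f c \<longleftrightarrow> (\<forall>n r. 0 < r \<longrightarrow> r < 1 \<longrightarrow>
     pairing lam (circ f r) (circ (phi lam n) 1) = c n * of_real (r ^ n * phi_norm2 lam n))"

lemma l1_nonneg: "0 \<le> l1 lam u"
  unfolding l1_def by (cases "(\<lambda>t. norm (u t) * weight lam t) integrable_on {-pi..pi}")
    (auto intro!: Henstock_Kurzweil_Integration.integral_nonneg simp: weight_nonneg not_integrable_integral)

lemma l1_le:
  assumes lam: "0 \<le> lam" and u: "continuous_on {-pi..pi} u"
    and M: "\<And>t. t \<in> {-pi..pi} \<Longrightarrow> norm (u t) \<le> M"
  shows "l1 lam u \<le> M * integral {-pi..pi} (weight lam)"
proof -
  have "l1 lam u \<le> integral {-pi..pi} (\<lambda>t. M * weight lam t)"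
    unfolding l1_def
    by (intro integral_le integrable_continuous_real continuous_intros continuous_on_weight lam u
        mult_right_mono M weight_nonneg)
  then show ?thesis by simp
qed

lemma norm_circ_phi_le: "0 \<le> lam \<Longrightarrow> norm (circ (phi lam n) 1 t) \<le> phi_mass lam n"
  using norm_phi_le[of lam n "cis t"] by (simp add: circ_def)

lemma norm_cis_minus_1_le: "norm (cis x - 1) \<le> \<bar>x\<bar>"
proof -
  have "cis x - 1 = cis (x/2) * (cis (x/2) - cis (- (x/2)))"
    by (simp add: right_diff_distrib cis_mult)
  also have "cis (x/2) - cis (- (x/2)) = 2 * \<i> * of_real (sin (x/2))"
    by (simp add: complex_eq_iff)
  finally have "norm (cis x - 1) = 2 * \<bar>sin (x/2)\<bar>" by (simp add: norm_mult)
  then show ?thesis using abs_sin_x_le_abs_x[of "x/2"] by simp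
qed

lemma phi_circle_ge:
  assumes lam: "0 \<le> lam" and t: "\<bar>t\<bar> \<le> 1 / (2 * (real n + 1))"
  shows "phi_mass lam n / 2 \<le> norm (circ (phi lam n) 1 t)"
proof -
  have nt: "real n * \<bar>t\<bar> \<le> 1/2"
  proof -
    have "real n * \<bar>t\<bar> \<le> real n * (1 / (2 * (real n + 1)))" by (intro mult_left_mono t) auto
    also have "\<dots> \<le> 1/2" by (simp add: field_simps)
    finally show ?thesis .
  qed
  have "circ (phi lam n) 1 t - of_real (phi_mass lam n)
      = (\<Sum>j\<le>n. of_real (phi_coeff lam n j) * (expi (int n - 2 * int j) t - 1))"
    by (simp add: phi_circle_expi phi_mass_def right_diff_distrib sum_subtractf)
  also have "norm \<dots> \<le> (\<Sum>j\<le>n. phi_coeff lam n j * (1/2))"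
  proof (rule sum_norm_le)
    fix j assume j: "j \<in> {..n}"
    have "norm (expi (int n - 2 * int j) t - 1) \<le> \<bar>of_int (int n - 2 * int j) * t\<bar>"
      unfolding expi_def by (rule norm_cis_minus_1_le)
    also have "\<dots> = of_int \<bar>int n - 2 * int j\<bar> * \<bar>t\<bar>" by (simp add: abs_mult)
    also have "\<dots> \<le> of_int (int n) * \<bar>t\<bar>"
      using j by (intro mult_right_mono of_int_le_iff[THEN iffD2]) auto
    also have "\<dots> \<le> 1/2" using nt by simp
    finally have "phi_coeff lam n j * norm (expi (int n - 2 * int j) t - 1) \<le> phi_coeff lam n j * (1/2)"
      by (intro mult_left_mono phi_coeff_nonneg lam)
    then show "norm (of_real (phi_coeff lam n j) * (expi (int n - 2 * int j) t - 1)) \<le> phi_coeff lam n j * (1/2)"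
      using phi_coeff_nonneg[OF lam, of n j] by (simp only: norm_mult norm_of_real abs_of_nonneg)
  qed
  also have "\<dots> = phi_mass lam n / 2" unfolding sum_distrib_right[symmetric] phi_mass_def by simp
  finally have "norm (of_real (phi_mass lam n) - circ (phi lam n) 1 t) \<le> phi_mass lam n / 2"
    by (simp add: norm_minus_commute)
  moreover have "norm (complex_of_real (phi_mass lam n)) = phi_mass lam n"
    using phi_mass_pos[OF lam, of n] by simp
  ultimately show ?thesis
    using norm_triangle_ineq2[of "of_real (phi_mass lam n)" "circ (phi lam n) 1 t"] by linarith
qed

lemma sin_ge_half:
  fixes x :: real
  assumes "0 \<le> x" "x \<le> 1" shows "x / 2 \<le> sin x"
proof (cases "x = 0")
  case False
  then have x: "0 < x" using assms by simp
  have "\<exists>z. 0 < z \<and> z < x \<and> sin x - sin 0 = (x - 0) * cos z"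
    by (rule MVT2[OF x]) (auto intro: DERIV_sin)
  then obtain z where z: "0 < z" "z < x" "sin x = x * cos z" by auto
  have "cos (pi/3) \<le> cos z"
    using z assms pi_gt3 by (intro cos_monotone_0_pi_le) auto
  then show ?thesis using z x by (simp add: cos_60)
qed simp

text \<open>The solution of degree \<open>n\<close> stays above half of its maximum \<open>phi_mass lam n\<close> on an arc of length of order
  \<open>1 / n\<close> around the positive axis, on which the weight is at least of order \<open>n powr (- 2 * lam)\<close>.\<close>
lemma phi_norm2_ge:
  assumes lam: "0 \<le> lam"
  shows "(phi_mass lam n)\<^sup>2 \<le> 4 * (8 * (real n + 1)) ^ growth lam * phi_norm2 lam n"
proof -
  define d where "d = 1 / (8 * (real n + 1))"
  have d: "0 < d" "d \<le> 1/8" by (auto simp: d_def field_simps)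
  let ?g = "\<lambda>t. (norm (circ (phi lam n) 1 t))\<^sup>2 * weight lam t"
  have cg: "continuous_on S ?g" for S
    by (intro continuous_intros continuous_on_circ_phi lam continuous_on_weight)
  let ?m = "(phi_mass lam n / 2)\<^sup>2 * d powr (2 * lam)"
  have "?m * (4 * d - 2 * d) = integral {2*d..4*d} (\<lambda>t. ?m)"
    using d by simp
  also have "\<dots> \<le> integral {2*d..4*d} ?g"
  proof (rule integral_le)
    show "(\<lambda>t. ?m) integrable_on {2*d..4*d}" "?g integrable_on {2*d..4*d}"
      by (auto intro!: integrable_continuous_real cg)
    fix t assume t: "t \<in> {2*d..4*d}"
    have "4 * d = 1 / (2 * (real n + 1))" by (simp add: d_def field_simps)
    then have "\<bar>t\<bar> \<le> 1 / (2 * (real n + 1))" using t d by auto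
    then have 1: "phi_mass lam n / 2 \<le> norm (circ (phi lam n) 1 t)" by (rule phi_circle_ge[OF lam])
    have "d \<le> t / 2" using t by simp
    also have "\<dots> \<le> sin t" using t d by (intro sin_ge_half) auto
    finally have "d \<le> \<bar>sin t\<bar>" by simp
    then have 2: "d powr (2 * lam) \<le> weight lam t"
      using d lam by (auto simp: weight_def intro: powr_mono2)
    show "?m \<le> ?g t"
      using phi_mass_pos[OF lam, of n] by (intro mult_mono 2 power_mono 1) auto
  qed
  also have "\<dots> \<le> phi_norm2 lam n"
    unfolding phi_norm2_def
    by (rule integral_subset_le)
      (use d pi_gt3 in \<open>auto intro!: integrable_continuous_real cg simp: weight_nonneg\<close>)
  finally have 3: "?m * (2 * d) \<le> phi_norm2 lam n" by simp
  have "d ^ growth lam = d powr real (growth lam)" using d by (simp add: powr_realpow)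
  also have "\<dots> \<le> d powr (2 * lam + 1)"
    using d lam by (intro powr_mono') (auto simp: growth_def)
  also have "\<dots> = d powr (2 * lam) * d" using d by (simp add: powr_add)
  finally have "(phi_mass lam n / 2)\<^sup>2 * d ^ growth lam \<le> (phi_mass lam n / 2)\<^sup>2 * (d powr (2 * lam) * d)"
    by (intro mult_left_mono) auto
  also have "\<dots> \<le> ?m * (2 * d)" using d by (simp add: mult_ac)
  also note 3
  finally have "(phi_mass lam n / 2)\<^sup>2 * d ^ growth lam \<le> phi_norm2 lam n" .
  then show ?thesis
    by (simp add: d_def power_divide power_one_over field_simps)
qed

lemma phi_norm2_pos: "0 \<le> lam \<Longrightarrow> 0 < phi_norm2 lam n"
proof -
  assume lam: "0 \<le> lam"
  have "0 < (phi_mass lam n)\<^sup>2" using phi_mass_pos[OF lam, of n] by simp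
  then have "0 < 4 * (8 * (real n + 1)) ^ growth lam * phi_norm2 lam n"
    using phi_norm2_ge[OF lam, of n] by linarith
  then show ?thesis by (simp add: zero_less_mult_iff)
qed

lemma pairing_phi_self:
  assumes lam: "0 \<le> lam"
  shows "pairing lam (circ (phi lam n) 1) (circ (phi lam n) 1) = of_real (phi_norm2 lam n)"
proof -
  have "pairing lam (circ (phi lam n) 1) (circ (phi lam n) 1)
      = integral {-pi..pi} (\<lambda>t. complex_of_real ((norm (circ (phi lam n) 1 t))\<^sup>2 * weight lam t))"
    unfolding pairing_def
    by (rule arg_cong[where f = "integral {-pi..pi}"], rule ext) (simp only: of_real_mult complex_norm_square)
  also have "\<dots> = of_real (phi_norm2 lam n)"
    unfolding phi_norm2_def
    by (intro integral_complex_of_real continuous_intros continuous_on_circ_phi continuous_on_weight lam)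
  finally show ?thesis .
qed

lemma pairing_phi_orthogonal:
  assumes lam: "0 \<le> lam" and "n \<noteq> m"
  shows "pairing lam (circ (phi lam n) 1) (circ (phi lam m) 1) = 0"
proof -
  have "of_real (real n) * pairing lam (circ (phi lam n) 1) (circ (phi lam m) 1)
      = of_real (real m) * pairing lam (circ (phi lam n) 1) (circ (phi lam m) 1)"
    using angular_selfadjoint[OF lam angular_phi[OF lam, of n] angular_phi[OF lam, of m]]
    by (simp only: pairing_cmult_left pairing_cmult_right complex_cnj_complex_of_real)
  then show ?thesis using assms(2) by simp
qed

text \<open>A coefficient is a moment divided by \<open>phi_norm2 lam n\<close>; the moment is at most \<open>phi_mass lam n\<close> times the
  \<open>L\<^sup>1\<close> mean. Only continuity of \<open>f\<close> enters, so the bound applies to a locally uniform limit before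
  that is known to be \<open>lam\<close>-analytic.\<close>
lemma coeff_bound:
  assumes lam: "0 \<le> lam" and f: "continuous_on unit_disc f" and c: "has_coeffs lam f c"
    and R: "0 < R" "R < 1"
  shows "norm (c n) * phi_mass lam n * R ^ n
    \<le> 4 * 8 ^ growth lam * (real n + 1) ^ growth lam * l1 lam (circ f R)"
proof -
  let ?A = "phi_mass lam n" and ?N = "phi_norm2 lam n"
  have N: "?N > 0" and A: "?A > 0" using phi_norm2_pos phi_mass_pos lam by auto
  have "norm (c n) * R ^ n * ?N = norm (pairing lam (circ f R) (circ (phi lam n) 1))"
    using c R N by (simp add: has_coeffs_def norm_mult norm_power)
  also have "\<dots> \<le> ?A * l1 lam (circ f R)"
    unfolding l1_def
    by (intro norm_pairing_le lam continuous_on_circ[OF f] continuous_on_circ_phi norm_circ_phi_le)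
      (use R in auto)
  finally have 1: "norm (c n) * R ^ n * ?N \<le> ?A * l1 lam (circ f R)" .
  have "norm (c n) * ?A * R ^ n * ?N = ?A * (norm (c n) * R ^ n * ?N)" by simp
  also have "\<dots> \<le> ?A * (?A * l1 lam (circ f R))" using 1 A by (intro mult_left_mono) auto
  also have "\<dots> = ?A\<^sup>2 * l1 lam (circ f R)" by (simp add: power2_eq_square)
  also have "\<dots> \<le> 4 * (8 * (real n + 1)) ^ growth lam * ?N * l1 lam (circ f R)"
    by (intro mult_right_mono phi_norm2_ge lam l1_nonneg)
  also have "\<dots> = 4 * 8 ^ growth lam * (real n + 1) ^ growth lam * l1 lam (circ f R) * ?N"
    unfolding power_mult_distrib by (simp only: mult_ac)
  finally show ?thesis using N by simp
qed

text \<open>With \<open>x = t ^ (K + 1)\<close>, each of \<open>K\<close> of the factors \<open>t ^ n\<close> absorbs one factor \<open>n + 1\<close>, since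
  \<open>(n + 1) * t ^ n \<le> (\<Sum>k\<le>n. t ^ k) \<le> 1 / (1 - t)\<close>; the remaining one is summed.\<close>
lemma polynomial_geometric_sum:
  assumes x: "0 \<le> x" "x < 1"
  shows "summable (\<lambda>n. (real n + 1) ^ K * x ^ n)"
    and "(\<Sum>n. (real n + 1) ^ K * x ^ n) \<le> ((real K + 1) / (1 - x)) ^ (K + 1)"
proof -
  define t where "t = root (K + 1) x"
  have tK: "t ^ (K + 1) = x" unfolding t_def using x by (intro real_root_pow_pos2) auto
  have t: "0 \<le> t" "t < 1" using x by (auto simp: t_def)
  have step: "(real n + 1) * t ^ n \<le> 1 / (1 - t)" for n
  proof -
    have "(real n + 1) * t ^ n = (\<Sum>k<Suc n. t ^ n)" by simp
    also have "\<dots> \<le> (\<Sum>k<Suc n. t ^ k)"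
      using t by (intro sum_mono power_decreasing) auto
    also have "\<dots> = (1 - t ^ Suc n) / (1 - t)" using t by (simp only: sum_gp_strict) simp
    also have "\<dots> \<le> 1 / (1 - t)" using t by (intro divide_right_mono) auto
    finally show ?thesis .
  qed
  have bound: "(real n + 1) ^ K * x ^ n \<le> (1 / (1 - t)) ^ K * t ^ n" for n
  proof -
    have "x ^ n = (t ^ n) ^ K * t ^ n"
      unfolding tK[symmetric] by (simp flip: power_mult power_add add: algebra_simps)
    then have "(real n + 1) ^ K * x ^ n = ((real n + 1) * t ^ n) ^ K * t ^ n"
      by (simp add: power_mult_distrib)
    also have "\<dots> \<le> (1 / (1 - t)) ^ K * t ^ n"
      using t by (intro mult_right_mono power_mono step) auto
    finally show ?thesis .
  qed
  have sg: "(\<lambda>n. (1 / (1 - t)) ^ K * t ^ n) sums ((1 / (1 - t)) ^ K * (1 / (1 - t)))"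
    using t by (intro sums_mult geometric_sums) auto
  show s: "summable (\<lambda>n. (real n + 1) ^ K * x ^ n)"
    by (rule summable_comparison_test'[OF sums_summable[OF sg]]) (use bound x in simp)
  have "(\<Sum>n. (real n + 1) ^ K * x ^ n) \<le> (1 / (1 - t)) ^ K * (1 / (1 - t))"
    unfolding sums_unique[OF sg] by (rule suminf_le[OF bound s sums_summable[OF sg]])
  also have "\<dots> = (1 / (1 - t)) ^ (K + 1)" by simp
  also have "\<dots> \<le> ((real K + 1) / (1 - x)) ^ (K + 1)"
  proof (rule power_mono)
    have "1 - x = (1 - t) * (\<Sum>k<K+1. t ^ k)"
      unfolding tK[symmetric] by (rule one_diff_power_eq)
    also have "\<dots> \<le> (1 - t) * (\<Sum>k<K+1. 1)"
      using t by (intro mult_left_mono sum_mono power_le_one) auto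
    finally show "1 / (1 - t) \<le> (real K + 1) / (1 - x)"
      using t x by (simp add: field_simps)
  qed (use t in auto)
  finally show "(\<Sum>n. (real n + 1) ^ K * x ^ n) \<le> ((real K + 1) / (1 - x)) ^ (K + 1)" .
qed

definition point_const :: "real \<Rightarrow> real" where
  "point_const lam = 4 * 8 ^ growth lam * (real (growth lam) + 1) ^ (growth lam + 1)"

lemma point_const_pos: "0 < point_const lam"
  by (simp add: point_const_def)

lemma series_bound:
  assumes lam: "0 \<le> lam" and R: "0 < R" "R < 1" and z: "norm z < R"
    and c: "\<And>n. norm (c n) * phi_mass lam n * R ^ n
      \<le> 4 * 8 ^ growth lam * (real n + 1) ^ growth lam * I"
    and s: "(\<lambda>n. c n * phi lam n z) sums s" and I: "0 \<le> I"
  shows "norm s \<le> point_const lam / (R - norm z) ^ (growth lam + 1) * I"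
proof -
  let ?K = "growth lam" and ?x = "norm z / R"
  let ?g = "\<lambda>n. 4 * 8 ^ ?K * I * ((real n + 1) ^ ?K * ?x ^ n)"
  have x: "0 \<le> ?x" "?x < 1" using R z by auto
  have "norm (c n * phi lam n z) \<le> ?g n" for n
  proof -
    have "norm (c n * phi lam n z) \<le> norm (c n) * (phi_mass lam n * norm z ^ n)"
      unfolding norm_mult by (intro mult_left_mono norm_phi_le lam) auto
    also have "\<dots> = norm (c n) * phi_mass lam n * R ^ n * ?x ^ n"
      using R by (simp add: power_divide)
    also have "\<dots> \<le> 4 * 8 ^ ?K * (real n + 1) ^ ?K * I * ?x ^ n"
      using x by (intro mult_right_mono c) auto
    finally show ?thesis by (simp add: mult_ac)
  qed
  then have "norm (\<Sum>n. c n * phi lam n z) \<le> (\<Sum>n. ?g n)"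
    by (intro norm_suminf_le summable_mult polynomial_geometric_sum x)
  also have "\<dots> = 4 * 8 ^ ?K * I * (\<Sum>n. (real n + 1) ^ ?K * ?x ^ n)"
    by (rule suminf_mult[OF polynomial_geometric_sum(1)[OF x]])
  also have "\<dots> \<le> 4 * 8 ^ ?K * I * ((real ?K + 1) / (1 - ?x)) ^ (?K + 1)"
    using I by (intro mult_left_mono polynomial_geometric_sum x) auto
  also have "\<dots> \<le> 4 * 8 ^ ?K * I * ((real ?K + 1) / (R - norm z)) ^ (?K + 1)"
  proof (intro mult_left_mono power_mono divide_left_mono)
    have "R * (1 - ?x) \<le> 1 * (1 - ?x)" using R x by (intro mult_right_mono) auto
    then show "R - norm z \<le> 1 - ?x" using R by (simp add: right_diff_distrib)
  qed (use I R z x in \<open>auto intro!: mult_pos_pos\<close>)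
  also have "\<dots> = point_const lam / (R - norm z) ^ (?K + 1) * I"
    unfolding point_const_def power_divide by simp
  finally show ?thesis using sums_unique[OF s] by simp
qed

lemma disc_summable_coeffs:
  assumes lam: "0 \<le> lam" and f: "continuous_on unit_disc f" and c: "has_coeffs lam f c"
  shows "disc_summable (\<lambda>n. norm (c n) * phi_mass lam n)"
  unfolding disc_summable_def
proof (intro allI impI)
  fix r :: real assume r: "0 \<le> r" "r < 1"
  define R where "R = (1 + r) / 2"
  have R: "0 < R" "R < 1" "r < R" using r by (auto simp: R_def)
  let ?g = "\<lambda>n. 4 * 8 ^ growth lam * l1 lam (circ f R) * ((real n + 1) ^ growth lam * (r / R) ^ n)"
  show "summable (\<lambda>n. norm (c n) * phi_mass lam n * r ^ n)"
  proof (rule summable_comparison_test')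
    show "summable ?g"
      by (intro summable_mult polynomial_geometric_sum) (use r R in auto)
    fix n
    have "norm (c n) * phi_mass lam n * r ^ n = norm (c n) * phi_mass lam n * R ^ n * (r / R) ^ n"
      using R by (simp add: power_divide)
    also have "\<dots> \<le> 4 * 8 ^ growth lam * (real n + 1) ^ growth lam * l1 lam (circ f R) * (r / R) ^ n"
      using r R by (intro mult_right_mono coeff_bound[OF lam f c]) auto
    finally show "norm (norm (c n) * phi_mass lam n * r ^ n) \<le> ?g n"
      using phi_mass_pos[OF lam, of n] r by (simp add: mult_ac)
  qed
qed

lemma has_coeffs_diff:
  assumes lam: "0 \<le> lam" and f: "continuous_on unit_disc f" "has_coeffs lam f c"
    and g: "continuous_on unit_disc g" "has_coeffs lam g d"
  shows "has_coeffs lam (\<lambda>z. f z - g z) (\<lambda>n. c n - d n)"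
  unfolding has_coeffs_def
proof (intro allI impI)
  fix n and r :: real assume r: "0 < r" "r < 1"
  have "pairing lam (\<lambda>t. circ f r t - circ g r t) (circ (phi lam n) 1)
      = pairing lam (circ f r) (circ (phi lam n) 1) - pairing lam (circ g r) (circ (phi lam n) 1)"
    using r by (intro pairing_diff_left lam continuous_on_circ f g continuous_on_circ_phi) auto
  moreover have "circ (\<lambda>z. f z - g z) r = (\<lambda>t. circ f r t - circ g r t)"
    by (simp add: circ_def[abs_def])
  ultimately show "pairing lam (circ (\<lambda>z. f z - g z) r) (circ (phi lam n) 1)
      = (c n - d n) * of_real (r ^ n * phi_norm2 lam n)"
    using f(2) g(2) r by (simp add: has_coeffs_def left_diff_distrib)
qed

lemma pairing_uniform_limit:
  assumes lam: "0 \<le> lam" and r: "0 \<le> r" "r < 1"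
    and F: "\<And>k. continuous_on unit_disc (F k)" and f: "continuous_on unit_disc f"
    and lim: "uniform_limit (cball 0 r) F f sequentially"
  shows "(\<lambda>k. pairing lam (circ (F k) r) (circ (phi lam n) 1)) \<longlonglongrightarrow> pairing lam (circ f r) (circ (phi lam n) 1)"
proof (rule LIMSEQ_I)
  fix e :: real assume e: "0 < e"
  define W where "W = integral {-pi..pi} (weight lam)"
  have W: "0 \<le> W" unfolding W_def
    by (intro Henstock_Kurzweil_Integration.integral_nonneg integrable_continuous_real continuous_on_weight lam)
      (simp add: weight_nonneg)
  have A: "0 < phi_mass lam n" by (rule phi_mass_pos[OF lam])
  define d where "d = e / (phi_mass lam n * (W + 1))"
  have d: "0 < d" using e W A by (simp add: d_def)
  obtain N where N: "\<And>k z. k \<ge> N \<Longrightarrow> z \<in> cball 0 r \<Longrightarrow> dist (F k z) (f z) < d"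
    using uniform_limitD[OF lim d] unfolding eventually_sequentially by blast
  show "\<exists>N. \<forall>k\<ge>N. norm (pairing lam (circ (F k) r) (circ (phi lam n) 1)
      - pairing lam (circ f r) (circ (phi lam n) 1)) < e"
  proof (intro exI[of _ N] allI impI)
    fix k assume k: "k \<ge> N"
    let ?u = "\<lambda>t. circ (F k) r t - circ f r t"
    have cu: "continuous_on {-pi..pi} ?u"
      by (intro continuous_intros continuous_on_circ F f r)
    have "pairing lam (circ (F k) r) (circ (phi lam n) 1) - pairing lam (circ f r) (circ (phi lam n) 1)
        = pairing lam ?u (circ (phi lam n) 1)"
      by (intro pairing_diff_left[symmetric] lam continuous_on_circ F f r continuous_on_circ_phi)
    also have "norm \<dots> \<le> phi_mass lam n * l1 lam ?u"
      unfolding l1_def by (intro norm_pairing_le lam cu continuous_on_circ_phi norm_circ_phi_le)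
    also have "\<dots> \<le> phi_mass lam n * (d * W)"
    proof (intro mult_left_mono l1_le[OF lam cu, folded W_def])
      fix t
      have "of_real r * cis t \<in> cball 0 r" using r by (simp add: norm_mult)
      from N[OF k this] show "norm (?u t) \<le> d" by (simp add: circ_def dist_norm)
    qed (use A in auto)
    also have "\<dots> = e * (W / (W + 1))" using A by (simp add: d_def)
    also have "\<dots> < e * 1" using e W by (intro mult_strict_left_mono) auto
    also have "e * 1 = e" by simp
    finally show "norm (pairing lam (circ (F k) r) (circ (phi lam n) 1)
      - pairing lam (circ f r) (circ (phi lam n) 1)) < e" .
  qed
qed

lemma has_coeffs_phi_series:
  assumes lam: "0 \<le> lam" and c: "disc_summable (\<lambda>n. norm (c n) * phi_mass lam n)"
  shows "has_coeffs lam (phi_series lam c) c"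
  unfolding has_coeffs_def
proof (intro allI impI)
  fix m and r :: real assume r: "0 < r" "r < 1"
  let ?b = "\<lambda>n j. c n * complex_of_real (phi_coeff lam n j)"
  let ?F = "\<lambda>N z. \<Sum>n<N. c n * phi lam n z"
  have cphi: "continuous_on S (phi lam n)" for S n
    unfolding phi_def hom_form_def[abs_def] by (intro continuous_intros)
  have lim: "uniform_limit (cball 0 r) ?F (phi_series lam c) sequentially"
    using uniform_limit_biseries[of ?b r] c r
    by (simp add: bsum_phi_series[OF lam] phi_series_def phi_def hom_cmult)
  have limit: "(\<lambda>N. pairing lam (circ (?F N) r) (circ (phi lam m) 1)) \<longlonglongrightarrow>
      pairing lam (circ (phi_series lam c) r) (circ (phi lam m) 1)"
    by (intro pairing_uniform_limit lam lim lam_analytic_continuous[OF lam_analytic_phi_series] c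
       continuous_intros cphi) (use r in auto)
  have const: "\<forall>\<^sub>F N in sequentially. pairing lam (circ (?F N) r) (circ (phi lam m) 1)
      = c m * of_real (r ^ m * phi_norm2 lam m)"
    using eventually_gt_at_top[of m]
  proof eventually_elim
    case (elim N)
    have "circ (?F N) r = (\<lambda>t. \<Sum>n<N. (c n * of_real (r ^ n)) * circ (phi lam n) 1 t)"
      by (rule ext) (simp add: circ_def phi_scale mult.assoc)
    moreover have "pairing lam (\<lambda>t. \<Sum>n<N. (c n * of_real (r ^ n)) * circ (phi lam n) 1 t) (circ (phi lam m) 1)
        = (\<Sum>n<N. pairing lam (\<lambda>t. (c n * of_real (r ^ n)) * circ (phi lam n) 1 t) (circ (phi lam m) 1))"
      unfolding pairing_def sum_distrib_right
      by (intro integral_sum integrable_continuous_real continuous_intros continuous_on_circ_phi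
          continuous_on_weight lam) auto
    moreover have "\<dots> = (\<Sum>n<N. if n = m then c m * of_real (r ^ m * phi_norm2 lam m) else 0)"
      by (intro sum.cong refl)
        (simp add: pairing_cmult_left pairing_phi_orthogonal[OF lam] pairing_phi_self[OF lam] mult.assoc)
    ultimately show ?case using elim by simp
  qed
  show "pairing lam (circ (phi_series lam c) r) (circ (phi lam m) 1)
      = c m * of_real (r ^ m * phi_norm2 lam m)"
    by (rule LIMSEQ_unique[OF limit tendsto_eventually[OF const]])
qed

text \<open>The series formed with the coefficients of \<open>f\<close> is \<open>lam\<close>-analytic and has the same coefficients, so its
  difference from \<open>f\<close> is orthogonal to all homogeneous solutions and vanishes.\<close>
lemma lam_analytic_expansion:
  assumes lam: "0 \<le> lam" and f: "lam_analytic lam f"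
  obtains c where "has_coeffs lam f c" "\<And>z. z \<in> unit_disc \<Longrightarrow> (\<lambda>n. c n * phi lam n z) sums f z"
proof -
  have cf: "continuous_on unit_disc f" by (rule lam_analytic_continuous[OF f])
  have "\<exists>c. \<forall>r. 0 < r \<longrightarrow> r < 1 \<longrightarrow>
      pairing lam (circ f r) (circ (phi lam n) 1) = c * of_real (r ^ n)" for n
    using phi_moment[OF lam f] by metis
  then obtain c' where c': "\<And>n r. 0 < r \<Longrightarrow> r < 1 \<Longrightarrow>
      pairing lam (circ f r) (circ (phi lam n) 1) = c' n * of_real (r ^ n)" by metis
  define c where "c n = c' n / of_real (phi_norm2 lam n)" for n
  have hc: "has_coeffs lam f c"
    using c' phi_norm2_pos[OF lam] by (simp add: has_coeffs_def c_def less_imp_neq[symmetric])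
  note ds = disc_summable_coeffs[OF lam cf hc]
  let ?g = "phi_series lam c"
  have g: "lam_analytic lam ?g" by (rule lam_analytic_phi_series[OF lam ds])
  have hd: "has_coeffs lam (\<lambda>z. f z - ?g z) (\<lambda>n. c n - c n)"
    by (intro has_coeffs_diff lam cf hc lam_analytic_continuous[OF g] has_coeffs_phi_series ds)
  have "f z - ?g z = 0" if "z \<in> unit_disc" for z
    using hd by (intro lam_analytic_unique[OF lam lam_analytic_diff[OF f g] _ that]) (simp add: has_coeffs_def)
  then have "(\<lambda>n. c n * phi lam n z) sums f z" if "z \<in> unit_disc" for z
    using phi_series_sums[OF lam ds, of z] that by simp
  with hc show ?thesis by (rule that)
qed

lemma point_bound:
  assumes lam: "0 \<le> lam" and f: "lam_analytic lam f" and R: "R < 1" and z: "norm z < R"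
  shows "norm (f z) \<le> point_const lam / (R - norm z) ^ (growth lam + 1) * l1 lam (circ f R)"
proof -
  obtain c where c: "has_coeffs lam f c" and s: "\<And>z. z \<in> unit_disc \<Longrightarrow> (\<lambda>n. c n * phi lam n z) sums f z"
    using lam_analytic_expansion[OF lam f] by blast
  have R0: "0 < R" using z norm_ge_zero[of z] by linarith
  show ?thesis
    by (rule series_bound[OF lam R0 R z coeff_bound[OF lam lam_analytic_continuous[OF f] c R0 R]])
      (use s z R l1_nonneg in auto)
qed

text \<open>The coefficients of \<open>F k\<close> converge to those of \<open>f\<close>. Applying the bounds to the continuous function
  \<open>F k - f\<close>, whose coefficients are the differences, shows that the expansion of \<open>F k\<close> converges to
  the series with the limiting coefficients, which therefore represents \<open>f\<close>.\<close>
lemma lam_analytic_limit: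
  assumes lam: "0 \<le> lam" and F: "\<And>k. lam_analytic lam (F k)"
    and lim: "\<And>r. 0 \<le> r \<Longrightarrow> r < 1 \<Longrightarrow> uniform_limit (cball 0 r) F f sequentially"
  shows "lam_analytic lam f"
proof -
  have cF: "continuous_on unit_disc (F k)" for k by (rule lam_analytic_continuous[OF F])
  have cf: "continuous_on unit_disc f"
  proof (rule continuous_at_imp_continuous_on, rule ballI)
    fix z :: complex assume z: "z \<in> unit_disc"
    define r where "r = (1 + norm z) / 2"
    have r: "0 \<le> r" "r < 1" "norm z < r" using z by (auto simp: r_def)
    have "continuous_on (cball 0 r) f"
    proof (rule uniform_limit_theorem[OF _ lim[OF r(1,2)]])
      show "\<forall>\<^sub>F k in sequentially. continuous_on (cball 0 r) (F k)"
        using r by (intro always_eventually allI continuous_on_subset[OF cF]) auto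
    qed simp
    then have "continuous_on (ball 0 r) f" by (rule continuous_on_subset) auto
    moreover have "z \<in> ball 0 r" using r by simp
    ultimately show "isCont f z" using continuous_on_eq_continuous_at[OF open_ball] by blast
  qed
  have "\<exists>c. has_coeffs lam (F k) c \<and> (\<forall>z\<in>unit_disc. (\<lambda>n. c n * phi lam n z) sums F k z)" for k
    using lam_analytic_expansion[OF lam F[of k]] by metis
  then obtain c where c: "\<And>k. has_coeffs lam (F k) (c k)"
    and sc: "\<And>k z. z \<in> unit_disc \<Longrightarrow> (\<lambda>n. c k n * phi lam n z) sums F k z" by metis
  have pl: "(\<lambda>k. c k n * of_real (r ^ n * phi_norm2 lam n)) \<longlonglongrightarrow> pairing lam (circ f r) (circ (phi lam n) 1)"
    if r: "0 < r" "r < 1" for n r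
    using pairing_uniform_limit[OF lam _ _ cF cf lim, of r n] c r by (simp add: has_coeffs_def)
  define d where "d n = pairing lam (circ f (1/2)) (circ (phi lam n) 1) / of_real ((1/2) ^ n * phi_norm2 lam n)" for n
  have N: "phi_norm2 lam n \<noteq> 0" for n using phi_norm2_pos[OF lam, of n] by simp
  have cd: "(\<lambda>k. c k n) \<longlonglongrightarrow> d n" for n
  proof -
    have "(\<lambda>k. c k n * of_real ((1/2) ^ n * phi_norm2 lam n) / of_real ((1/2) ^ n * phi_norm2 lam n)) \<longlonglongrightarrow> d n"
      unfolding d_def by (rule tendsto_divide[OF pl tendsto_const]) (use N in auto)
    then show ?thesis using N by simp
  qed
  have hd: "has_coeffs lam f d"
    unfolding has_coeffs_def
  proof (intro allI impI)
    fix n and r :: real assume r: "0 < r" "r < 1"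
    have "(\<lambda>k. c k n * of_real (r ^ n * phi_norm2 lam n)) \<longlonglongrightarrow> d n * of_real (r ^ n * phi_norm2 lam n)"
      by (intro tendsto_intros cd)
    then show "pairing lam (circ f r) (circ (phi lam n) 1) = d n * of_real (r ^ n * phi_norm2 lam n)"
      using pl[OF r] LIMSEQ_unique by blast
  qed
  note ds = disc_summable_coeffs[OF lam cf hd]
  have "phi_series lam d z = f z" if z: "z \<in> unit_disc" for z
  proof -
    define R where "R = (1 + norm z) / 2"
    have R: "0 < R" "R < 1" "norm z < R" using z by (auto simp: R_def add_pos_nonneg)
    define D where "D = point_const lam / (R - norm z) ^ (growth lam + 1)"
    have D: "0 \<le> D" using R point_const_pos[of lam] by (simp add: D_def)
    define W where "W = integral {-pi..pi} (weight lam)"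
    have W: "0 \<le> W" unfolding W_def
      by (intro Henstock_Kurzweil_Integration.integral_nonneg integrable_continuous_real continuous_on_weight lam)
        (simp add: weight_nonneg)
    have b: "norm (F k z - phi_series lam d z) \<le> D * l1 lam (circ (\<lambda>z. F k z - f z) R)" for k
      unfolding D_def
    proof (rule series_bound[OF lam R])
      have "continuous_on unit_disc (\<lambda>z. F k z - f z)" by (intro continuous_intros cF cf)
      from coeff_bound[OF lam this has_coeffs_diff[OF lam cF c cf hd] R(1,2)]
      show "norm (c k n - d n) * phi_mass lam n * R ^ n \<le> 4 * 8 ^ growth lam * (real n + 1) ^ growth lam
          * l1 lam (circ (\<lambda>z. F k z - f z) R)" for n .
      show "(\<lambda>n. (c k n - d n) * phi lam n z) sums (F k z - phi_series lam d z)"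
        unfolding left_diff_distrib using z by (intro sums_diff sc phi_series_sums lam ds) auto
    qed (rule l1_nonneg)
    have "(\<lambda>k. F k z - phi_series lam d z) \<longlonglongrightarrow> 0"
    proof (rule LIMSEQ_I)
      fix e :: real assume e: "0 < e"
      define \<delta> where "\<delta> = e / (D * W + 1)"
      have \<delta>: "0 < \<delta>" using e D W by (simp add: \<delta>_def add_nonneg_pos)
      obtain N where N: "\<And>k z. k \<ge> N \<Longrightarrow> z \<in> cball 0 R \<Longrightarrow> dist (F k z) (f z) < \<delta>"
        using uniform_limitD[OF lim[OF less_imp_le[OF R(1)] R(2)] \<delta>] unfolding eventually_sequentially by blast
      show "\<exists>N. \<forall>k\<ge>N. norm (F k z - phi_series lam d z - 0) < e"
      proof (intro exI[of _ N] allI impI)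
        fix k assume k: "k \<ge> N"
        have "l1 lam (circ (\<lambda>z. F k z - f z) R) \<le> \<delta> * W"
          unfolding W_def
        proof (rule l1_le[OF lam])
          show "continuous_on {-pi..pi} (circ (\<lambda>z. F k z - f z) R)"
            using R by (intro continuous_on_circ continuous_intros cF cf) auto
          fix t
          have "of_real R * cis t \<in> cball 0 R" using R by (simp add: norm_mult)
          from N[OF k this] show "norm (circ (\<lambda>z. F k z - f z) R t) \<le> \<delta>"
            by (simp add: circ_def dist_norm)
        qed
        then have "D * l1 lam (circ (\<lambda>z. F k z - f z) R) \<le> D * (\<delta> * W)"
          using D by (rule mult_left_mono)
        also have "\<dots> < e"
        proof -
          have "D * (\<delta> * W) = e * (D * W / (D * W + 1))" by (simp add: \<delta>_def)
          also have "\<dots> < e * 1"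
            using e D W by (intro mult_strict_left_mono) (auto simp: divide_less_eq_1 add_nonneg_pos)
          finally show ?thesis by simp
        qed
        finally show "norm (F k z - phi_series lam d z - 0) < e" using b[of k] by simp
      qed
    qed
    then have "(\<lambda>k. F k z) \<longlonglongrightarrow> phi_series lam d z" by (simp add: LIM_zero_iff)
    moreover have "(\<lambda>k. F k z) \<longlonglongrightarrow> f z"
      using tendsto_uniform_limitI[OF lim[of R], of z] R by simp
    ultimately show ?thesis by (rule LIMSEQ_unique)
  qed
  then show ?thesis using lam_analytic_cong[OF lam_analytic_phi_series[OF lam ds]] by blast
qed

section \<open>The Hardy means\<close>

text \<open>The mean of order \<open>q\<close> before the \<open>q\<close>-th root is taken.\<close>
definition mass :: "real \<Rightarrow> real \<Rightarrow> (real \<Rightarrow> complex) \<Rightarrow> real" where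
  "mass lam q u = c_tilde lam * integral {-pi..pi} (\<lambda>t. norm (u t) powr q * weight lam t)"

lemma c_tilde_pos: "0 \<le> lam \<Longrightarrow> 0 < c_tilde lam"
  unfolding c_tilde_def c_lam_def by (auto intro!: divide_pos_pos mult_pos_pos Gamma_real_pos)

lemma continuous_on_norm_powr:
  "continuous_on S u \<Longrightarrow> 0 < q \<Longrightarrow> continuous_on S (\<lambda>t. norm (u t :: complex) powr q)"
  by (intro continuous_on_powr' continuous_intros) auto

text \<open>The density of the measure is \<open>c_tilde lam\<close> times the continuous weight except possibly at the zeros of
  the sine.\<close>
lemma integral_m_lam:
  fixes g :: "real \<Rightarrow> real"
  assumes lam: "0 \<le> lam" and g: "continuous_on UNIV g"
  shows "integral\<^sup>L (m_lam lam) g = c_tilde lam * integral {-pi..pi} (\<lambda>t. g t * weight lam t)"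
proof -
  have mg: "g \<in> borel_measurable borel" by (rule borel_measurable_continuous_onI[OF g])
  let ?d = "\<lambda>t. c_tilde lam * \<bar>sin t\<bar> powr (2 * lam)"
  have "integral\<^sup>L (m_lam lam) g = integral\<^sup>L (restrict_space lborel {-pi..pi}) (\<lambda>t. ?d t *\<^sub>R g t)"
    unfolding m_lam_def
  proof (rule integral_density)
    show "g \<in> borel_measurable (restrict_space lborel {-pi..pi})"
      by (rule measurable_restrict_space1) (use mg in simp)
    show "?d \<in> borel_measurable (restrict_space lborel {-pi..pi})"
      by (rule measurable_restrict_space1) simp
    show "AE t in restrict_space lborel {-pi..pi}. 0 \<le> ?d t"
      using c_tilde_pos[OF lam] by (intro AE_I2) simp
  qed
  also have "\<dots> = integral\<^sup>L lborel (\<lambda>t. indicator {-pi..pi} t *\<^sub>R (?d t *\<^sub>R g t))"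
    by (rule integral_restrict_space) simp
  also have "\<dots> = integral\<^sup>L lborel (\<lambda>t. indicator {-pi..pi} t *\<^sub>R (c_tilde lam * (g t * weight lam t)))"
  proof (rule integral_cong_AE)
    have "AE t in lborel. t \<notin> {-pi, 0, pi :: real}"
      by (intro AE_not_in finite_imp_null_set_lborel) simp
    then show "AE t in lborel. indicator {-pi..pi} t *\<^sub>R (?d t *\<^sub>R g t)
        = indicator {-pi..pi} t *\<^sub>R (c_tilde lam * (g t * weight lam t))"
    proof eventually_elim
      case (elim t)
      have "sin t \<noteq> 0" if "t \<in> {-pi..pi}"
      proof (cases "0 < t")
        case True then show ?thesis using sin_gt_zero[of t] elim that by auto
      next
        case False then show ?thesis using sin_gt_zero[of "- t"] elim that by auto
      qed
      then show ?case by (auto simp: weight_def indicator_def)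
    qed
    show "(\<lambda>t. indicator {-pi..pi} t *\<^sub>R (?d t *\<^sub>R g t)) \<in> borel_measurable lborel"
      using mg by simp
    have "weight lam \<in> borel_measurable borel"
      by (rule borel_measurable_continuous_onI[OF continuous_on_weight[OF lam]])
    then show "(\<lambda>t. indicator {-pi..pi} t *\<^sub>R (c_tilde lam * (g t * weight lam t))) \<in> borel_measurable lborel"
      using mg by simp
  qed
  also have "\<dots> = integral {-pi..pi} (\<lambda>t. c_tilde lam * (g t * weight lam t))"
    unfolding set_lebesgue_integral_def[symmetric]
    by (intro set_borel_integral_eq_integral borel_integrable_atLeastAtMost' continuous_intros
        continuous_on_weight lam continuous_on_subset[OF g]) auto
  finally show ?thesis by simp
qed

lemma mass_mono:
  assumes lam: "0 \<le> lam" and q: "0 < q" and u: "continuous_on {-pi..pi} u"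
    and g: "continuous_on {-pi..pi} g" and le: "\<And>t. t \<in> {-pi..pi} \<Longrightarrow> norm (u t) powr q \<le> g t"
  shows "mass lam q u \<le> c_tilde lam * integral {-pi..pi} (\<lambda>t. g t * weight lam t)"
  unfolding mass_def
  by (intro mult_left_mono integral_le integrable_continuous_real continuous_intros continuous_on_norm_powr
      continuous_on_weight lam q u g mult_right_mono le weight_nonneg less_imp_le[OF c_tilde_pos])

lemma mass_nonneg:
  assumes "0 \<le> lam" "0 < q" "continuous_on {-pi..pi} u" shows "0 \<le> mass lam q u"
  unfolding mass_def
  by (intro mult_nonneg_nonneg Henstock_Kurzweil_Integration.integral_nonneg integrable_continuous_real
     continuous_intros continuous_on_norm_powr continuous_on_weight less_imp_le[OF c_tilde_pos] assms)
    (auto simp: weight_nonneg)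

definition total_mass :: "real \<Rightarrow> real" where
  "total_mass lam = c_tilde lam * integral {-pi..pi} (weight lam)"

lemma total_mass_nonneg: "0 \<le> lam \<Longrightarrow> 0 \<le> total_mass lam"
  unfolding total_mass_def
  by (intro mult_nonneg_nonneg Henstock_Kurzweil_Integration.integral_nonneg integrable_continuous_real
     continuous_on_weight less_imp_le[OF c_tilde_pos]) (auto simp: weight_nonneg)

lemma mass_le_sup:
  assumes "0 \<le> lam" "0 < q" "continuous_on {-pi..pi} u" "\<And>t. t \<in> {-pi..pi} \<Longrightarrow> norm (u t) \<le> M"
  shows "mass lam q u \<le> M powr q * total_mass lam"
proof -
  have "mass lam q u \<le> c_tilde lam * integral {-pi..pi} (\<lambda>t. M powr q * weight lam t)"
    using assms by (intro mass_mono powr_mono2 continuous_intros) auto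
  then show ?thesis by (simp add: total_mass_def mult_ac)
qed

lemma mass_add_combination:
  assumes lam: "0 \<le> lam" and q: "0 < q"
    and u: "continuous_on {-pi..pi} u" and v: "continuous_on {-pi..pi} v"
    and le: "\<And>t. t \<in> {-pi..pi} \<Longrightarrow> norm (u t + v t) powr q \<le> \<alpha> * norm (u t) powr q + \<beta> * norm (v t) powr q"
  shows "mass lam q (\<lambda>t. u t + v t) \<le> \<alpha> * mass lam q u + \<beta> * mass lam q v"
proof -
  let ?g = "\<lambda>t. \<alpha> * norm (u t) powr q + \<beta> * norm (v t) powr q"
  have "mass lam q (\<lambda>t. u t + v t) \<le> c_tilde lam * integral {-pi..pi} (\<lambda>t. ?g t * weight lam t)"
    by (intro mass_mono lam q continuous_intros continuous_on_norm_powr u v le)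
  also have "integral {-pi..pi} (\<lambda>t. ?g t * weight lam t)
      = integral {-pi..pi} (\<lambda>t. \<alpha> * (norm (u t) powr q * weight lam t) + \<beta> * (norm (v t) powr q * weight lam t))"
    by (simp add: algebra_simps)
  also have "\<dots> = \<alpha> * integral {-pi..pi} (\<lambda>t. norm (u t) powr q * weight lam t)
      + \<beta> * integral {-pi..pi} (\<lambda>t. norm (v t) powr q * weight lam t)"
    by (subst integral_add) (auto intro!: integrable_continuous_real continuous_intros
       continuous_on_norm_powr continuous_on_weight lam q u v)
  finally show ?thesis by (simp add: mass_def algebra_simps)
qed

text \<open>Each of \<open>x\<close>, \<open>y\<close> satisfies \<open>z * (x + y) powr (q - 1) \<le> z powr q\<close>, since \<open>q - 1 \<le> 0\<close>.\<close>
lemma powr_subadditive: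
  fixes x y q :: real
  assumes "0 \<le> x" "0 \<le> y" "0 < q" "q \<le> 1" shows "(x + y) powr q \<le> x powr q + y powr q"
proof (cases "x + y = 0")
  case False
  then have s: "0 < x + y" using assms by linarith
  have part: "z * (x + y) powr (q - 1) \<le> z powr q" if z: "0 \<le> z" "z \<le> x + y" for z
  proof (cases "z = 0")
    case False
    then have "(x + y) powr (q - 1) \<le> z powr (q - 1)"
      using z assms by (intro powr_mono2') auto
    then have "z * (x + y) powr (q - 1) \<le> z * z powr (q - 1)" using z by (intro mult_left_mono)
    then show ?thesis using z False by (simp add: powr_diff)
  qed simp
  have "(x + y) powr q = (x + y) * (x + y) powr (q - 1)" using s by (simp add: powr_diff)
  also have "\<dots> = x * (x + y) powr (q - 1) + y * (x + y) powr (q - 1)" by (rule distrib_right)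
  also have "\<dots> \<le> x powr q + y powr q" using assms by (intro add_mono part) auto
  finally show ?thesis .
qed (use assms in simp)

lemma mass_subadditive:
  assumes "0 \<le> lam" "0 < q" "q \<le> 1" "continuous_on {-pi..pi} u" "continuous_on {-pi..pi} v"
  shows "mass lam q (\<lambda>t. u t + v t) \<le> mass lam q u + mass lam q v"
proof -
  have "mass lam q (\<lambda>t. u t + v t) \<le> 1 * mass lam q u + 1 * mass lam q v"
  proof (rule mass_add_combination)
    fix t
    have "norm (u t + v t) powr q \<le> (norm (u t) + norm (v t)) powr q"
      using assms by (intro powr_mono2 norm_triangle_ineq) auto
    also have "\<dots> \<le> norm (u t) powr q + norm (v t) powr q"
      using assms by (intro powr_subadditive) auto
    finally show "norm (u t + v t) powr q \<le> 1 * norm (u t) powr q + 1 * norm (v t) powr q" by simp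
  qed (use assms in auto)
  then show ?thesis by simp
qed

lemma powr_convex_combination:
  fixes x y q s :: real
  assumes "0 \<le> x" "0 \<le> y" "1 \<le> q" "0 < s" "s < 1"
  shows "(s * x + (1 - s) * y) powr q \<le> s * x powr q + (1 - s) * y powr q"
proof (cases "x = 0 \<or> y = 0")
  case False
  then show ?thesis
    using convex_onD[OF powr_convex[OF assms(3)], of "1 - s" x y] assms by simp
next
  case True
  have one: "s powr q \<le> s" if "0 < s" "s < 1" for s :: real
    using powr_mono'[of 1 q s] that assms(3) by simp
  have "(s * x) powr q \<le> s * x powr q" "((1 - s) * y) powr q \<le> (1 - s) * y powr q"
    using assms one[of s] one[of "1 - s"] by (auto simp: powr_mult intro!: mult_right_mono)
  then show ?thesis using True assms(3) by auto
qed

text \<open>Convexity of \<open>x powr q\<close> is applied to \<open>norm (u t) / a\<close> and \<open>norm (v t) / b\<close> with the weights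
  \<open>a / (a + b)\<close> and \<open>b / (a + b)\<close>. Bounds \<open>a\<close> and \<open>b\<close> instead of the norms themselves avoid division by 0.\<close>
lemma mass_minkowski:
  assumes lam: "0 \<le> lam" and q: "1 \<le> q"
    and u: "continuous_on {-pi..pi} u" and v: "continuous_on {-pi..pi} v"
    and a: "0 < a" "mass lam q u \<le> a powr q" and b: "0 < b" "mass lam q v \<le> b powr q"
  shows "mass lam q (\<lambda>t. u t + v t) \<le> (a + b) powr q"
proof -
  define s where "s = a / (a + b)"
  have s: "0 < s" "s < 1" "1 - s = b / (a + b)" using a b by (auto simp: s_def field_simps)
  let ?P = "(a + b) powr q"
  have P: "0 < ?P" using a b by simp
  have "mass lam q (\<lambda>t. u t + v t)
      \<le> (?P * s / a powr q) * mass lam q u + (?P * (1 - s) / b powr q) * mass lam q v"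
  proof (rule mass_add_combination)
    fix t
    let ?x = "norm (u t)" and ?y = "norm (v t)"
    have "norm (u t + v t) powr q \<le> (?x + ?y) powr q"
      using q by (intro powr_mono2 norm_triangle_ineq) auto
    also have "?x + ?y = (a + b) * (s * (?x / a) + (1 - s) * (?y / b))"
      unfolding s(3) using a b by (simp add: s_def distrib_left)
    also have "\<dots> powr q = ?P * (s * (?x / a) + (1 - s) * (?y / b)) powr q"
      using a b s by (intro powr_mult)
    also have "\<dots> \<le> ?P * (s * (?x / a) powr q + (1 - s) * (?y / b) powr q)"
      using a b s q by (intro mult_left_mono powr_convex_combination) auto
    also have "\<dots> = (?P * s / a powr q) * ?x powr q + (?P * (1 - s) / b powr q) * ?y powr q"
      using a b by (simp add: powr_divide distrib_left)
    finally show "norm (u t + v t) powr q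
        \<le> (?P * s / a powr q) * ?x powr q + (?P * (1 - s) / b powr q) * ?y powr q" .
  qed (use lam q u v in auto)
  also have "\<dots> \<le> (?P * s / a powr q) * a powr q + (?P * (1 - s) / b powr q) * b powr q"
    using a b s P by (intro add_mono mult_left_mono) auto
  also have "\<dots> = ?P * s + ?P * (1 - s)" using a b by simp
  also have "\<dots> = ?P" by (simp add: algebra_simps)
  finally show ?thesis .
qed

text \<open>The metric is the norm for \<open>p \<ge> 1\<close> and its \<open>p\<close>-th power for \<open>p < 1\<close>. In both cases a distance
  is at most \<open>d\<close> exactly if this condition holds for the difference of the two functions on all circles,
  so that the exponents can be treated together from here on.\<close>
definition mean_le :: "real \<Rightarrow> ennreal \<Rightarrow> real \<Rightarrow> (real \<Rightarrow> complex) \<Rightarrow> bool" where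
  "mean_le lam p d u \<longleftrightarrow>
     (if p = \<infinity> then \<forall>t. norm (u t) \<le> d
      else if p < 1 then mass lam (enn2real p) u \<le> d
      else mass lam (enn2real p) u \<le> d powr enn2real p)"

lemma finite_exponent:
  assumes "0 < p" "p \<noteq> \<infinity>"
  obtains q where "0 < q" "p = ennreal q" "enn2real p = q" "p < 1 \<longleftrightarrow> q < 1"
proof -
  have fin: "p < \<infinity>" using assms(2) by (simp add: top.not_eq_extremum)
  then have p: "p = ennreal (enn2real p)" by simp
  have q: "0 < enn2real p" using assms(1) fin by (simp add: enn2real_positive_iff)
  have "p < 1 \<longleftrightarrow> enn2real p < 1"
    by (subst p) (simp add: ennreal_less_one_iff)
  with q p show ?thesis by (intro that) auto
qed

lemma mean_le_minus: "mean_le lam p d (\<lambda>t. - u t) = mean_le lam p d u"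
  by (simp add: mean_le_def mass_def)

lemma mean_le_add:
  assumes lam: "0 \<le> lam" and p: "0 < p"
    and u: "continuous_on {-pi..pi} u" and v: "continuous_on {-pi..pi} v"
    and d: "0 < d" "mean_le lam p d u" and e: "0 < e" "mean_le lam p e v"
  shows "mean_le lam p (d + e) (\<lambda>t. u t + v t)"
proof (cases "p = \<infinity>")
  case True
  then show ?thesis using d e unfolding mean_le_def
    by (auto intro: order_trans[OF norm_triangle_ineq add_mono])
next
  case False
  then obtain q where q: "0 < q" "p = ennreal q" "enn2real p = q" "p < 1 \<longleftrightarrow> q < 1"
    using finite_exponent[OF p] by metis
  show ?thesis
  proof (cases "q < 1")
    case True
    then show ?thesis
      using mass_subadditive[OF lam q(1) _ u v] d e False q by (simp add: mean_le_def)
  next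
    case F: False
    then show ?thesis
      using mass_minkowski[OF lam _ u v, of q d e] d e False q by (simp add: mean_le_def)
  qed
qed

lemma mean_le_small:
  assumes lam: "0 \<le> lam" and p: "0 < p" and e: "0 < e"
  obtains \<eta> where "0 < \<eta>"
    "\<And>u. continuous_on {-pi..pi} u \<Longrightarrow> (\<And>t. norm (u t) \<le> \<eta>) \<Longrightarrow> mean_le lam p e u"
proof (cases "p = \<infinity>")
  case True
  show ?thesis by (rule that[OF e]) (use True in \<open>simp add: mean_le_def\<close>)
next
  case False
  then obtain q where q: "0 < q" "p = ennreal q" "enn2real p = q" "p < 1 \<longleftrightarrow> q < 1"
    using finite_exponent[OF p] by metis
  define T where "T = total_mass lam + 1"
  have T: "0 < T" "total_mass lam \<le> T" using total_mass_nonneg[OF lam] by (auto simp: T_def)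
  define E where "E = (if q < 1 then e else e powr q)"
  have E: "0 < E" using e by (simp add: E_def)
  let ?\<eta> = "(E / T) powr (1 / q)"
  show ?thesis
  proof (rule that)
    show "0 < ?\<eta>" using E T by simp
    fix u :: "real \<Rightarrow> complex" assume u: "continuous_on {-pi..pi} u" "\<And>t. norm (u t) \<le> ?\<eta>"
    have "mass lam q u \<le> ?\<eta> powr q * total_mass lam"
      by (rule mass_le_sup[OF lam q(1) u(1)]) (rule u(2))
    also have "?\<eta> powr q = E / T" using q(1) E T by (simp add: powr_powr)
    also have "E / T * total_mass lam \<le> E / T * T" using E T by (intro mult_left_mono) auto
    also have "\<dots> = E" using T by simp
    finally show "mean_le lam p e u" using q False by (auto simp: mean_le_def E_def)
  qed
qed

lemma Hardy_norm_le_iff: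
  assumes lam: "0 \<le> lam" and p: "0 < p" and f: "continuous_on unit_disc f" and d: "0 \<le> d"
  shows "Hardy_norm lam p f \<le> ennreal (if p < 1 then d powr (1 / enn2real p) else d)
    \<longleftrightarrow> (\<forall>r\<in>{0..<1}. mean_le lam p d (circ f r))"
proof -
  have "M_mean lam p f r \<le> ennreal (if p < 1 then d powr (1 / enn2real p) else d)
      \<longleftrightarrow> mean_le lam p d (circ f r)" if r: "r \<in> {0..<1}" for r
  proof (cases "p = \<infinity>")
    case True
    then show ?thesis using d
      by (simp add: M_mean_def mean_le_def SUP_le_iff circ_def)
  next
    case False
    then obtain q where q: "0 < q" "p = ennreal q" "enn2real p = q" "p < 1 \<longleftrightarrow> q < 1"
      using finite_exponent[OF p] by metis
    have cc: "continuous_on S (circ f r)" for S using continuous_on_circ[OF f] r by simp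
    have M: "M_mean lam p f r = ennreal (mass lam q (circ f r) powr (1 / q))"
      using False q integral_m_lam[OF lam continuous_on_norm_powr[OF cc q(1)]]
      by (simp add: M_mean_def mass_def circ_def)
    have m0: "0 \<le> mass lam q (circ f r)" by (rule mass_nonneg[OF lam q(1) cc])
    have iff: "x powr (1/q) \<le> y powr (1/q) \<longleftrightarrow> x \<le> y" if "0 \<le> x" "0 \<le> y" for x y :: real
    proof
      assume "x powr (1/q) \<le> y powr (1/q)"
      then have "(x powr (1/q)) powr q \<le> (y powr (1/q)) powr q"
        by (rule powr_mono2[rotated 2]) (use q(1) in auto)
      then show "x \<le> y" using that q(1) by (simp add: powr_powr)
    next
      assume "x \<le> y" then show "x powr (1/q) \<le> y powr (1/q)"
        using that q(1) by (intro powr_mono2) auto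
    qed
    show ?thesis
    proof (cases "q < 1")
      case True
      then show ?thesis using M iff[OF m0 d] q False by (simp add: mean_le_def)
    next
      case F: False
      have "(d powr q) powr (1/q) = d" using d q(1) by (simp add: powr_powr)
      then show ?thesis using M iff[OF m0, of "d powr q"] q False F d by (simp add: mean_le_def)
    qed
  qed
  then show ?thesis unfolding Hardy_norm_def SUP_le_iff by blast
qed

section \<open>Point evaluations and completeness\<close>

lemma point_estimate_sup:
  assumes "\<And>r. r \<in> {0..<1} \<Longrightarrow> mean_le lam \<infinity> d (circ f r)" "z \<in> unit_disc"
  shows "norm (f z) \<le> d"
proof -
  have "of_real (norm z) * cis (Arg z) = z"
    using rcis_cmod_Arg[of z] by (simp add: rcis_def)
  then have "f z = circ f (norm z) (Arg z)" by (simp add: circ_def)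
  then show ?thesis using assms(1)[of "norm z"] assms(2) by (simp add: mean_le_def)
qed

lemma l1_le_mass:
  assumes lam: "0 \<le> lam" and q: "0 < q" and u: "continuous_on {-pi..pi} u"
    and le: "\<And>t. t \<in> {-pi..pi} \<Longrightarrow> norm (u t) \<le> \<alpha> + \<beta> * norm (u t) powr q"
  shows "c_tilde lam * l1 lam u \<le> \<alpha> * total_mass lam + \<beta> * mass lam q u"
proof -
  note int = integrable_continuous_real continuous_intros continuous_on_norm_powr continuous_on_weight lam q u
  have "l1 lam u \<le> integral {-pi..pi} (\<lambda>t. (\<alpha> + \<beta> * norm (u t) powr q) * weight lam t)"
    unfolding l1_def by (intro integral_le mult_right_mono le weight_nonneg int)
  also have "\<dots> = integral {-pi..pi} (\<lambda>t. \<alpha> * weight lam t + \<beta> * (norm (u t) powr q * weight lam t))"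
    by (simp add: algebra_simps)
  also have "\<dots> = \<alpha> * integral {-pi..pi} (weight lam) + \<beta> * integral {-pi..pi} (\<lambda>t. norm (u t) powr q * weight lam t)"
    by (subst integral_add) (auto intro!: int)
  finally have "c_tilde lam * l1 lam u \<le> c_tilde lam * (\<alpha> * integral {-pi..pi} (weight lam)
      + \<beta> * integral {-pi..pi} (\<lambda>t. norm (u t) powr q * weight lam t))"
    using c_tilde_pos[OF lam] by (intro mult_left_mono) auto
  then show ?thesis by (simp add: total_mass_def mass_def algebra_simps)
qed

text \<open>The \<open>L\<^sup>1\<close> mean is estimated by the mean of order \<open>q\<close> through the pointwise inequality
  \<open>x \<le> d + d * (x / d) powr q\<close>.\<close>
lemma point_estimate_ge_1:
  assumes lam: "0 \<le> lam" and q: "1 \<le> q" and \<rho>: "\<rho> < 1" and e: "0 < e"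
  obtains d where "0 < d"
    "\<And>f z. lam_analytic lam f \<Longrightarrow> (\<And>r. r \<in> {0..<1} \<Longrightarrow> mass lam q (circ f r) \<le> d powr q) \<Longrightarrow>
       norm z \<le> \<rho> \<Longrightarrow> norm (f z) \<le> e"
proof -
  define R where "R = (1 + max 0 \<rho>) / 2"
  have R: "0 \<le> R" "R < 1" "\<rho> < R" using \<rho> by (auto simp: R_def)
  define B where "B = point_const lam / (R - \<rho>) ^ (growth lam + 1)"
  have B: "0 < B" using R point_const_pos by (simp add: B_def)
  define T where "T = (total_mass lam + 1) / c_tilde lam"
  have T: "0 < T" using total_mass_nonneg[OF lam] c_tilde_pos[OF lam]
    by (auto simp: T_def intro!: divide_pos_pos)
  define d where "d = e / (B * T)"
  have d: "0 < d" using e B T by (simp add: d_def)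
  show ?thesis
  proof (rule that[OF d])
    fix f and z :: complex
    assume f: "lam_analytic lam f" and m: "\<And>r. r \<in> {0..<1} \<Longrightarrow> mass lam q (circ f r) \<le> d powr q"
      and z: "norm z \<le> \<rho>"
    have "c_tilde lam * l1 lam (circ f R) \<le> d * total_mass lam + d / d powr q * mass lam q (circ f R)"
    proof (rule l1_le_mass[OF lam])
      show "continuous_on {-pi..pi} (circ f R)"
        by (rule continuous_on_circ[OF lam_analytic_continuous[OF f] R(1,2)])
      fix t
      let ?x = "norm (circ f R t)"
      show "?x \<le> d + d / d powr q * ?x powr q"
      proof (cases "?x \<le> d")
        case True
        moreover have "0 \<le> d / d powr q * ?x powr q" using d by simp
        ultimately show ?thesis by linarith
      next
        case False
        then have "1 \<le> ?x / d" using d by simp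
        then have "(?x / d) powr 1 \<le> (?x / d) powr q" using q by (intro powr_mono)
        moreover have "0 < ?x / d" using False d by (intro divide_pos_pos) auto
        ultimately have "?x / d \<le> ?x powr q / d powr q" using d by (simp add: powr_divide)
        then have "?x \<le> d / d powr q * ?x powr q" using d by (simp add: field_simps)
        then show ?thesis using d by simp
      qed
    qed (use q in auto)
    also have "\<dots> \<le> d * total_mass lam + d / d powr q * d powr q"
      using d m[of R] R by (intro add_left_mono mult_left_mono) auto
    also have "\<dots> = d * (total_mass lam + 1)" using d by (simp add: algebra_simps)
    finally have l1: "l1 lam (circ f R) \<le> d * T"
      using c_tilde_pos[OF lam] by (simp add: T_def field_simps)
    have "norm (f z) \<le> point_const lam / (R - norm z) ^ (growth lam + 1) * l1 lam (circ f R)"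
      using z R by (intro point_bound lam f) auto
    also have "\<dots> \<le> B * (d * T)"
      unfolding B_def using z R point_const_pos[of lam]
      by (intro mult_mono divide_left_mono power_mono l1 l1_nonneg) (auto intro!: mult_pos_pos zero_less_power)
    also have "\<dots> = e" using B T by (simp add: d_def)
    finally show "norm (f z) \<le> e" .
  qed
qed

text \<open>For exponents below 1 the \<open>L\<^sup>1\<close> mean on a circle is bounded by the mean of order \<open>q\<close> times a power
  \<open>1 - q\<close> of the supremum. With \<open>a * q\<close> equal to the order of growth in the estimate of point values, the
  weighted supremum \<open>G\<close> of \<open>(R - norm z) powr a * norm (f z)\<close> satisfies \<open>G \<le> B * d * G powr (1 - q)\<close>,
  and \<open>G\<close> can be absorbed because it is finite.\<close>
lemma point_estimate_less_1:
  assumes lam: "0 \<le> lam" and q: "0 < q" "q < 1" and \<rho>: "\<rho> < 1" and e: "0 < e"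
  obtains d where "0 < d"
    "\<And>f z. lam_analytic lam f \<Longrightarrow> (\<And>r. r \<in> {0..<1} \<Longrightarrow> mass lam q (circ f r) \<le> d) \<Longrightarrow>
       norm z \<le> \<rho> \<Longrightarrow> norm (f z) \<le> e"
proof -
  define R where "R = (1 + max 0 \<rho>) / 2"
  have R: "0 < R" "R < 1" "\<rho> < R" using \<rho> by (auto simp: R_def)
  define N where "N = growth lam + 1"
  define a where "a = real N / q"
  have a: "0 < a" using q by (simp add: a_def N_def)
  define B where "B = 2 powr a * point_const lam / c_tilde lam"
  have B: "0 < B" using point_const_pos c_tilde_pos[OF lam] by (simp add: B_def)
  define E where "E = e * (R - \<rho>) powr a"
  have E: "0 < E" using e R by (simp add: E_def)
  define d where "d = E powr q / B"
  have d: "0 < d" using E B by (simp add: d_def)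
  show ?thesis
  proof (rule that[OF d])
    fix f and z0 :: complex
    assume f: "lam_analytic lam f" and m: "\<And>r. r \<in> {0..<1} \<Longrightarrow> mass lam q (circ f r) \<le> d"
      and z0: "norm z0 \<le> \<rho>"
    have cf: "continuous_on unit_disc f" by (rule lam_analytic_continuous[OF f])
    let ?h = "\<lambda>z. (R - norm z) powr a * norm (f z)"
    have "bounded (f ` cball 0 R)"
      by (intro compact_imp_bounded compact_continuous_image continuous_on_subset[OF cf]) (use R in auto)
    then obtain C where C: "\<And>z. z \<in> cball 0 R \<Longrightarrow> norm (f z) \<le> C"
      unfolding bounded_iff by blast
    have bdd: "bdd_above (?h ` ball 0 R)"
    proof (rule bdd_aboveI2)
      fix z :: complex assume z: "z \<in> ball 0 R"
      show "?h z \<le> R powr a * C"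
        using z a R by (intro mult_mono powr_mono2 C) auto
    qed
    define G where "G = (SUP z\<in>ball 0 R. ?h z)"
    have hG: "?h z \<le> G" if "norm z < R" for z
      unfolding G_def using that by (intro cSUP_upper bdd) auto
    have G0: "0 \<le> G" using hG[of 0] R by (simp add: order_trans[rotated])
    have step: "?h z \<le> B * d * G powr (1 - q)" if z: "norm z < R" for z
    proof -
      define s where "s = (R - norm z) / 2"
      have s: "0 < s" using z by (simp add: s_def)
      define r where "r = norm z + s"
      have r: "0 \<le> r" "r < 1" "r < R" "norm z < r" "r - norm z = s" "R - r = s" "R - norm z = 2 * s"
        using s z R by (auto simp: r_def s_def field_simps)
      have cr: "continuous_on {-pi..pi} (circ f r)" by (rule continuous_on_circ[OF cf r(1,2)])
      let ?M = "G / s powr a"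
      have M0: "0 \<le> ?M" using G0 by simp
      have ub: "norm (circ f r t) \<le> ?M" for t
      proof -
        have "s powr a * norm (circ f r t) \<le> G"
          using hG[of "of_real r * cis t"] r by (simp add: norm_mult circ_def)
        then show ?thesis using s by (simp add: field_simps)
      qed
      have "c_tilde lam * l1 lam (circ f r) \<le> 0 * total_mass lam + ?M powr (1 - q) * mass lam q (circ f r)"
      proof (rule l1_le_mass[OF lam q(1) cr])
        fix t
        let ?x = "norm (circ f r t)"
        have "?x = ?x powr (1 - q) * ?x powr q"
          by (simp flip: powr_add)
        also have "\<dots> \<le> ?M powr (1 - q) * ?x powr q"
          using q ub by (intro mult_right_mono powr_mono2) auto
        finally show "?x \<le> 0 + ?M powr (1 - q) * ?x powr q" by simp
      qed
      also have "\<dots> \<le> ?M powr (1 - q) * d"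
        using m[of r] r by (simp add: mult_left_mono)
      finally have l1: "l1 lam (circ f r) \<le> ?M powr (1 - q) * d / c_tilde lam"
        using c_tilde_pos[OF lam] by (simp add: field_simps)
      have "norm (f z) \<le> point_const lam / s ^ N * l1 lam (circ f r)"
        using point_bound[OF lam f r(2,4)] r(5) by (simp add: N_def)
      also have "\<dots> \<le> point_const lam / s ^ N * (?M powr (1 - q) * d / c_tilde lam)"
        using s point_const_pos[of lam] by (intro mult_left_mono l1) auto
      finally have "?h z \<le> (2 * s) powr a * (point_const lam / s ^ N * (?M powr (1 - q) * d / c_tilde lam))"
        unfolding r(7) by (rule mult_left_mono) simp
      also have "\<dots> = B * d * G powr (1 - q)"
      proof -
        have "s ^ N = s powr (a * q)" using s q by (simp add: a_def powr_realpow)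
        moreover have "?M powr (1 - q) = G powr (1 - q) / s powr (a * (1 - q))"
          using G0 s by (simp add: powr_divide powr_powr)
        moreover have "s powr a = s powr (a * q) * s powr (a * (1 - q))"
          by (simp add: algebra_simps flip: powr_add)
        moreover have "(2 * s) powr a = 2 powr a * s powr a" using s by (simp add: powr_mult)
        ultimately show ?thesis using s by (simp add: B_def)
      qed
      finally show ?thesis .
    qed
    have GG: "G \<le> B * d * G powr (1 - q)"
      unfolding G_def by (rule cSUP_least) (use step R in \<open>auto simp: G_def\<close>)
    have "G \<le> E"
    proof (rule ccontr)
      assume "\<not> G \<le> E"
      then have GE: "E < G" by simp
      have "B * d = E powr q" using B by (simp add: d_def)
      also have "\<dots> < G powr q" using GE E q by (intro powr_less_mono2) auto
      finally have "B * d * G powr (1 - q) < G powr q * G powr (1 - q)"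
        using GE E by (intro mult_strict_right_mono) auto
      also have "\<dots> = G" using GE E by (simp flip: powr_add)
      finally show False using GG by simp
    qed
    moreover have "(R - \<rho>) powr a * norm (f z0) \<le> ?h z0"
      using z0 R a by (intro mult_right_mono powr_mono2) auto
    moreover have "?h z0 \<le> G" using z0 R by (intro hG) auto
    ultimately have "(R - \<rho>) powr a * norm (f z0) \<le> (R - \<rho>) powr a * e"
      unfolding E_def by (simp only: mult.commute[of e])
    then show "norm (f z0) \<le> e" using R by simp
  qed
qed

text \<open>In this form the estimate is uniform in the exponent: small distance to 0 implies small values on a compact
  subset of the disc.\<close>
lemma point_estimate:
  assumes lam: "0 \<le> lam" and p: "0 < p" and \<rho>: "\<rho> < 1" and e: "0 < e"
  obtains d where "0 < d"
    "\<And>f z. lam_analytic lam f \<Longrightarrow> (\<And>r. r \<in> {0..<1} \<Longrightarrow> mean_le lam p d (circ f r)) \<Longrightarrow>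
       norm z \<le> \<rho> \<Longrightarrow> norm (f z) \<le> e"
proof (cases "p = \<infinity>")
  case True
  show ?thesis
  proof (rule that[OF e])
    fix f and z :: complex
    assume "\<And>r. r \<in> {0..<1} \<Longrightarrow> mean_le lam p e (circ f r)" "norm z \<le> \<rho>"
    then show "norm (f z) \<le> e"
      using point_estimate_sup[of lam e f z] True \<rho> by simp
  qed
next
  case False
  then obtain q where q: "0 < q" "p = ennreal q" "enn2real p = q" "p < 1 \<longleftrightarrow> q < 1"
    using finite_exponent[OF p] by metis
  show ?thesis
  proof (cases "q < 1")
    case True
    obtain d where d: "0 < d"
      "\<And>f z. lam_analytic lam f \<Longrightarrow> (\<And>r. r \<in> {0..<1} \<Longrightarrow> mass lam q (circ f r) \<le> d) \<Longrightarrow>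
       norm z \<le> \<rho> \<Longrightarrow> norm (f z) \<le> e"
      by (rule point_estimate_less_1[OF lam q(1) True \<rho> e]) (rule that; blast)
    show ?thesis by (rule that[OF d(1)], rule d(2)) (use q True False in \<open>auto simp: mean_le_def\<close>)
  next
    case F: False
    then have q1: "1 \<le> q" by simp
    obtain d where d: "0 < d"
      "\<And>f z. lam_analytic lam f \<Longrightarrow> (\<And>r. r \<in> {0..<1} \<Longrightarrow> mass lam q (circ f r) \<le> d powr q) \<Longrightarrow>
       norm z \<le> \<rho> \<Longrightarrow> norm (f z) \<le> e"
      by (rule point_estimate_ge_1[OF lam q1 \<rho> e]) (rule that; blast)
    show ?thesis by (rule that[OF d(1)], rule d(2)) (use q F False in \<open>auto simp: mean_le_def\<close>)
  qed
qed

text \<open>Once \<open>f - F k\<close> is uniformly small on the circle, its mean is at most \<open>e\<close>, and the triangle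
  inequality applies.\<close>
lemma mean_le_limit:
  assumes lam: "0 \<le> lam" and p: "0 < p" and r: "0 \<le> r" "r < 1"
    and F: "\<And>k. continuous_on unit_disc (F k)" and f: "continuous_on unit_disc f"
    and lim: "uniform_limit (cball 0 r) F f sequentially"
    and d: "0 < d" "\<forall>\<^sub>F k in sequentially. mean_le lam p d (circ (F k) r)" and e: "0 < e"
  shows "mean_le lam p (d + e) (circ f r)"
proof -
  obtain \<eta> where \<eta>: "0 < \<eta>"
    "\<And>u. continuous_on {-pi..pi} u \<Longrightarrow> (\<And>t. norm (u t) \<le> \<eta>) \<Longrightarrow> mean_le lam p e u"
    by (rule mean_le_small[OF lam p e]) (rule that; blast)
  have "\<forall>\<^sub>F k in sequentially. mean_le lam p (d + e) (circ f r)"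
    using d(2) uniform_limitD[OF lim \<eta>(1)]
  proof eventually_elim
    case (elim k)
    have cont: "continuous_on {-pi..pi} (circ (F k) r)" "continuous_on {-pi..pi} (circ f r)"
      by (intro continuous_on_circ F f r)+
    have "mean_le lam p e (\<lambda>t. circ f r t - circ (F k) r t)"
    proof (rule \<eta>(2))
      show "continuous_on {-pi..pi} (\<lambda>t. circ f r t - circ (F k) r t)"
        by (intro continuous_intros cont)
      fix t
      have "of_real r * cis t \<in> cball 0 r" using r by (simp add: norm_mult)
      then have "dist (F k (of_real r * cis t)) (f (of_real r * cis t)) < \<eta>" using elim by blast
      then show "norm (circ f r t - circ (F k) r t) \<le> \<eta>"
        by (simp add: circ_def dist_norm norm_minus_commute)
    qed
    from mean_le_add[OF lam p cont(1) continuous_on_diff[OF cont(2,1)] d(1) elim(1) e this]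
    show ?case by simp
  qed
  then show ?thesis by simp
qed

lemma Hardy_norm_finite_iff:
  assumes lam: "0 \<le> lam" and p: "0 < p" and f: "continuous_on unit_disc f"
  shows "Hardy_norm lam p f < \<infinity> \<longleftrightarrow> (\<exists>d>0. \<forall>r\<in>{0..<1}. mean_le lam p d (circ f r))"
proof
  assume fin: "Hardy_norm lam p f < \<infinity>"
  define h where "h = enn2real (Hardy_norm lam p f)"
  have h: "Hardy_norm lam p f = ennreal h" "0 \<le> h" using fin by (auto simp: h_def)
  define d where "d = (if p < 1 then (h + 1) powr enn2real p else h + 1)"
  have d: "0 < d" using h by (simp add: d_def)
  have "Hardy_norm lam p f \<le> ennreal (if p < 1 then d powr (1 / enn2real p) else d)"
  proof -
    have "enn2real p \<noteq> 0" if "p < 1"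
    proof -
      have "p \<noteq> \<infinity>" using that by auto
      then show ?thesis using finite_exponent[OF p] by (metis less_irrefl)
    qed
    then have "h \<le> (if p < 1 then d powr (1 / enn2real p) else d)"
      using h by (auto simp: d_def powr_powr)
    then show ?thesis unfolding h(1) by (rule ennreal_leI)
  qed
  then have "\<forall>r\<in>{0..<1}. mean_le lam p d (circ f r)"
    using Hardy_norm_le_iff[OF lam p f, of d] d by simp
  then show "\<exists>d>0. \<forall>r\<in>{0..<1}. mean_le lam p d (circ f r)" using d by blast
next
  assume "\<exists>d>0. \<forall>r\<in>{0..<1}. mean_le lam p d (circ f r)"
  then obtain d where "0 < d" "\<forall>r\<in>{0..<1}. mean_le lam p d (circ f r)" by blast
  then have "Hardy_norm lam p f \<le> ennreal (if p < 1 then d powr (1 / enn2real p) else d)"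
    using Hardy_norm_le_iff[OF lam p f, of d] by simp
  then show "Hardy_norm lam p f < \<infinity>" using ennreal_less_top order_le_less_trans by fastforce
qed

lemma Hardy_space_diff:
  assumes lam: "0 \<le> lam" and p: "0 < p" and f: "f \<in> Hardy_space lam p" and g: "g \<in> Hardy_space lam p"
  shows "lam_analytic lam (\<lambda>z. f z - g z)" "Hardy_norm lam p (\<lambda>z. f z - g z) < \<infinity>"
proof -
  show l: "lam_analytic lam (\<lambda>z. f z - g z)"
    using f g by (auto simp: Hardy_space_def intro: lam_analytic_diff)
  have cf: "continuous_on unit_disc f" and cg: "continuous_on unit_disc g"
    using f g by (auto simp: Hardy_space_def intro: lam_analytic_continuous)
  obtain d where d: "0 < d" "\<forall>r\<in>{0..<1}. mean_le lam p d (circ f r)"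
    using f Hardy_norm_finite_iff[OF lam p cf] by (auto simp: Hardy_space_def)
  obtain e where e: "0 < e" "\<forall>r\<in>{0..<1}. mean_le lam p e (circ g r)"
    using g Hardy_norm_finite_iff[OF lam p cg] by (auto simp: Hardy_space_def)
  have "mean_le lam p (d + e) (circ (\<lambda>z. f z - g z) r)" if r: "r \<in> {0..<1}" for r
  proof -
    have "mean_le lam p (d + e) (\<lambda>t. circ f r t + - circ g r t)"
      using r d e by (intro mean_le_add lam p continuous_on_circ cf cg continuous_on_minus)
        (auto simp: mean_le_minus)
    then show ?thesis by (simp add: circ_def[abs_def])
  qed
  then show "Hardy_norm lam p (\<lambda>z. f z - g z) < \<infinity>"
    using d e Hardy_norm_finite_iff[OF lam p lam_analytic_continuous[OF l]]
    by (meson add_pos_pos)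
qed

lemma Hardy_dist_le_iff:
  assumes lam: "0 \<le> lam" and p: "0 < p" and f: "f \<in> Hardy_space lam p" and g: "g \<in> Hardy_space lam p"
    and d: "0 \<le> d"
  shows "Hardy_dist lam p f g \<le> d \<longleftrightarrow> (\<forall>r\<in>{0..<1}. mean_le lam p d (circ (\<lambda>z. f z - g z) r))"
proof -
  define h where "h = enn2real (Hardy_norm lam p (\<lambda>z. f z - g z))"
  have h: "Hardy_norm lam p (\<lambda>z. f z - g z) = ennreal h" "0 \<le> h"
    using Hardy_space_diff(2)[OF lam p f g] by (auto simp: h_def)
  have "Hardy_dist lam p f g \<le> d \<longleftrightarrow>
      Hardy_norm lam p (\<lambda>z. f z - g z) \<le> ennreal (if p < 1 then d powr (1 / enn2real p) else d)"
  proof (cases "p < 1")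
    case True
    then have "p \<noteq> \<infinity>" by auto
    then obtain q where q: "0 < q" "enn2real p = q" using finite_exponent[OF p] by metis
    have "h powr q \<le> d \<longleftrightarrow> h \<le> d powr (1 / q)"
    proof
      assume "h powr q \<le> d"
      then have "(h powr q) powr (1 / q) \<le> d powr (1 / q)" using q by (intro powr_mono2) auto
      then show "h \<le> d powr (1 / q)" using h q by (simp add: powr_powr)
    next
      assume "h \<le> d powr (1 / q)"
      then have "h powr q \<le> (d powr (1 / q)) powr q" using h q by (intro powr_mono2) auto
      then show "h powr q \<le> d" using d q by (simp add: powr_powr)
    qed
    then show ?thesis using True q h by (simp add: Hardy_dist_def)
  next
    case False
    then show ?thesis using h d by (simp add: Hardy_dist_def)
  qed
  then show ?thesis
    using Hardy_norm_le_iff[OF lam p lam_analytic_continuous[OF Hardy_space_diff(1)[OF lam p f g]] d] by blast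
qed

lemma Hardy_dist_nonneg: "0 \<le> Hardy_dist lam p f g"
  by (simp add: Hardy_dist_def)

lemma Hardy_dist_commute: "Hardy_dist lam p f g = Hardy_dist lam p g f"
proof -
  have "Hardy_norm lam p (\<lambda>z. f z - g z) = Hardy_norm lam p (\<lambda>z. g z - f z)"
    unfolding Hardy_norm_def M_mean_def by (simp add: norm_minus_commute)
  then show ?thesis by (simp add: Hardy_dist_def)
qed

lemma Metric_space_Hardy:
  assumes lam: "0 \<le> lam" and p: "0 < p"
  shows "Metric_space (Hardy_space lam p) (Hardy_dist lam p)"
proof
  show "0 \<le> Hardy_dist lam p f g" for f g by (rule Hardy_dist_nonneg)
  show "Hardy_dist lam p f g = Hardy_dist lam p g f" for f g by (rule Hardy_dist_commute)
  fix f g assume f: "f \<in> Hardy_space lam p" and g: "g \<in> Hardy_space lam p"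
  note D = Hardy_dist_le_iff[OF lam p f g]
  show "Hardy_dist lam p f g = 0 \<longleftrightarrow> f = g"
  proof
    assume "f = g"
    then have "mean_le lam p 0 (circ (\<lambda>z. f z - g z) r)" for r
      by (simp add: mean_le_def mass_def circ_def)
    then have "Hardy_dist lam p f g \<le> 0" using D[of 0] by simp
    then show "Hardy_dist lam p f g = 0" using Hardy_dist_nonneg[of lam p f g] by simp
  next
    assume 0: "Hardy_dist lam p f g = 0"
    have "f z = g z" if z: "z \<in> unit_disc" for z
    proof -
      have "norm (f z - g z) \<le> 0 + e" if e: "0 < e" for e
      proof -
        have \<rho>: "norm z < 1" using z by simp
        obtain d where d: "0 < d" and est: "\<And>f w. lam_analytic lam f \<Longrightarrow>
          (\<And>r. r \<in> {0..<1} \<Longrightarrow> mean_le lam p d (circ f r)) \<Longrightarrow> norm w \<le> norm z \<Longrightarrow> norm (f w) \<le> e"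
          by (rule point_estimate[OF lam p \<rho> e]) (rule that; blast)
        have "\<forall>r\<in>{0..<1}. mean_le lam p d (circ (\<lambda>z. f z - g z) r)"
          using D[of d] 0 d by simp
        then show ?thesis
          using est[OF Hardy_space_diff(1)[OF lam p f g], of z] by simp
      qed
      then have "norm (f z - g z) \<le> 0" by (rule field_le_epsilon)
      then show ?thesis by simp
    qed
    moreover have "f \<in> extensional unit_disc" "g \<in> extensional unit_disc"
      using f g by (auto simp: Hardy_space_def)
    ultimately show "f = g" by (intro extensionalityI) auto
  qed
  fix h assume h: "h \<in> Hardy_space lam p"
  show "Hardy_dist lam p f h \<le> Hardy_dist lam p f g + Hardy_dist lam p g h"
  proof (rule field_le_epsilon)
    fix e :: real assume e: "0 < e"
    define a b where "a = Hardy_dist lam p f g + e/2" and "b = Hardy_dist lam p g h + e/2"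
    have ab: "0 < a" "0 < b" using e Hardy_dist_nonneg by (auto simp: a_def b_def add_nonneg_pos)
    have 1: "\<forall>r\<in>{0..<1}. mean_le lam p a (circ (\<lambda>z. f z - g z) r)"
      using Hardy_dist_le_iff[OF lam p f g, of a] ab e by (simp add: a_def)
    have 2: "\<forall>r\<in>{0..<1}. mean_le lam p b (circ (\<lambda>z. g z - h z) r)"
      using Hardy_dist_le_iff[OF lam p g h, of b] ab e by (simp add: b_def)
    have "\<forall>r\<in>{0..<1}. mean_le lam p (a + b) (circ (\<lambda>z. f z - h z) r)"
    proof
      fix r :: real assume r: "r \<in> {0..<1}"
      have "mean_le lam p (a + b) (\<lambda>t. circ (\<lambda>z. f z - g z) r t + circ (\<lambda>z. g z - h z) r t)"
        using 1 2 r
        by (intro mean_le_add lam p ab continuous_on_circ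
            lam_analytic_continuous[OF Hardy_space_diff(1)[OF lam p f g]]
            lam_analytic_continuous[OF Hardy_space_diff(1)[OF lam p g h]]) auto
      then show "mean_le lam p (a + b) (circ (\<lambda>z. f z - h z) r)" by (simp add: circ_def[abs_def])
    qed
    then have "Hardy_dist lam p f h \<le> a + b"
      using Hardy_dist_le_iff[OF lam p f h, of "a + b"] ab by simp
    then show "Hardy_dist lam p f h \<le> Hardy_dist lam p f g + Hardy_dist lam p g h + e"
      by (simp add: a_def b_def)
  qed
qed

theorem theorem5p5:
  fixes lam :: real and p :: ennreal
  assumes "0 \<le> lam"
    and "0 < p"
    and "ennreal (2 * lam / (2 * lam + 1)) \<le> p"
  shows "Metric_space (Hardy_space lam p) (Hardy_dist lam p) \<and>
         Metric_space.mcomplete (Hardy_space lam p) (Hardy_dist lam p)"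
proof
  note lam = assms(1) and p = assms(2)
  show ms: "Metric_space (Hardy_space lam p) (Hardy_dist lam p)"
    by (rule Metric_space_Hardy[OF lam p])
  interpret H: Metric_space "Hardy_space lam p" "Hardy_dist lam p" by (rule ms)
  show "H.mcomplete"
    unfolding H.mcomplete_def
  proof (intro allI impI)
    fix F assume "H.MCauchy F"
    then have FH: "\<And>k. F k \<in> Hardy_space lam p"
      and cau: "\<And>e. 0 < e \<Longrightarrow> \<exists>N. \<forall>n n'. N \<le> n \<longrightarrow> N \<le> n' \<longrightarrow> Hardy_dist lam p (F n) (F n') < e"
      unfolding H.MCauchy_def by auto
    have Fa: "lam_analytic lam (F k)" for k using FH[of k] by (simp add: Hardy_space_def)
    have cF: "continuous_on unit_disc (F k)" for k by (rule lam_analytic_continuous[OF Fa])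
    define f where "f = restrict (\<lambda>z. lim (\<lambda>k. F k z)) unit_disc"
    have lim: "uniform_limit (cball 0 r) F f sequentially" if r: "r < 1" for r
    proof -
      have "uniformly_Cauchy_on (cball 0 r) F"
        unfolding uniformly_Cauchy_on_def
      proof (intro allI impI)
        fix e :: real assume e: "0 < e"
        then have e2: "0 < e / 2" by simp
        obtain d where d: "0 < d" and est: "\<And>f w. lam_analytic lam f \<Longrightarrow>
          (\<And>r. r \<in> {0..<1} \<Longrightarrow> mean_le lam p d (circ f r)) \<Longrightarrow> norm w \<le> r \<Longrightarrow> norm (f w) \<le> e / 2"
          by (rule point_estimate[OF lam p r e2]) (rule that; blast)
        obtain N where N: "\<And>n n'. N \<le> n \<Longrightarrow> N \<le> n' \<Longrightarrow> Hardy_dist lam p (F n) (F n') < d"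
          using cau[OF d] by blast
        show "\<exists>M. \<forall>z\<in>cball 0 r. \<forall>m\<ge>M. \<forall>n\<ge>M. dist (F m z) (F n z) < e"
        proof (intro exI[of _ N] ballI allI impI)
          fix z :: complex and m n assume z: "z \<in> cball 0 r" and mn: "N \<le> m" "N \<le> n"
          have "\<forall>s\<in>{0..<1}. mean_le lam p d (circ (\<lambda>z. F m z - F n z) s)"
            using Hardy_dist_le_iff[OF lam p FH FH, of d m n] N[OF mn] d by simp
          then have "norm (F m z - F n z) \<le> e / 2"
            using est[OF lam_analytic_diff[OF Fa Fa], of m n z] z by simp
          then show "dist (F m z) (F n z) < e" using e by (simp add: dist_norm)
        qed
      qed
      then have "uniformly_convergent_on (cball 0 r) F"
        by (rule Cauchy_uniformly_convergent)
      then have "uniform_limit (cball 0 r) F (\<lambda>z. lim (\<lambda>k. F k z)) sequentially"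
        by (simp add: uniformly_convergent_uniform_limit_iff)
      then show ?thesis
        by (rule uniform_limit_cong'[THEN iffD1, rotated 2]) (use r in \<open>auto simp: f_def\<close>)
    qed
    have fa: "lam_analytic lam f"
      by (rule lam_analytic_limit[where F = F, OF lam Fa lim])
    have cf: "continuous_on unit_disc f" by (rule lam_analytic_continuous[OF fa])
    have close: "\<exists>N. \<forall>n\<ge>N. \<forall>r\<in>{0..<1}. mean_le lam p e (circ (\<lambda>z. F n z - f z) r)" if e: "0 < e" for e
    proof -
      have e2: "0 < e / 2" using e by simp
      obtain N where N: "\<And>n n'. N \<le> n \<Longrightarrow> N \<le> n' \<Longrightarrow> Hardy_dist lam p (F n) (F n') < e / 2"
        using cau[OF e2] by blast
      have "mean_le lam p (e / 2 + e / 2) (circ (\<lambda>z. F n z - f z) r)" if n: "N \<le> n" and r: "r \<in> {0..<1}" for n r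
      proof (rule mean_le_limit[OF lam p _ _ _ _ _ e2 _ e2, where F = "\<lambda>k z. F n z - F k z"])
        show "0 \<le> r" "r < 1" using r by auto
        show "continuous_on unit_disc (\<lambda>z. F n z - F k z)" for k by (intro continuous_intros cF)
        show "continuous_on unit_disc (\<lambda>z. F n z - f z)" by (intro continuous_intros cF cf)
        show "uniform_limit (cball 0 r) (\<lambda>k z. F n z - F k z) (\<lambda>z. F n z - f z) sequentially"
          using r by (intro uniform_limit_intros lim) auto
        show "\<forall>\<^sub>F k in sequentially. mean_le lam p (e / 2) (circ (\<lambda>z. F n z - F k z) r)"
          using eventually_ge_at_top[of N]
        proof eventually_elim
          case (elim k)
          then show ?case
            using Hardy_dist_le_iff[OF lam p FH FH, of "e / 2" n k] N[OF n elim] e r by simp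
        qed
      qed
      then show ?thesis by (intro exI[of _ N]) simp
    qed
    have fH: "f \<in> Hardy_space lam p"
    proof -
      obtain n where n: "\<forall>r\<in>{0..<1}. mean_le lam p 1 (circ (\<lambda>z. F n z - f z) r)"
        using close[of 1] by auto
      obtain d where d: "0 < d" "\<forall>r\<in>{0..<1}. mean_le lam p d (circ (F n) r)"
        using FH[of n] Hardy_norm_finite_iff[OF lam p cF] by (auto simp: Hardy_space_def)
      have "mean_le lam p (d + 1) (circ f r)" if r: "r \<in> {0..<1}" for r
      proof -
        have "mean_le lam p (d + 1) (\<lambda>t. circ (F n) r t + - circ (\<lambda>z. F n z - f z) r t)"
          using r n d by (intro mean_le_add lam p continuous_on_circ cF continuous_on_minus continuous_on_diff cf)
            (auto simp: mean_le_minus)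
        then show ?thesis by (simp add: circ_def[abs_def])
      qed
      then have "Hardy_norm lam p f < \<infinity>"
        using d Hardy_norm_finite_iff[OF lam p cf] by (meson add_pos_pos zero_less_one)
      then show ?thesis using fa by (simp add: Hardy_space_def f_def)
    qed
    have "limitin H.mtopology F f sequentially"
      unfolding H.limit_metric_sequentially
    proof (intro conjI allI impI fH)
      fix e :: real assume e: "0 < e"
      then have e2: "0 < e / 2" by simp
      obtain N where N: "\<And>n. n \<ge> N \<Longrightarrow> \<forall>r\<in>{0..<1}. mean_le lam p (e / 2) (circ (\<lambda>z. F n z - f z) r)"
        using close[OF e2] by blast
      show "\<exists>N. \<forall>n\<ge>N. F n \<in> Hardy_space lam p \<and> Hardy_dist lam p (F n) f < e"
      proof (intro exI[of _ N] allI impI conjI FH)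
        fix n assume "N \<le> n"
        then have "Hardy_dist lam p (F n) f \<le> e / 2"
          using Hardy_dist_le_iff[OF lam p FH fH, of "e / 2" n] N e by simp
        then show "Hardy_dist lam p (F n) f < e" using e by simp
      qed
    qed
    then show "\<exists>f. limitin H.mtopology F f sequentially" by blast
  qed
qed

end
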